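(* Let $\Omega \subset \mathbb{C}^d$ be a smooth strictly pseudo-convex domain, let $\sigma$ be the normalized surface measure on $\partial\Omega$, and let $E \subset L^2(\partial\Omega,\sigma)$ be the linear space of restrictions to $\partial\Omega$ of holomorphic polynomials on $\mathbb{C}^d$. Then $E$ admits a uniformly bounded orthonormal basis: there exist a constant $C<\infty$ and a sequence $(f_n)_{n\ge 1}$ of elements of $E$ which is orthonormal in $L^2(\partial\Omega,\sigma)$, whose closed linear span in $L^2(\partial\Omega,\sigma)$ contains $E$, and such that $\sup_{\zeta\in\partial\Omega}|f_n(\zeta)|\le C$ for all $n$.
   Context: A smooth strictly pseudo-convex domain is understood to be a bounded domain in $\mathbb{C}^d$ with $C^\infty$ boundary that is strictly pseudo-convex. The normalized surface measure $\sigma$ on $\partial\Omega$ is the surface measure rescaled to be a probability measure. A holomorphic polynomial is a polynomial with complex coefficients in the coordinates $\zeta_1,\dots,\zeta_d$. An orthonormal basis of a (not necessarily closed) linear subspace $E$ of a Hilbert space is an orthonormal system of elements of $E$ whose closed linear span contains $E$. *)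

theory Defs
  imports "HOL-Analysis.Analysis"
begin

section \<open>Strictly pseudo-convex domains\<close>

text \<open>\<open>C\<^sup>k\<close> on an open set: all iterated directional derivatives up to order \<open>k\<close> exist as
  Frechet derivatives and are continuous. Only meant for open \<open>S\<close>.\<close>

primrec Ck_on :: "nat \<Rightarrow> ('a::euclidean_space \<Rightarrow> 'b::real_normed_vector) \<Rightarrow> 'a set \<Rightarrow> bool" where
  "Ck_on 0 f S \<longleftrightarrow> continuous_on S f"
| "Ck_on (Suc k) f S \<longleftrightarrow>
     (\<forall>x\<in>S. f differentiable (at x)) \<and> (\<forall>v. Ck_on k (\<lambda>x. frechet_derivative f (at x) v) S)"

definition smooth_on :: "('a::euclidean_space \<Rightarrow> 'b::real_normed_vector) \<Rightarrow> 'a set \<Rightarrow> bool" where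
  "smooth_on f S \<longleftrightarrow> (\<forall>k. Ck_on k f S)"

definition boundary_defining_function ::
  "(complex ^ 'd) set \<Rightarrow> (complex ^ 'd \<Rightarrow> real) \<Rightarrow> bool" where
  "boundary_defining_function \<Omega> \<rho> \<longleftrightarrow>
     (\<exists>U. open U \<and> frontier \<Omega> \<subseteq> U \<and> smooth_on \<rho> U \<and> \<Omega> \<inter> U = {z \<in> U. \<rho> z < 0} \<and>
          (\<forall>p\<in>frontier \<Omega>. frechet_derivative \<rho> (at p) \<noteq> (\<lambda>v. 0)))"

text \<open>The Wirtinger operators \<open>\<partial>/\<partial>z\<^sub>j\<close> and \<open>\<partial>/\<partial>\<bar>z\<^sub>j\<close>; \<open>axis j 1\<close> and \<open>axis j \<i>\<close> are the
  directions of the real coordinates \<open>x\<^sub>j\<close> and \<open>y\<^sub>j\<close>.\<close>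

definition wirtinger :: "'d \<Rightarrow> (complex ^ 'd \<Rightarrow> complex) \<Rightarrow> complex ^ 'd \<Rightarrow> complex" where
  "wirtinger j f z =
     (frechet_derivative f (at z) (axis j 1) - \<i> * frechet_derivative f (at z) (axis j \<i>)) / 2"

definition wirtinger_bar :: "'d \<Rightarrow> (complex ^ 'd \<Rightarrow> complex) \<Rightarrow> complex ^ 'd \<Rightarrow> complex" where
  "wirtinger_bar j f z =
     (frechet_derivative f (at z) (axis j 1) + \<i> * frechet_derivative f (at z) (axis j \<i>)) / 2"

definition complex_tangent_space ::
  "(complex ^ 'd \<Rightarrow> real) \<Rightarrow> complex ^ 'd \<Rightarrow> (complex ^ 'd) set" where
  "complex_tangent_space \<rho> p =
     {w. (\<Sum>j\<in>UNIV. wirtinger j (\<lambda>z. complex_of_real (\<rho> z)) p * w $ j) = 0}"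

text \<open>The Hermitian sum is real for \<open>C\<^sup>2\<close> functions \<open>\<rho>\<close>; \<open>Re\<close> only adjusts the type.\<close>

definition levi_form :: "(complex ^ 'd \<Rightarrow> real) \<Rightarrow> complex ^ 'd \<Rightarrow> complex ^ 'd \<Rightarrow> real" where
  "levi_form \<rho> p w =
     Re (\<Sum>j\<in>UNIV. \<Sum>k\<in>UNIV.
           wirtinger j (wirtinger_bar k (\<lambda>z. complex_of_real (\<rho> z))) p * w $ j * cnj (w $ k))"

definition smooth_strictly_pseudoconvex_domain :: "(complex ^ 'd) set \<Rightarrow> bool" where
  "smooth_strictly_pseudoconvex_domain \<Omega> \<longleftrightarrow>
     open \<Omega> \<and> connected \<Omega> \<and> \<Omega> \<noteq> {} \<and> bounded \<Omega> \<and>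
     (\<exists>\<rho>. boundary_defining_function \<Omega> \<rho> \<and>
          (\<forall>p\<in>frontier \<Omega>. \<forall>w\<in>complex_tangent_space \<rho> p. w \<noteq> 0 \<longrightarrow> levi_form \<rho> p w > 0))"


section \<open>Surface measure\<close>

text \<open>Hausdorff measure of dimension \<open>s > 0\<close>, normalized so as to agree with Lebesgue measure
  on \<open>\<real>\<^sup>s\<close> and with the surface measure on smooth \<open>s\<close>-dimensional submanifolds.
  Boundedness is required explicitly because \<^const>\<open>diameter\<close> is meaningless on unbounded sets.\<close>

definition hausdorff_content :: "real \<Rightarrow> real \<Rightarrow> 'a::metric_space set \<Rightarrow> ennreal" where
  "hausdorff_content s \<delta> A =
     (INF U\<in>{U :: nat \<Rightarrow> 'a set. A \<subseteq> (\<Union>n. U n) \<and> (\<forall>n. bounded (U n) \<and> diameter (U n) \<le> \<delta>)}.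
        \<Sum>n. ennreal (unit_ball_vol s * (diameter (U n) / 2) powr s))"

definition hausdorff_outer_measure :: "real \<Rightarrow> 'a::metric_space set \<Rightarrow> ennreal" where
  "hausdorff_outer_measure s A = (SUP \<delta>\<in>{0<..}. hausdorff_content s \<delta> A)"

definition hausdorff_measure :: "real \<Rightarrow> 'a::metric_space measure" where
  "hausdorff_measure s = measure_of UNIV (sets borel) (hausdorff_outer_measure s)"

definition surface_measure :: "(complex ^ 'd) set \<Rightarrow> (complex ^ 'd) measure" where
  "surface_measure \<Omega> =
     restrict_space (hausdorff_measure (2 * real CARD('d) - 1)) (frontier \<Omega>)"

definition normalized_surface_measure :: "(complex ^ 'd) set \<Rightarrow> (complex ^ 'd) measure" where
  "normalized_surface_measure \<Omega> =
     uniform_measure (surface_measure \<Omega>) (space (surface_measure \<Omega>))"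


section \<open>Square-integrable functions\<close>

definition L2_space :: "'a measure \<Rightarrow> ('a \<Rightarrow> complex) set" where
  "L2_space M = {f \<in> borel_measurable M. integrable M (\<lambda>x. (norm (f x))\<^sup>2)}"

definition L2_inner :: "'a measure \<Rightarrow> ('a \<Rightarrow> complex) \<Rightarrow> ('a \<Rightarrow> complex) \<Rightarrow> complex" where
  "L2_inner M f g = (LINT x|M. f x * cnj (g x))"

definition L2_norm_on :: "'a measure \<Rightarrow> ('a \<Rightarrow> complex) \<Rightarrow> real" where
  "L2_norm_on M f = sqrt (LINT x|M. (norm (f x))\<^sup>2)"

definition L2_orthonormal :: "'a measure \<Rightarrow> (nat \<Rightarrow> 'a \<Rightarrow> complex) \<Rightarrow> bool" where
  "L2_orthonormal M f \<longleftrightarrow>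
     (\<forall>n. f n \<in> L2_space M) \<and> (\<forall>m n. L2_inner M (f m) (f n) = (if m = n then 1 else 0))"

definition L2_closed_span :: "'a measure \<Rightarrow> ('a \<Rightarrow> complex) set \<Rightarrow> ('a \<Rightarrow> complex) set" where
  "L2_closed_span M B =
     {g \<in> L2_space M. \<forall>\<epsilon>>0. \<exists>F c. finite F \<and> F \<subseteq> B \<and>
        L2_norm_on M (\<lambda>x. g x - (\<Sum>f\<in>F. c f * f x)) < \<epsilon>}"


section \<open>Holomorphic polynomials\<close>

text \<open>A multi-index is a function \<open>\<alpha> :: 'd \<Rightarrow> nat\<close>.\<close>

definition holomorphic_polynomial :: "(complex ^ 'd \<Rightarrow> complex) \<Rightarrow> bool" where
  "holomorphic_polynomial p \<longleftrightarrow>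
     (\<exists>A c. finite (A :: ('d \<Rightarrow> nat) set) \<and>
        p = (\<lambda>z. \<Sum>\<alpha>\<in>A. c \<alpha> * (\<Prod>j\<in>UNIV. (z $ j) ^ \<alpha> j)))"

text \<open>Functions on \<open>\<partial>\<Omega>\<close> are represented by functions on the whole space whose values off \<open>\<partial>\<Omega>\<close>
  are irrelevant: \<open>\<partial>\<Omega>\<close> is the underlying space of \<open>normalized_surface_measure \<Omega>\<close>.\<close>

definition boundary_polynomials :: "(complex ^ 'd) set \<Rightarrow> (complex ^ 'd \<Rightarrow> complex) set" where
  "boundary_polynomials \<Omega> =
     {f. \<exists>p. holomorphic_polynomial p \<and> (\<forall>\<zeta>\<in>frontier \<Omega>. f \<zeta> = p \<zeta>)}"

end

theory Submission
  imports Defs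
begin

text \<open>At a point \<open>q\<close> of \<open>\<partial>\<Omega>\<close> that is farthest from some \<open>a\<close> in the unit ball, \<open>\<Omega>\<close> is enclosed by a ball
  touching \<open>\<partial>\<Omega>\<close> at \<open>q\<close>. The set \<open>V\<close> of these points has positive surface measure: the Lipschitz map
  \<open>(q, t) \<mapsto> q - t \<nabla>\<rho>(q)\<close> sends \<open>V \<times> [0, T]\<close> onto a set containing the unit ball. The linear polynomial
  \<open>L\<^sub>q(z) = \<langle>q - z, q - a\<rangle>\<close> satisfies \<open>Re L\<^sub>q(z) \<ge> |z - q|\<^sup>2 / 2\<close> on \<open>\<partial>\<Omega>\<close>, with a matching upper bound
  on \<open>V\<close>, so \<open>(1 - L\<^sub>q / K)\<^sup>N\<close> is a peak of width \<open>N\<^sup>-\<^sup>1\<^sup>/\<^sup>2\<close> in all directions. Sums of peaks over a net of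
  mesh \<open>N\<^sup>-\<^sup>1\<^sup>/\<^sup>2\<close> in \<open>V\<close> with suitable signs are bounded, have \<open>L\<^sup>2\<close> norm bounded below, and become
  orthogonal to any fixed finite set as \<open>N \<rightarrow> \<infinity>\<close>. Hence every finite orthonormal set of polynomials is
  extended by one uniformly bounded polynomial. Mixing an arbitrary unit vector with many of these by Haar
  matrices spreads it over uniformly bounded vectors, which gives the basis.\<close>

section \<open>Hausdorff measure\<close>

text \<open>The obstacle is the uniform constant: Gram-Schmidt on the monomials controls no
  sup-norm. Analysis and algebra are therefore separated. The analysis supplies, for every finite
  orthonormal \<open>S\<close>, however large its members, a further unit vector orthogonal to
  \<open>S\<close> whose bound \<open>C\<close> is independent of \<open>S\<close>; the algebra
  turns this into a basis bounded by \<open>(1 + sqrt 2) * C + 1\<close>, although it meets vectors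
  of large sup-norm on the way. Peaks are centred only on \<open>V\<close>, where a real quadratic
  inequality valid on the whole boundary controls a complex affine function. Since only an L2 norm
  has to stay away from zero, positive measure of \<open>V\<close> is enough. The signs do not make
  a sum of peaks exactly orthogonal to \<open>S\<close>; they keep its projection onto the span of
  \<open>S\<close> small, in L2 and in sup-norm, and the projection is then subtracted. The total
  mass of the boundary has to be nonzero, which \<open>V\<close> ensures, and finite, because the
  boundary is locally a Lipschitz graph; otherwise the normalized measure would be zero.\<close>

lemma hausdorff_content_le_cover:
  assumes "A \<subseteq> (\<Union>n. U n)" "\<And>n. bounded (U n)" "\<And>n. diameter (U n) \<le> \<delta>"
  shows "hausdorff_content s \<delta> A \<le> (\<Sum>n. ennreal (unit_ball_vol s * (diameter (U n) / 2) powr s))"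
  unfolding hausdorff_content_def by (rule INF_lower) (use assms in auto)

lemma hausdorff_content_less_cover:
  assumes "hausdorff_content s \<delta> A < c"
  shows "\<exists>U. A \<subseteq> (\<Union>n. U n) \<and> (\<forall>n. bounded (U n)) \<and> (\<forall>n. diameter (U n) \<le> \<delta>) \<and>
    (\<Sum>n. ennreal (unit_ball_vol s * (diameter (U n) / 2) powr s)) < c"
  using assms unfolding hausdorff_content_def INF_less_iff by blast

lemma hausdorff_content_mono: "A \<subseteq> B \<Longrightarrow> hausdorff_content s \<delta> A \<le> hausdorff_content s \<delta> B"
  unfolding hausdorff_content_def by (rule INF_superset_mono) auto

lemma hausdorff_content_antimono:
  "\<delta> \<le> \<delta>' \<Longrightarrow> hausdorff_content s \<delta>' A \<le> hausdorff_content s \<delta> A"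
  unfolding hausdorff_content_def by (rule INF_superset_mono) (auto intro: order_trans)

lemma hausdorff_content_le_diameter:
  assumes "bounded A" "diameter A \<le> \<delta>" "0 \<le> \<delta>"
  shows "hausdorff_content s \<delta> A \<le> ennreal (unit_ball_vol s * (diameter A / 2) powr s)"
proof -
  have "hausdorff_content s \<delta> A \<le>
      (\<Sum>n. ennreal (unit_ball_vol s * (diameter (if n = 0 then A else {}) / 2) powr s))"
    by (rule hausdorff_content_le_cover) (use assms in auto)
  also have "\<dots> = ennreal (unit_ball_vol s * (diameter A / 2) powr s)"
    by (subst suminf_finite[of "{0}"]) auto
  finally show ?thesis .
qed

lemma hausdorff_content_empty [simp]: "0 \<le> \<delta> \<Longrightarrow> hausdorff_content s \<delta> {} = 0"
  using hausdorff_content_le_diameter[of "{}" \<delta> s] by simp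

lemma hausdorff_content_countably_subadditive:
  "hausdorff_content s \<delta> (\<Union>i. A i) \<le> (\<Sum>i. hausdorff_content s \<delta> (A i))"
proof (cases "(\<Sum>i. hausdorff_content s \<delta> (A i)) = \<infinity>")
  case False
  let ?t = "\<lambda>X. ennreal (unit_ball_vol s * (diameter X / 2) powr s)"
  have fin: "hausdorff_content s \<delta> (A i) < \<infinity>" for i
  proof (rule ccontr)
    assume "\<not> hausdorff_content s \<delta> (A i) < \<infinity>"
    moreover have "hausdorff_content s \<delta> (A i) \<le> (\<Sum>i. hausdorff_content s \<delta> (A i))"
      using sum_le_suminf[of "\<lambda>i. hausdorff_content s \<delta> (A i)" "{i}"] by simp
    ultimately show False using False by (simp add: top_unique less_top[symmetric])
  qed
  show ?thesis
  proof (rule ennreal_le_epsilon)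
    fix e :: real assume e: "0 < e"
    have "\<exists>U. A i \<subseteq> (\<Union>n. U n) \<and> (\<forall>n. bounded (U n)) \<and> (\<forall>n. diameter (U n) \<le> \<delta>) \<and>
        (\<Sum>n. ?t (U n)) < hausdorff_content s \<delta> (A i) + ennreal (e * (1/2)^Suc i)" for i
    proof -
      have "hausdorff_content s \<delta> (A i) < hausdorff_content s \<delta> (A i) + ennreal (e * (1/2)^Suc i)"
        using ennreal_add_left_cancel_less[of "hausdorff_content s \<delta> (A i)" 0 "ennreal (e * (1/2)^Suc i)"]
          fin[of i] e by (simp add: ennreal_less_zero_iff less_top)
      then show ?thesis by (rule hausdorff_content_less_cover)
    qed
    then have U_ex: "\<forall>i. \<exists>U. A i \<subseteq> (\<Union>n. U n) \<and> (\<forall>n. bounded (U n)) \<and> (\<forall>n. diameter (U n) \<le> \<delta>) \<and>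
        (\<Sum>n. ?t (U n)) < hausdorff_content s \<delta> (A i) + ennreal (e * (1/2)^Suc i)" ..
    obtain U where "\<forall>i. A i \<subseteq> (\<Union>n. U i n) \<and> (\<forall>n. bounded (U i n)) \<and> (\<forall>n. diameter (U i n) \<le> \<delta>) \<and>
        (\<Sum>n. ?t (U i n)) < hausdorff_content s \<delta> (A i) + ennreal (e * (1/2)^Suc i)"
      using choice[OF U_ex] by (elim exE)
    then have U: "\<And>i. A i \<subseteq> (\<Union>n. U i n)" "\<And>i n. bounded (U i n)"
      "\<And>i n. diameter (U i n) \<le> \<delta>"
      "\<And>i. (\<Sum>n. ?t (U i n)) < hausdorff_content s \<delta> (A i) + ennreal (e * (1/2)^Suc i)"
      by iprover+
    define W where "W = (\<lambda>n. case prod_decode n of (i, j) \<Rightarrow> U i j)"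
    have "(\<Union>i. A i) \<subseteq> (\<Union>n. W n)"
    proof
      fix x assume "x \<in> (\<Union>i. A i)"
      then obtain i j where "x \<in> U i j" using U(1) by blast
      then have "x \<in> W (prod_encode (i, j))" by (simp add: W_def)
      then show "x \<in> (\<Union>n. W n)" by blast
    qed
    then have "hausdorff_content s \<delta> (\<Union>i. A i) \<le> (\<Sum>n. ?t (W n))"
      by (rule hausdorff_content_le_cover) (auto simp: W_def U split: prod.split)
    also have "\<dots> = (\<Sum>n. (\<lambda>(i, j). ?t (U i j)) (prod_decode n))"
      by (intro suminf_cong) (auto simp: W_def split: prod.split)
    also have "\<dots> = (\<Sum>i. \<Sum>j. ?t (U i j))"
      by (rule suminf_ennreal_2dimen) simp
    also have "\<dots> \<le> (\<Sum>i. hausdorff_content s \<delta> (A i) + ennreal (e * (1/2)^Suc i))"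
      using U(4) by (intro suminf_le summableI) (auto simp: less_imp_le)
    also have "\<dots> = (\<Sum>i. hausdorff_content s \<delta> (A i)) + (\<Sum>i. ennreal (e * (1/2)^Suc i))"
      by (rule suminf_add[symmetric]) (rule summableI)+
    also have "(\<Sum>i. ennreal (e * (1/2)^Suc i)) = ennreal e"
      using power_half_series[THEN sums_mult, of e] e
      by (intro suminf_ennreal_eq) auto
    finally show "hausdorff_content s \<delta> (\<Union>i. A i) \<le> (\<Sum>i. hausdorff_content s \<delta> (A i)) + ennreal e" .
  qed
qed simp

section \<open>Hausdorff outer measure and Caratheodory measurability of Borel sets\<close>

lemma hausdorff_content_le_outer_measure:
  "0 < \<delta> \<Longrightarrow> hausdorff_content s \<delta> A \<le> hausdorff_outer_measure s A"
  unfolding hausdorff_outer_measure_def by (rule SUP_upper) simp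

lemma hausdorff_outer_measure_mono:
  "A \<subseteq> B \<Longrightarrow> hausdorff_outer_measure s A \<le> hausdorff_outer_measure s B"
  unfolding hausdorff_outer_measure_def by (rule SUP_mono') (rule hausdorff_content_mono)

lemma hausdorff_outer_measure_empty [simp]: "hausdorff_outer_measure s {} = 0"
  unfolding hausdorff_outer_measure_def by (simp add: SUP_constant)

lemma hausdorff_outer_measure_countably_subadditive:
  "hausdorff_outer_measure s (\<Union>i. A i) \<le> (\<Sum>i. hausdorff_outer_measure s (A i))"
  unfolding hausdorff_outer_measure_def[of s "\<Union>i. A i"]
proof (rule SUP_least)
  fix \<delta> :: real assume "\<delta> \<in> {0<..}"
  then show "hausdorff_content s \<delta> (\<Union>i. A i) \<le> (\<Sum>i. hausdorff_outer_measure s (A i))"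
    by (intro order_trans[OF hausdorff_content_countably_subadditive] suminf_le summableI
        hausdorff_content_le_outer_measure) auto
qed

lemma outer_measure_space_hausdorff: "outer_measure_space UNIV (hausdorff_outer_measure s)"
  unfolding outer_measure_space_def positive_def increasing_def countably_subadditive_def
  using hausdorff_outer_measure_mono hausdorff_outer_measure_countably_subadditive by auto

lemma hausdorff_outer_measure_Un_le:
  "hausdorff_outer_measure s (A \<union> B) \<le> hausdorff_outer_measure s A + hausdorff_outer_measure s B"
proof -
  have "A \<union> B = (\<Union>i::nat. if i = 0 then A else if i = 1 then B else {})"
    by (auto split: if_splits)
  then have "hausdorff_outer_measure s (A \<union> B) \<le>
     (\<Sum>i::nat. hausdorff_outer_measure s (if i = 0 then A else if i = 1 then B else {}))"
    by (simp only: hausdorff_outer_measure_countably_subadditive)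
  also have "\<dots> = hausdorff_outer_measure s A + hausdorff_outer_measure s B"
    by (subst suminf_finite[of "{0,1}"]) auto
  finally show ?thesis .
qed

lemma hausdorff_outer_measure_singleton:
  assumes "0 < s"
  shows "hausdorff_outer_measure s {x} = 0"
proof -
  have "hausdorff_content s \<delta> {x} = 0" if "0 < \<delta>" for \<delta>
    using hausdorff_content_le_diameter[of "{x}" \<delta> s] that by simp
  then show ?thesis unfolding hausdorff_outer_measure_def by (simp add: SUP_constant)
qed

text \<open>A cover by sets of diameter below \<open>e\<close> splits into the sets meeting
  \<open>A\<close> and those meeting \<open>B\<close>, since none meets both. Additivity over sets
  at positive distance is Caratheodory's criterion for Borel sets to be measurable.\<close>

lemma hausdorff_outer_measure_separated:
  assumes e: "0 < e" and sep: "\<And>x y. x \<in> A \<Longrightarrow> y \<in> B \<Longrightarrow> e \<le> dist x y"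
  shows "hausdorff_outer_measure s A + hausdorff_outer_measure s B \<le> hausdorff_outer_measure s (A \<union> B)"
proof -
  let ?t = "\<lambda>X. ennreal (unit_ball_vol s * (diameter X / 2) powr s)"
  have small: "hausdorff_content s \<delta> A + hausdorff_content s \<delta> B \<le> hausdorff_content s \<delta> (A \<union> B)"
    if \<delta>: "0 < \<delta>" "\<delta> < e" for \<delta>
    unfolding hausdorff_content_def[of s \<delta> "A \<union> B"]
  proof (rule INF_greatest, clarify)
    fix U :: "nat \<Rightarrow> 'a set"
    assume U: "A \<union> B \<subseteq> (\<Union>n. U n)" "\<forall>n. bounded (U n) \<and> diameter (U n) \<le> \<delta>"
    let ?P = "\<lambda>X n. if U n \<inter> X = {} then {} else U n"
    have disj: "U n \<inter> A = {} \<or> U n \<inter> B = {}" for n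
    proof (rule ccontr)
      assume "\<not> (U n \<inter> A = {} \<or> U n \<inter> B = {})"
      then obtain x y where xy: "x \<in> U n" "x \<in> A" "y \<in> U n" "y \<in> B" by blast
      then have "dist x y \<le> diameter (U n)" using U(2) by (intro diameter_bounded_bound) auto
      with sep[OF xy(2,4)] U(2) \<delta>(2) show False by (meson leD le_less_trans order_trans)
    qed
    have "hausdorff_content s \<delta> X \<le> (\<Sum>n. ?t (?P X n))" if XU: "X \<subseteq> (\<Union>n. U n)" for X
    proof (rule hausdorff_content_le_cover)
      show "X \<subseteq> (\<Union>n. ?P X n)"
      proof
        fix x assume "x \<in> X"
        then obtain n where "x \<in> U n" using XU by blast
        then have "x \<in> ?P X n" using \<open>x \<in> X\<close> by auto
        then show "x \<in> (\<Union>n. ?P X n)" by blast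
      qed
    qed (use U \<delta> in auto)
    then have "hausdorff_content s \<delta> A + hausdorff_content s \<delta> B \<le> (\<Sum>n. ?t (?P A n)) + (\<Sum>n. ?t (?P B n))"
      using U(1) by (intro add_mono) auto
    also have "\<dots> = (\<Sum>n. ?t (?P A n) + ?t (?P B n))"
      by (intro suminf_add summableI)
    also have "\<dots> \<le> (\<Sum>n. ?t (U n))"
    proof (intro suminf_le summableI)
      fix n show "?t (?P A n) + ?t (?P B n) \<le> ?t (U n)" using disj[of n] by auto
    qed
    finally show "hausdorff_content s \<delta> A + hausdorff_content s \<delta> B \<le> (\<Sum>n. ?t (U n))" .
  qed
  have "hausdorff_content s \<delta> A + hausdorff_content s \<delta>' B \<le> hausdorff_outer_measure s (A \<union> B)"
    if "0 < \<delta>" "0 < \<delta>'" for \<delta> \<delta>'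
  proof -
    \<comment> \<open>The two suprema run over independent scales. The content grows as the scale
      shrinks, so one common scale below \<open>e\<close> dominates both.\<close>
    define \<eta> where "\<eta> = min (min \<delta> \<delta>') (e / 2)"
    have \<eta>: "0 < \<eta>" "\<eta> < e" "\<eta> \<le> \<delta>" "\<eta> \<le> \<delta>'" using that e by (auto simp: \<eta>_def)
    have "hausdorff_content s \<delta> A + hausdorff_content s \<delta>' B \<le> hausdorff_content s \<eta> A + hausdorff_content s \<eta> B"
      using \<eta> by (intro add_mono hausdorff_content_antimono)
    also have "\<dots> \<le> hausdorff_content s \<eta> (A \<union> B)" using small \<eta> by simp
    also have "\<dots> \<le> hausdorff_outer_measure s (A \<union> B)"
      using \<eta> by (rule_tac hausdorff_content_le_outer_measure)
    finally show ?thesis .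
  qed
  then have "hausdorff_outer_measure s A + hausdorff_content s \<delta>' B \<le> hausdorff_outer_measure s (A \<union> B)"
    if "0 < \<delta>'" for \<delta>'
    unfolding hausdorff_outer_measure_def[of s A]
    using that by (subst ennreal_SUP_add_left[symmetric]) (auto intro!: SUP_least)
  then show ?thesis
    unfolding hausdorff_outer_measure_def[of s B]
    by (subst ennreal_SUP_add_right) (auto intro!: SUP_least)
qed

text \<open>Caratheodory's argument. The points of \<open>A\<close> at distance at least 1 / (n + 1)
  from \<open>C\<close> are additive with \<open>A \<inter> C\<close>; the rest of
  \<open>A - C\<close> is a union of thin shells \<open>R k\<close>, k >= n. Shells of equal parity
  are separated from each other, so the measures of all shells sum to at most twice that of
  \<open>A\<close>, and the tail of this convergent series tends to 0.\<close>

lemma closed_in_lambda_system_hausdorff: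
  fixes C :: "'a::metric_space set"
  assumes "closed C"
  shows "C \<in> lambda_system UNIV UNIV (hausdorff_outer_measure s)"
proof (cases "C = {}")
  case False
  let ?H = "hausdorff_outer_measure s :: 'a set \<Rightarrow> ennreal"
  have main: "?H (A \<inter> C) + ?H (A - C) \<le> ?H A" if fin: "?H A < \<infinity>" for A
  proof -
    define R where "R = (\<lambda>k::nat. {x \<in> A. 1 / real (k + 2) \<le> infdist x C \<and> infdist x C < 1 / real (k + 1)})"
    have sep: "?H X + ?H Y \<le> ?H (X \<union> Y)"
      if "\<And>x. x \<in> X \<Longrightarrow> a \<le> infdist x C" "\<And>y. y \<in> Y \<Longrightarrow> infdist y C \<le> b" "b < a" for X Y a b
    proof (rule hausdorff_outer_measure_separated)
      show "0 < a - b" using that by simp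
      fix x y assume "x \<in> X" "y \<in> Y"
      with that(1,2) have "a \<le> infdist x C" "infdist y C \<le> b" by auto
      with infdist_triangle_abs[of x C y] show "a - b \<le> dist x y" by linarith
    qed
    \<comment> \<open>\<open>c\<close> selects the parity. The shells before index 2n + c stay at
      distance at least 1 / (2n + c) from \<open>C\<close>, the shell 2n + c stays below 1 / (2n + c
      + 1). For n = 0 the union is empty, which also avoids the value 1 / 0.\<close>
    have part: "(\<Sum>i<n. ?H (R (2 * i + c))) \<le> ?H (\<Union>i<n. R (2 * i + c))" for n c
    proof (induction n)
      case (Suc n)
      have "(\<Sum>i<Suc n. ?H (R (2 * i + c))) \<le> ?H (\<Union>i<n. R (2 * i + c)) + ?H (R (2 * n + c))"
        using Suc by (simp add: add_right_mono)
      also have "\<dots> \<le> ?H ((\<Union>i<n. R (2 * i + c)) \<union> R (2 * n + c))"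
      proof (cases "n = 0")
        case False
        show ?thesis
        proof (rule sep)
          fix x assume "x \<in> (\<Union>i<n. R (2 * i + c))"
          then obtain i where "i < n" "1 / real (2 * i + c + 2) \<le> infdist x C" by (auto simp: R_def)
          moreover have "1 / real (2 * n + c) \<le> 1 / real (2 * i + c + 2)"
            using \<open>i < n\<close> by (intro divide_left_mono) auto
          ultimately show "1 / real (2 * n + c) \<le> infdist x C" by linarith
        next
          fix x assume "x \<in> R (2 * n + c)"
          then show "infdist x C \<le> 1 / real (2 * n + c + 1)" by (auto simp: R_def)
        next
          show "1 / real (2 * n + c + 1) < 1 / real (2 * n + c)"
            using False by (intro divide_strict_left_mono) auto
        qed
      qed simp
      also have "(\<Union>i<n. R (2 * i + c)) \<union> R (2 * n + c) = (\<Union>i<Suc n. R (2 * i + c))"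
        by (auto simp: less_Suc_eq)
      finally show ?case .
    qed simp
    have part': "(\<Sum>i<n. ?H (R (2 * i + c))) \<le> ?H A" for n c
      by (rule order_trans[OF part]) (auto simp: R_def intro!: hausdorff_outer_measure_mono)
    have "(\<Sum>k<n. ?H (R k)) \<le> ?H A + ?H A" for n
    proof -
      have "(\<Sum>k<n. ?H (R k)) \<le> (\<Sum>k<2*n. ?H (R k))"
        by (rule sum_mono2) auto
      also have "\<dots> = (\<Sum>i<n. ?H (R (2 * i + 0))) + (\<Sum>i<n. ?H (R (2 * i + 1)))"
        by (induction n) (auto simp: algebra_simps)
      also have "\<dots> \<le> ?H A + ?H A" by (intro add_mono part')
      finally show ?thesis .
    qed
    then have "(\<Sum>k. ?H (R k)) \<le> ?H A + ?H A"
      by (intro suminf_le_const summableI)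
    then have S: "(\<Sum>k. ?H (R k)) < \<infinity>"
      by (rule le_less_trans) (use fin in simp)
    \<comment> \<open>The partial sum on the left replaces a subtraction in \<open>ennreal\<close>:
      it completes the tail to the full series, which is finite by \<open>S\<close> and is cancelled
      at the end.\<close>
    have "?H (A \<inter> C) + ?H (A - C) + (\<Sum>k<n. ?H (R k)) \<le> ?H A + (\<Sum>k. ?H (R k))" for n
    proof -
      define B where "B = {x \<in> A. 1 / real (n + 1) \<le> infdist x C}"
      have "A - C \<subseteq> B \<union> (\<Union>k. R (k + n))"
      proof
        fix x assume x: "x \<in> A - C"
        have d: "0 < infdist x C"
          using in_closed_iff_infdist_zero[OF assms False, of x] x infdist_nonneg[of x C] by force
        show "x \<in> B \<union> (\<Union>k. R (k + n))"
        proof (cases "x \<in> B")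
          case False
          define m where "m = (LEAST m. 1 / real (m + 1) \<le> infdist x C)"
          obtain m' where "inverse (real (Suc m')) < infdist x C" using reals_Archimedean[OF d] by auto
          then have ex: "1 / real (m' + 1) \<le> infdist x C" by (simp add: field_simps)
          have m: "1 / real (m + 1) \<le> infdist x C" unfolding m_def by (rule LeastI) (rule ex)
          have nm: "n < m"
          proof (rule ccontr)
            assume "\<not> n < m"
            then have "1 / real (n + 1) \<le> 1 / real (m + 1)" by (intro divide_left_mono) auto
            with m False x show False by (auto simp: B_def)
          qed
          have "\<not> 1 / real (m - 1 + 1) \<le> infdist x C"
            using not_less_Least[of "m - 1" "\<lambda>m. 1 / real (m + 1) \<le> infdist x C"] nm
            unfolding m_def[symmetric] by auto
          then have "x \<in> R ((m - 1 - n) + n)" using nm m x by (auto simp: R_def)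
          then show ?thesis by blast
        qed simp
      qed
      then have "?H (A - C) \<le> ?H B + (\<Sum>k. ?H (R (k + n)))"
        by (rule order_trans[OF hausdorff_outer_measure_mono order_trans[OF hausdorff_outer_measure_Un_le
              add_left_mono[OF hausdorff_outer_measure_countably_subadditive]]])
      moreover have "?H B + ?H (A \<inter> C) \<le> ?H A"
      proof -
        have "?H B + ?H (A \<inter> C) \<le> ?H (B \<union> (A \<inter> C))"
          by (rule sep[of _ "1 / real (n+1)" _ 0]) (auto simp: B_def)
        also have "\<dots> \<le> ?H A" by (rule hausdorff_outer_measure_mono) (auto simp: B_def)
        finally show ?thesis .
      qed
      ultimately have "?H (A \<inter> C) + ?H (A - C) + (\<Sum>k<n. ?H (R k)) \<le>
          ?H (A \<inter> C) + (?H B + (\<Sum>k. ?H (R (k + n)))) + (\<Sum>k<n. ?H (R k))"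
        by (intro add_mono order_refl)
      also have "\<dots> = (?H B + ?H (A \<inter> C)) + ((\<Sum>k. ?H (R (k + n))) + (\<Sum>k<n. ?H (R k)))"
        by (simp add: ac_simps)
      also have "(\<Sum>k. ?H (R (k + n))) + (\<Sum>k<n. ?H (R k)) = (\<Sum>k. ?H (R k))"
        by (rule suminf_offset[symmetric, OF summableI])
      also have "(?H B + ?H (A \<inter> C)) + (\<Sum>k. ?H (R k)) \<le> ?H A + (\<Sum>k. ?H (R k))"
        by (rule add_right_mono) fact
      finally show ?thesis .
    qed
    then have "(SUP n. ?H (A \<inter> C) + ?H (A - C) + (\<Sum>k<n. ?H (R k))) \<le> ?H A + (\<Sum>k. ?H (R k))"
      by (rule SUP_least)
    then have "?H (A \<inter> C) + ?H (A - C) + (\<Sum>k. ?H (R k)) \<le> ?H A + (\<Sum>k. ?H (R k))"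
      unfolding suminf_eq_SUP by (subst ennreal_SUP_add_right) auto
    then show ?thesis
      using S by (auto simp: add.commute[of _ "\<Sum>k. ?H (R k)"] ennreal_add_left_cancel_le)
  qed
  have "?H (C \<inter> A) + ?H ((UNIV - C) \<inter> A) = ?H A" for A
  proof (rule antisym)
    have eq: "(UNIV - C) \<inter> A = A - C" "C \<inter> A = A \<inter> C" by auto
    show "?H (C \<inter> A) + ?H ((UNIV - C) \<inter> A) \<le> ?H A"
      unfolding eq using main[of A] by (cases "?H A = \<infinity>") (auto simp: less_top)
    show "?H A \<le> ?H (C \<inter> A) + ?H ((UNIV - C) \<inter> A)"
      using hausdorff_outer_measure_Un_le[of s "C \<inter> A" "(UNIV - C) \<inter> A"]
      by (simp add: eq Int_Diff_Un)
  qed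
  then show ?thesis by (simp add: lambda_system_def)
qed (simp add: lambda_system_def)

text \<open>\<open>measure_of\<close> yields the zero measure unless its set function is countably
  additive on the generated sigma-algebra, so this is what gives \<open>hausdorff_measure\<close>
  its intended values.\<close>

lemma measure_space_hausdorff:
  "measure_space UNIV (sets (borel :: 'a::metric_space measure)) (hausdorff_outer_measure s)"
proof -
  let ?L = "lambda_system UNIV UNIV (hausdorff_outer_measure s) :: 'a set set"
  interpret sigma_algebra UNIV "UNIV :: 'a set set" using sigma_algebra_Pow[of UNIV] by simp
  have ms: "measure_space UNIV ?L (hausdorff_outer_measure s)"
    by (rule caratheodory_lemma[OF outer_measure_space_hausdorff])
  have "sigma_sets UNIV (Collect closed) \<subseteq> ?L"
  proof (rule sigma_algebra.sigma_sets_subset)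
    show "sigma_algebra UNIV ?L" using ms unfolding measure_space_def by (elim conjE)
    show "Collect closed \<subseteq> ?L" using closed_in_lambda_system_hausdorff by blast
  qed
  moreover have "sets (borel :: 'a measure) = sigma_sets UNIV (Collect closed)"
    unfolding borel_eq_closed by simp
  ultimately have "sets borel \<subseteq> ?L" by simp
  then show ?thesis
    using sets.sigma_algebra_axioms[of "borel :: 'a measure"] by (intro measure_down[OF ms]) simp_all
qed

lemma space_hausdorff_measure [simp]: "space (hausdorff_measure s) = UNIV"
  by (simp add: hausdorff_measure_def space_measure_of_conv)

lemma sets_hausdorff_measure [simp, measurable_cong]: "sets (hausdorff_measure s) = sets borel"
  unfolding hausdorff_measure_def by (metis sets.sets_measure_of_eq space_borel)

lemma emeasure_hausdorff_measure:
  "A \<in> sets borel \<Longrightarrow> emeasure (hausdorff_measure s) A = hausdorff_outer_measure s A"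
  using measure_space_hausdorff[where 'a='a] unfolding hausdorff_measure_def
  by (intro emeasure_measure_of_sigma) (auto simp: measure_space_def)

section \<open>Finite measure of Lipschitz graphs, and Lipschitz images of null sets\<close>

lemma hausdorff_content_Un_le:
  assumes "0 \<le> \<delta>"
  shows "hausdorff_content s \<delta> (A \<union> B) \<le> hausdorff_content s \<delta> A + hausdorff_content s \<delta> B"
proof -
  have "A \<union> B = (\<Union>i::nat. if i = 0 then A else if i = 1 then B else {})"
    by (auto split: if_splits)
  then have "hausdorff_content s \<delta> (A \<union> B) \<le>
     (\<Sum>i::nat. hausdorff_content s \<delta> (if i = 0 then A else if i = 1 then B else {}))"
    by (simp only: hausdorff_content_countably_subadditive)
  also have "\<dots> = hausdorff_content s \<delta> A + hausdorff_content s \<delta> B"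
    using assms by (subst suminf_finite[of "{0,1}"]) auto
  finally show ?thesis .
qed

lemma hausdorff_content_finite_UN_le:
  assumes "0 \<le> \<delta>" "finite I"
  shows "hausdorff_content s \<delta> (\<Union>i\<in>I. W i) \<le> (\<Sum>i\<in>I. hausdorff_content s \<delta> (W i))"
  using assms(2)
proof (induction I)
  case empty
  then show ?case using assms(1) by simp
next
  case (insert i I)
  have "hausdorff_content s \<delta> (\<Union>i\<in>insert i I. W i) \<le> hausdorff_content s \<delta> (W i) + hausdorff_content s \<delta> (\<Union>i\<in>I. W i)"
    using hausdorff_content_Un_le[OF assms(1)] by simp
  also have "\<dots> \<le> hausdorff_content s \<delta> (W i) + (\<Sum>i\<in>I. hausdorff_content s \<delta> (W i))"
    by (intro add_left_mono insert.IH)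
  finally show ?case using insert by simp
qed

lemma hausdorff_outer_measure_finite_UN:
  assumes "finite I" "\<And>i. i \<in> I \<Longrightarrow> hausdorff_outer_measure s (W i) < \<infinity>"
  shows "hausdorff_outer_measure s (\<Union>i\<in>I. W i) < \<infinity>"
  using assms
proof (induction I)
  case (insert i I)
  have "hausdorff_outer_measure s (\<Union>i\<in>insert i I. W i) \<le>
      hausdorff_outer_measure s (W i) + hausdorff_outer_measure s (\<Union>i\<in>I. W i)"
    using hausdorff_outer_measure_Un_le by simp
  also have "\<dots> < \<infinity>" using insert by simp
  finally show ?case .
qed simp

lemma powr_eq_power: "0 \<le> x \<Longrightarrow> 0 < m \<Longrightarrow> x powr real m = x ^ m"
  by (cases "x = 0") (auto simp: powr_realpow)

text \<open>By \<open>proj\<close> the set is a Lipschitz graph over the \<open>m\<close>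
  coordinates other than \<open>b\<close>. A grid of mesh 1 / k in these coordinates cuts it into at
  most (2kM + 2)^m pieces of diameter at most C m / k, so the powers of k cancel in the Hausdorff
  sums.\<close>

lemma hausdorff_outer_measure_finite_projection:
  fixes A :: "'a::euclidean_space set"
  assumes b: "b \<in> Basis" and bA: "bounded A" and m: "DIM('a) = Suc m" "0 < m" and C: "0 \<le> C"
    and proj: "\<And>x y. x \<in> A \<Longrightarrow> y \<in> A \<Longrightarrow> dist x y \<le> C * (\<Sum>b'\<in>Basis - {b}. \<bar>(x - y) \<bullet> b'\<bar>)"
  shows "hausdorff_outer_measure (real m) A < \<infinity>"
proof -
  let ?B = "Basis - {b}"
  have cB: "card ?B = m" using b m by simp
  obtain M0 where M0: "\<And>x. x \<in> A \<Longrightarrow> norm x \<le> M0" using bA by (auto simp: bounded_iff)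
  obtain M :: nat where M: "M0 \<le> real M" using real_arch_simple by blast
  have bnd: "\<bar>x \<bullet> b'\<bar> \<le> real M" if "x \<in> A" "b' \<in> ?B" for x b'
    using Basis_le_norm[of b' x] M0[OF that(1)] M that(2) by auto
  let ?X = "unit_ball_vol (real m) * (((2 * real M + 2) * C * real m)) ^ m"
  have "hausdorff_content (real m) \<delta> A \<le> ennreal ?X" if \<delta>: "0 < \<delta>" for \<delta>
  proof -
    obtain k0 :: nat where "C * real m / \<delta> \<le> real k0" using real_arch_simple by blast
    define k where "k = Suc k0"
    have "C * real m / \<delta> \<le> real k" using \<open>C * real m / \<delta> \<le> real k0\<close> by (simp add: k_def)
    then have k: "0 < k" "C * real m / real k \<le> \<delta>" using \<delta> by (auto simp: k_def field_simps)
    define I where "I = PiE ?B (\<lambda>_. {- int (k * M) - 1..int (k * M)})"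
    define W where "W = (\<lambda>g. {x \<in> A. \<forall>b'\<in>?B. \<lfloor>real k * (x \<bullet> b')\<rfloor> = g b'})"
    have I: "finite I" "card I = (2 * k * M + 2) ^ m"
      unfolding I_def using cB
      by (auto intro!: finite_PiE simp: card_PiE nat_add_distrib nat_mult_distrib mult_ac)
    have "A \<subseteq> (\<Union>g\<in>I. W g)"
    proof
      fix x assume x: "x \<in> A"
      let ?g = "restrict (\<lambda>b'. \<lfloor>real k * (x \<bullet> b')\<rfloor>) ?B"
      have "\<lfloor>real k * (x \<bullet> b')\<rfloor> \<in> {- int (k * M) - 1..int (k * M)}" if b': "b' \<in> ?B" for b'
      proof -
        have "\<bar>real k * (x \<bullet> b')\<bar> \<le> real k * real M"
          unfolding abs_mult using bnd[OF x b'] by (simp add: mult_left_mono)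
        then have "real k * (x \<bullet> b') \<le> real_of_int (int (k * M))" "- real_of_int (int (k * M)) \<le> real k * (x \<bullet> b')"
          by auto
        then show ?thesis by (simp add: floor_le_iff le_floor_iff)
      qed
      then have "?g \<in> I" by (auto simp: I_def)
      moreover have "x \<in> W ?g" using x by (auto simp: W_def)
      ultimately show "x \<in> (\<Union>g\<in>I. W g)" by blast
    qed
    then have "hausdorff_content (real m) \<delta> A \<le> (\<Sum>g\<in>I. hausdorff_content (real m) \<delta> (W g))"
      using hausdorff_content_finite_UN_le[OF _ I(1), of \<delta> "real m" W] \<delta>
      by (meson hausdorff_content_mono less_imp_le order_trans)
    also have "\<dots> \<le> (\<Sum>g\<in>I. ennreal (unit_ball_vol (real m) * (C * real m / real k / 2) ^ m))"
    proof (rule sum_mono)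
      fix g assume "g \<in> I"
      have bW: "bounded (W g)" using bA by (rule bounded_subset) (auto simp: W_def)
      have dW: "dist x y \<le> C * real m / real k" if "x \<in> W g" "y \<in> W g" for x y
      proof -
        have "\<bar>(x - y) \<bullet> b'\<bar> \<le> 1 / real k" if b': "b' \<in> ?B" for b'
        proof -
          have "\<lfloor>real k * (x \<bullet> b')\<rfloor> = \<lfloor>real k * (y \<bullet> b')\<rfloor>"
            using \<open>x \<in> W g\<close> \<open>y \<in> W g\<close> b' by (simp add: W_def)
          then have "\<bar>real k * (x \<bullet> b') - real k * (y \<bullet> b')\<bar> \<le> 1" by linarith
          then have "real k * \<bar>(x - y) \<bullet> b'\<bar> \<le> 1"
            by (simp add: inner_diff_left abs_mult flip: right_diff_distrib)
          then show ?thesis using k by (simp add: field_simps)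
        qed
        then have "(\<Sum>b'\<in>?B. \<bar>(x - y) \<bullet> b'\<bar>) \<le> real (card ?B) * (1 / real k)"
          by (intro sum_bounded_above) auto
        then have "C * (\<Sum>b'\<in>?B. \<bar>(x - y) \<bullet> b'\<bar>) \<le> C * (real m * (1 / real k))"
          using C cB by (intro mult_left_mono) auto
        then show ?thesis using proj[of x y] that by (auto simp: W_def)
      qed
      have h0: "0 \<le> C * real m / real k" using C by simp
      have diam: "diameter (W g) \<le> C * real m / real k"
        using dW h0 by (intro diameter_le) (auto simp: dist_norm)
      have "hausdorff_content (real m) \<delta> (W g) \<le> ennreal (unit_ball_vol (real m) * (diameter (W g) / 2) powr real m)"
        using diam k(2) \<delta> by (intro hausdorff_content_le_diameter[OF bW]) auto
      also have "\<dots> \<le> ennreal (unit_ball_vol (real m) * (C * real m / real k / 2) ^ m)"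
        using diam diameter_ge_0[OF bW] m
        by (intro ennreal_leI mult_left_mono) (auto simp: powr_eq_power intro!: power_mono)
      finally show "hausdorff_content (real m) \<delta> (W g) \<le> ennreal (unit_ball_vol (real m) * (C * real m / real k / 2) ^ m)" .
    qed
    also have "\<dots> = ennreal (real (card I) * (unit_ball_vol (real m) * (C * real m / real k / 2) ^ m))"
      using C by (simp add: ennreal_mult ennreal_of_nat_eq_real_of_nat)
    also have "real (card I) * (unit_ball_vol (real m) * (C * real m / real k / 2) ^ m) =
        unit_ball_vol (real m) * ((2 * real k * real M + 2) * (C * real m / real k / 2)) ^ m"
    proof -
      have "real (card I) = (2 * real k * real M + 2) ^ m" by (simp add: I(2) mult_ac add.commute)
      then show ?thesis by (simp only: power_mult_distrib mult_ac)
    qed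
    also have "ennreal \<dots> \<le> ennreal ?X"
    proof (intro ennreal_leI mult_left_mono power_mono)
      have "(2 * real k * real M + 2) * (C * real m / real k / 2) \<le> (2 * real k * real M + 2 * real k) * (C * real m / real k / 2)"
        using k C by (intro mult_right_mono) auto
      also have "\<dots> = (real M + 1) * (C * real m)" using k by (simp add: field_simps)
      also have "\<dots> \<le> (2 * real M + 2) * (C * real m)"
        using C by (intro mult_right_mono) auto
      finally show "(2 * real k * real M + 2) * (C * real m / real k / 2) \<le> (2 * real M + 2) * C * real m"
        by (simp add: mult.assoc)
    qed (use C in auto)
    finally show ?thesis .
  qed
  then have "hausdorff_outer_measure (real m) A \<le> ennreal ?X"
    unfolding hausdorff_outer_measure_def by (intro SUP_least) auto
  then show ?thesis by (rule le_less_trans) simp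
qed

text \<open>Over a cover set of size d the image of the time interval [0, T] is covered by at most T
  / d + 1 balls of radius 2 L d, of total volume of order d^m: time adds exactly one dimension.
  Covers with a small sum of d^m thus give images of small volume.\<close>

lemma hausdorff_null_imp_lipschitz_image_null:
  fixes f :: "'a::metric_space \<Rightarrow> real \<Rightarrow> 'b::euclidean_space"
  assumes m: "DIM('b) = Suc m" "0 < m" and null: "hausdorff_outer_measure (real m) V = 0"
    and L: "0 < L" and T: "0 \<le> T"
    and lip: "\<And>x y s t. x \<in> V \<Longrightarrow> y \<in> V \<Longrightarrow> s \<in> {0..T} \<Longrightarrow> t \<in> {0..T} \<Longrightarrow>
      dist (f x s) (f y t) \<le> L * (dist x y + \<bar>s - t\<bar>)"
    and e: "0 < e"
  shows "\<exists>S\<in>sets borel. (\<forall>x\<in>V. \<forall>t\<in>{0..T}. f x t \<in> S) \<and> emeasure lborel S \<le> ennreal e"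
proof -
  define \<beta> where "\<beta> = unit_ball_vol (real (Suc m))"
  define c where "c = unit_ball_vol (real m) / 2 ^ m"
  have pos: "0 < \<beta>" "0 < c" by (auto simp: \<beta>_def c_def)
  \<comment> \<open>\<open>Q\<close> bounds volume divided by d^m: at most T / d + 1 balls of volume
    \<open>\<beta> * (2 * L * d) ^ Suc m\<close>, with T + d <= T + 2 because d <= 2. The sum of d^m
    will be at most 2 \<eta>, hence the choice of \<eta>.\<close>
  define Q where "Q = \<beta> * (2 * L) ^ Suc m * (T + 2)"
  have Q: "0 < Q" using pos L T by (auto simp: Q_def intro!: mult_pos_pos)
  define \<eta> where "\<eta> = e / (2 * Q)"
  have \<eta>: "0 < \<eta>" using e Q by (simp add: \<eta>_def)
  have "hausdorff_content (real m) 1 V \<le> 0"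
    using hausdorff_content_le_outer_measure[of 1 "real m" V] null by simp
  also have "0 < ennreal (c * \<eta>)" using pos \<eta> by simp
  finally obtain U where U: "V \<subseteq> (\<Union>n. U n)" "\<forall>n. bounded (U n)" "\<forall>n. diameter (U n) \<le> 1"
    "(\<Sum>n. ennreal (unit_ball_vol (real m) * (diameter (U n) / 2) powr real m)) < ennreal (c * \<eta>)"
    by (blast dest: hausdorff_content_less_cover)
  define \<delta> where "\<delta> = (\<lambda>n. diameter (U n))"
  have \<delta>: "0 \<le> \<delta> n" "\<delta> n \<le> 1" for n using U(2,3) diameter_ge_0 by (auto simp: \<delta>_def)
  have "(\<Sum>n. ennreal (unit_ball_vol (real m) * (diameter (U n) / 2) powr real m)) = (\<Sum>n. ennreal c * ennreal (\<delta> n ^ m))"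
    using \<delta> m(2) pos
    by (intro suminf_cong) (simp add: \<delta>_def powr_eq_power c_def power_divide flip: ennreal_mult)
  also have "\<dots> = ennreal c * (\<Sum>n. ennreal (\<delta> n ^ m))" by (rule ennreal_suminf_cmult)
  finally have "ennreal c * (\<Sum>n. ennreal (\<delta> n ^ m)) \<le> ennreal c * ennreal \<eta>"
    using U(4) pos \<eta> by (simp add: ennreal_mult less_imp_le)
  then have sum\<delta>: "(\<Sum>n. ennreal (\<delta> n ^ m)) \<le> ennreal \<eta>"
    using pos by (subst (asm) ennreal_mult_le_mult_iff) auto
  \<comment> \<open>A cover set may have diameter 0, for which T / d makes no sense. Adding
    \<open>\<tau> n > 0\<close> makes the sizes positive at total cost \<eta>.\<close>
  have "\<exists>\<tau>>0. \<tau> \<le> 1 \<and> (\<delta> n + \<tau>) ^ m \<le> \<delta> n ^ m + \<eta> * (1/2) ^ Suc n" for n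
  proof -
    have "((\<lambda>\<tau>. (\<delta> n + \<tau>) ^ m) \<longlongrightarrow> (\<delta> n + 0) ^ m) (at_right 0)"
      by (intro tendsto_intros)
    then have "eventually (\<lambda>\<tau>. (\<delta> n + \<tau>) ^ m < \<delta> n ^ m + \<eta> * (1/2) ^ Suc n) (at_right 0)"
      using \<eta> by (intro order_tendstoD) auto
    moreover have "eventually (\<lambda>\<tau>::real. \<tau> \<in> {0<..<1}) (at_right 0)"
      by (rule eventually_at_right_real) simp
    ultimately have "eventually (\<lambda>\<tau>::real. 0 < \<tau> \<and> \<tau> \<le> 1 \<and> (\<delta> n + \<tau>) ^ m \<le> \<delta> n ^ m + \<eta> * (1/2) ^ Suc n) (at_right 0)"
      by eventually_elim auto
    then show ?thesis by (auto dest: eventually_happens)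
  qed
  then obtain \<tau> where \<tau>: "\<And>n. 0 < \<tau> n" "\<And>n. \<tau> n \<le> 1" "\<And>n. (\<delta> n + \<tau> n) ^ m \<le> \<delta> n ^ m + \<eta> * (1/2) ^ Suc n"
    by metis
  define d where "d = (\<lambda>n. \<delta> n + \<tau> n)"
  have d: "0 < d n" "d n \<le> 2" "\<delta> n \<le> d n" for n
    using \<delta>[of n] \<tau>(1,2)[of n] by (auto simp: d_def)
  have "(\<Sum>n. ennreal (d n ^ m)) \<le> (\<Sum>n. ennreal (\<delta> n ^ m) + ennreal (\<eta> * (1/2) ^ Suc n))"
  proof (intro suminf_le summableI)
    fix n
    have "ennreal (d n ^ m) \<le> ennreal (\<delta> n ^ m + \<eta> * (1/2) ^ Suc n)"
      unfolding d_def by (rule ennreal_leI[OF \<tau>(3)])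
    also have "\<dots> = ennreal (\<delta> n ^ m) + ennreal (\<eta> * (1/2) ^ Suc n)"
      using \<delta>(1)[of n] \<eta> by (intro ennreal_plus) auto
    finally show "ennreal (d n ^ m) \<le> ennreal (\<delta> n ^ m) + ennreal (\<eta> * (1/2) ^ Suc n)" .
  qed
  also have "\<dots> = (\<Sum>n. ennreal (\<delta> n ^ m)) + (\<Sum>n. ennreal (\<eta> * (1/2) ^ Suc n))"
    by (rule suminf_add[symmetric]) (rule summableI)+
  also have "(\<Sum>n. ennreal (\<eta> * (1/2) ^ Suc n)) = ennreal \<eta>"
    using power_half_series[THEN sums_mult, of \<eta>] \<eta> by (intro suminf_ennreal_eq) auto
  also have "(\<Sum>n. ennreal (\<delta> n ^ m)) + ennreal \<eta> \<le> ennreal \<eta> + ennreal \<eta>"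
    by (intro add_right_mono sum\<delta>)
  also have "\<dots> = ennreal (2 * \<eta>)" using \<eta> by (simp flip: ennreal_plus)
  finally have sumd: "(\<Sum>n. ennreal (d n ^ m)) \<le> ennreal (2 * \<eta>)" .
  define z where "z = (\<lambda>n. SOME x. x \<in> U n \<inter> V)"
  define K where "K = (\<lambda>n. nat \<lfloor>T / d n\<rfloor>)"
  define P where "P = (\<lambda>n. \<Union>k\<in>{..K n}. cball (f (z n) (real k * d n)) (2 * L * d n))"
  have Pborel: "P n \<in> sets lborel" for n unfolding P_def by auto
  have P: "emeasure lborel (P n) \<le> ennreal Q * ennreal (d n ^ m)" for n
  proof -
    have "emeasure lborel (P n) \<le> (\<Sum>k\<in>{..K n}. emeasure lborel (cball (f (z n) (real k * d n)) (2 * L * d n)))"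
      unfolding P_def by (rule emeasure_subadditive_finite) auto
    also have "\<dots> = (\<Sum>k\<in>{..K n}. ennreal (\<beta> * (2 * L * d n) ^ Suc m))"
      using L d(1)[of n] m by (intro sum.cong refl, subst emeasure_cball) (auto simp: \<beta>_def)
    also have "\<dots> = ennreal (real (Suc (K n)) * (\<beta> * (2 * L * d n) ^ Suc m))"
      using L d(1)[of n] pos by (subst sum_constant) (simp add: ennreal_mult ennreal_of_nat_eq_real_of_nat del: power_Suc)
    also have "\<dots> \<le> ennreal (Q * d n ^ m)"
    proof (rule ennreal_leI)
      have "real (K n) \<le> T / d n" unfolding K_def using T d(1)[of n] by (intro of_nat_floor) auto
      then have "real (Suc (K n)) \<le> T / d n + 1" by simp
      then have "real (Suc (K n)) * (\<beta> * (2 * L * d n) ^ Suc m) \<le> (T / d n + 1) * (\<beta> * (2 * L * d n) ^ Suc m)"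
        using L d(1)[of n] pos by (intro mult_right_mono) auto
      also have "\<dots> = \<beta> * (2 * L) ^ Suc m * (T + d n) * d n ^ m"
        using d(1)[of n] by (simp add: power_mult_distrib field_simps)
      also have "\<dots> \<le> \<beta> * (2 * L) ^ Suc m * (T + 2) * d n ^ m"
        using L d(1,2)[of n] pos by (intro mult_right_mono mult_left_mono) auto
      finally show "real (Suc (K n)) * (\<beta> * (2 * L * d n) ^ Suc m) \<le> Q * d n ^ m" by (simp add: Q_def)
    qed
    finally show ?thesis using Q d(1)[of n] by (simp add: ennreal_mult)
  qed
  show ?thesis
  proof (intro bexI[of _ "\<Union>n. P n"] conjI ballI)
    fix x t assume x: "x \<in> V" and t: "t \<in> {0..T}"
    then obtain n where n: "x \<in> U n" using U(1) by auto
    then have z: "z n \<in> U n" "z n \<in> V"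
      using someI[of "\<lambda>x. x \<in> U n \<inter> V" x] x by (auto simp: z_def)
    define k where "k = nat \<lfloor>t / d n\<rfloor>"
    have t0: "0 \<le> t / d n" using t d(1)[of n] by auto
    have "real k = real_of_int \<lfloor>t / d n\<rfloor>" using t0 by (simp add: k_def)
    then have "real k \<le> t / d n" "t / d n \<le> real k + 1" by linarith+
    then have kd: "real k * d n \<le> t" "t \<le> real k * d n + d n" using d(1)[of n] by (auto simp: field_simps)
    have "k \<le> K n" unfolding k_def K_def
      using t d(1)[of n] by (intro nat_mono floor_mono divide_right_mono) auto
    moreover have "dist (f (z n) (real k * d n)) (f x t) \<le> 2 * L * d n"
    proof -
      have "dist (f (z n) (real k * d n)) (f x t) \<le> L * (dist (z n) x + \<bar>real k * d n - t\<bar>)"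
        using kd t d(1)[of n] by (intro lip z x) auto
      also have "\<dots> \<le> L * (d n + d n)"
      proof (intro mult_left_mono add_mono)
        have "dist (z n) x \<le> \<delta> n" unfolding \<delta>_def using U(2) z n by (intro diameter_bounded_bound) auto
        then show "dist (z n) x \<le> d n" using d(3)[of n] by linarith
        show "\<bar>real k * d n - t\<bar> \<le> d n" using kd by linarith
      qed (use L in auto)
      finally show ?thesis by simp
    qed
    ultimately have "f x t \<in> P n" by (auto simp: P_def)
    then show "f x t \<in> (\<Union>n. P n)" by blast
  next
    have "emeasure lborel (\<Union>n. P n) \<le> (\<Sum>n. emeasure lborel (P n))"
      using Pborel by (intro emeasure_subadditive_countably) auto
    also have "\<dots> \<le> (\<Sum>n. ennreal Q * ennreal (d n ^ m))"
      by (intro suminf_le summableI P)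
    also have "\<dots> = ennreal Q * (\<Sum>n. ennreal (d n ^ m))" by (rule ennreal_suminf_cmult)
    also have "\<dots> \<le> ennreal Q * ennreal (2 * \<eta>)" by (intro mult_left_mono sumd) auto
    also have "\<dots> = ennreal e" using Q \<eta> by (simp add: \<eta>_def flip: ennreal_mult)
    finally show "emeasure lborel (\<Union>n. P n) \<le> ennreal e" .
  next
    show "(\<Union>n. P n) \<in> sets borel" using Pborel by auto
  qed
qed

section \<open>Points with an enclosing ball\<close>

text \<open>\<open>K\<close> need not be convex, so the mean value inequality is applied only to
  pairs within \<open>e\<close>, inside a ball contained in \<open>U\<close>. For the other pairs
  the bound \<open>F\<close> of |f| gives the quotient 2 |F| / e.\<close>

lemma Ck_on_1_lipschitz_on_compact:
  fixes f :: "'a::euclidean_space \<Rightarrow> real"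
  assumes f: "Ck_on (Suc 0) f U" and U: "open U" and K: "compact K" "K \<subseteq> U"
  obtains L where "0 \<le> L" "\<And>x y. x \<in> K \<Longrightarrow> y \<in> K \<Longrightarrow> \<bar>f x - f y\<bar> \<le> L * norm (x - y)"
proof -
  let ?D = "\<lambda>x. frechet_derivative f (at x)"
  have diff: "f differentiable (at x)" if "x \<in> U" for x using f that by simp
  have cont: "continuous_on U (\<lambda>x. ?D x v)" for v using f by simp
  obtain e where e: "0 < e" "(\<Union>x\<in>K. cball x e) \<subseteq> U"
    using compact_subset_open_imp_cball_epsilon_subset[OF K(1) U K(2)] by auto
  define W where "W = (\<Union>x\<in>K. cball x e)"
  have W: "compact W" "W \<subseteq> U" using compact_minkowski_sum_cball[OF K(1)] e(2) by (auto simp: W_def)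
  have "\<exists>B. \<forall>x\<in>W. \<bar>?D x b\<bar> \<le> B" for b
    using compact_imp_bounded[OF compact_continuous_image[OF continuous_on_subset[OF cont W(2)] W(1)], of b]
    by (auto simp: bounded_iff)
  then obtain B where B: "\<And>b x. x \<in> W \<Longrightarrow> \<bar>?D x b\<bar> \<le> B b" by metis
  define M where "M = (\<Sum>b\<in>Basis. \<bar>B b\<bar>)"
  have M: "onorm (?D x) \<le> M" if x: "x \<in> W" for x
  proof (rule onorm_le)
    fix v
    have lin: "linear (?D x)" using diff x W(2) by (intro linear_frechet_derivative) auto
    have "?D x v = ?D x (\<Sum>b\<in>Basis. (v \<bullet> b) *\<^sub>R b)" by (simp add: euclidean_representation)
    also have "\<dots> = (\<Sum>b\<in>Basis. (v \<bullet> b) * ?D x b)" using lin by (simp add: linear_sum linear_cmul)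
    also have "norm \<dots> \<le> (\<Sum>b\<in>Basis. \<bar>B b\<bar> * norm v)"
    proof (rule sum_norm_le)
      fix b :: 'a assume b: "b \<in> Basis"
      have "norm ((v \<bullet> b) * ?D x b) = \<bar>?D x b\<bar> * \<bar>v \<bullet> b\<bar>" by (simp add: abs_mult)
      also have "\<dots> \<le> \<bar>B b\<bar> * norm v"
        using B[OF x, of b] Basis_le_norm[OF b, of v] by (intro mult_mono) auto
      finally show "norm ((v \<bullet> b) * ?D x b) \<le> \<bar>B b\<bar> * norm v" .
    qed
    finally show "norm (?D x v) \<le> M * norm v" by (simp add: M_def sum_distrib_right)
  qed
  obtain F where F: "\<And>x. x \<in> K \<Longrightarrow> \<bar>f x\<bar> \<le> F"
  proof -
    have "continuous_on K f"
      using diff K(2) by (intro continuous_at_imp_continuous_on) (auto intro: differentiable_imp_continuous_within)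
    then show ?thesis
      using that compact_imp_bounded[OF compact_continuous_image[OF _ K(1)], of f] by (auto simp: bounded_iff)
  qed
  define L where "L = M + 2 * \<bar>F\<bar> / e"
  have M0: "0 \<le> M" by (auto simp: M_def intro: sum_nonneg)
  show ?thesis
  proof (rule that[of L])
    show "0 \<le> L" using e M0 by (simp add: L_def)
    fix x y assume x: "x \<in> K" and y: "y \<in> K"
    show "\<bar>f x - f y\<bar> \<le> L * norm (x - y)"
    proof (cases "norm (x - y) \<le> e")
      case True
      have sub: "cball x e \<subseteq> W" using x by (auto simp: W_def)
      have "norm (f x - f y) \<le> M * norm (x - y)"
      proof (rule differentiable_bound[OF convex_cball[of x e]])
        show "(f has_derivative ?D z) (at z within cball x e)" if "z \<in> cball x e" for z
          using diff[of z] that sub W(2) frechet_derivative_works has_derivative_at_withinI by blast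
        show "onorm (?D z) \<le> M" if "z \<in> cball x e" for z using M that sub by auto
      qed (use True e in \<open>auto simp: dist_norm\<close>)
      also have "\<dots> \<le> L * norm (x - y)" using e by (intro mult_right_mono) (auto simp: L_def)
      finally show ?thesis by simp
    next
      case False
      have "\<bar>f x - f y\<bar> \<le> 2 * \<bar>F\<bar>" using F[OF x] F[OF y] by linarith
      also have "\<dots> = 2 * \<bar>F\<bar> / e * e" using e by simp
      also have "\<dots> \<le> L * norm (x - y)"
        using False e M0 by (intro mult_mono) (auto simp: L_def)
      finally show ?thesis .
    qed
  qed
qed

lemma norm_add_square:
  fixes x y :: "'a::real_inner"
  shows "(norm (x + y))\<^sup>2 = (norm x)\<^sup>2 + 2 * (y \<bullet> x) + (norm y)\<^sup>2"
  by (simp add: power2_norm_eq_inner inner_add_left inner_add_right inner_commute)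

text \<open>The geometry of enclosing balls is a matter of the real inner product, so complex space
  is treated as a real Euclidean space here.\<close>

locale smooth_bounded_domain =
  fixes \<Omega> :: "'a::euclidean_space set" and \<rho> :: "'a \<Rightarrow> real" and U :: "'a set"
  assumes open_dom: "open \<Omega>" and bounded_dom: "bounded \<Omega>" and nonempty_dom: "\<Omega> \<noteq> {}"
    and open_nbhd: "open U" and frontier_sub: "frontier \<Omega> \<subseteq> U" and smooth: "smooth_on \<rho> U"
    and dom_eq: "\<Omega> \<inter> U = {z \<in> U. \<rho> z < 0}"
    and nonsingular: "\<And>p. p \<in> frontier \<Omega> \<Longrightarrow> frechet_derivative \<rho> (at p) \<noteq> (\<lambda>v. 0)"
begin

definition grad :: "'a \<Rightarrow> 'a" where
  "grad x = (\<Sum>b\<in>Basis. frechet_derivative \<rho> (at x) b *\<^sub>R b)"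

lemma differentiable: "x \<in> U \<Longrightarrow> \<rho> differentiable (at x)"
  using smooth[unfolded smooth_on_def, rule_format, of 1] by simp

lemma Ck_on_derivative: "Ck_on (Suc 0) (\<lambda>x. frechet_derivative \<rho> (at x) v) U"
  using smooth[unfolded smooth_on_def, rule_format, of "Suc (Suc 0)"] by simp

lemma frechet_derivative_eq_grad:
  assumes "x \<in> U" shows "frechet_derivative \<rho> (at x) = (\<lambda>v. grad x \<bullet> v)"
proof
  fix v
  have lin: "linear (frechet_derivative \<rho> (at x))" using differentiable[OF assms] by (rule linear_frechet_derivative)
  have "frechet_derivative \<rho> (at x) v = frechet_derivative \<rho> (at x) (\<Sum>b\<in>Basis. (v \<bullet> b) *\<^sub>R b)"
    by (simp add: euclidean_representation)
  also have "\<dots> = (\<Sum>b\<in>Basis. (v \<bullet> b) * frechet_derivative \<rho> (at x) b)"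
    using lin by (simp add: linear_sum linear_cmul)
  finally show "frechet_derivative \<rho> (at x) v = grad x \<bullet> v"
    unfolding grad_def inner_sum_left by (simp add: inner_commute mult.commute)
qed

lemma has_derivative_grad: "x \<in> U \<Longrightarrow> (\<rho> has_derivative (\<lambda>v. grad x \<bullet> v)) (at x)"
  using frechet_derivative_works[of \<rho> "at x"] differentiable frechet_derivative_eq_grad by metis

lemma grad_nonzero: "p \<in> frontier \<Omega> \<Longrightarrow> grad p \<noteq> 0"
  using nonsingular frechet_derivative_eq_grad frontier_sub by fastforce

lemma continuous_on_grad: "continuous_on U grad"
proof -
  have "continuous_on U (\<lambda>x. frechet_derivative \<rho> (at x) b)" for b
    using Ck_on_derivative[of b]
    by (intro continuous_at_imp_continuous_on) (auto intro: differentiable_imp_continuous_within)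
  then show ?thesis unfolding grad_def by (intro continuous_intros)
qed

lemma compact_frontier: "compact (frontier \<Omega>)"
  using bounded_dom by (rule compact_frontier_bounded)

text \<open>Here the second derivatives of \<rho> enter. A Lipschitz gradient makes
  \<open>q - t *\<^sub>R grad q\<close> Lipschitz in \<open>q\<close> and \<open>t\<close>, and it
  gives the quadratic upper bound on \<open>V\<close>.\<close>

lemma grad_lipschitz:
  "\<exists>L\<ge>0. \<forall>x\<in>frontier \<Omega>. \<forall>y\<in>frontier \<Omega>. norm (grad x - grad y) \<le> L * norm (x - y)"
proof -
  let ?D = "\<lambda>b x. frechet_derivative \<rho> (at x) b"
  have "\<exists>L. 0 \<le> L \<and> (\<forall>x\<in>frontier \<Omega>. \<forall>y\<in>frontier \<Omega>. \<bar>?D b x - ?D b y\<bar> \<le> L * norm (x - y))" for b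
    using Ck_on_1_lipschitz_on_compact[OF Ck_on_derivative open_nbhd compact_frontier frontier_sub, of b] by metis
  then obtain L where L: "\<And>b. 0 \<le> L b"
    "\<And>b x y. x \<in> frontier \<Omega> \<Longrightarrow> y \<in> frontier \<Omega> \<Longrightarrow> \<bar>?D b x - ?D b y\<bar> \<le> L b * norm (x - y)" by metis
  show ?thesis
  proof (intro exI[of _ "\<Sum>b\<in>Basis. L b"] conjI ballI)
    show "0 \<le> (\<Sum>b\<in>Basis. L b)" by (intro sum_nonneg L)
    fix x y assume xy: "x \<in> frontier \<Omega>" "y \<in> frontier \<Omega>"
    have "grad x - grad y = (\<Sum>b\<in>Basis. (?D b x - ?D b y) *\<^sub>R b)"
      by (simp add: grad_def sum_subtractf scaleR_diff_left)
    also have "norm \<dots> \<le> (\<Sum>b\<in>Basis. L b * norm (x - y))"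
      using L(2)[OF xy] by (intro sum_norm_le) simp
    finally show "norm (grad x - grad y) \<le> (\<Sum>b\<in>Basis. L b) * norm (x - y)"
      by (simp add: sum_distrib_right)
  qed
qed

text \<open>The definition speaks of the negative side of \<rho> only. A negative value would put
  \<open>p\<close> into the open set \<Omega>; a positive one would separate \<open>p\<close> from
  the closure of \<Omega>.\<close>

lemma defining_function_zero:
  assumes p: "p \<in> frontier \<Omega>" shows "\<rho> p = 0"
proof (rule antisym)
  have pU: "p \<in> U" using p frontier_sub by auto
  have "p \<notin> \<Omega>" using p open_dom by (simp add: frontier_def interior_open)
  then have "p \<notin> {z \<in> U. \<rho> z < 0}" using dom_eq by blast
  then show "0 \<le> \<rho> p" using pU by simp
  show "\<rho> p \<le> 0"
  proof (rule ccontr)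
    assume "\<not> \<rho> p \<le> 0"
    then have "0 < \<rho> p" by simp
    moreover have "isCont \<rho> p" using differentiable[OF pU] by (rule differentiable_imp_continuous_within)
    then have "(\<rho> \<longlongrightarrow> \<rho> p) (nhds p)" unfolding continuous_at tendsto_at_iff_tendsto_nhds .
    ultimately have "eventually (\<lambda>x. 0 < \<rho> x) (nhds p)" by (intro order_tendstoD(1))
    then have "eventually (\<lambda>x. 0 < \<rho> x \<and> x \<in> U) (nhds p)"
      using eventually_nhds_in_open[OF open_nbhd pU] by eventually_elim auto
    then obtain S where S: "open S" "p \<in> S" "\<And>x. x \<in> S \<Longrightarrow> 0 < \<rho> x \<and> x \<in> U"
      by (auto simp: eventually_nhds)
    have False if "x \<in> S" "x \<in> \<Omega>" for x
    proof -
      have "x \<in> \<Omega> \<inter> U" using S(3) that by auto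
      then have "\<rho> x < 0" unfolding dom_eq by simp
      with S(3)[OF that(1)] show False by simp
    qed
    then have "S \<inter> \<Omega> = {}" by blast
    then have "S \<inter> closure \<Omega> = {}" using S(1) open_Int_closure_eq_empty by blast
    then show False using p S(2) by (auto simp: frontier_def)
  qed
qed

text \<open>Quantitative substitute for the implicit function theorem. As \<rho> vanishes at both
  points, \<open>x - y\<close> is almost orthogonal to \<open>grad p\<close>; where
  \<open>grad p\<close> has a nonzero \<open>b\<close>-component, this bounds the
  \<open>b\<close>-component of \<open>x - y\<close> by the others.\<close>

lemma local_projection:
  assumes p: "p \<in> frontier \<Omega>"
  obtains r C b where "0 < r" "0 \<le> C" "b \<in> Basis"
    "\<And>x y. x \<in> frontier \<Omega> \<inter> ball p r \<Longrightarrow> y \<in> frontier \<Omega> \<inter> ball p r \<Longrightarrow>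
       dist x y \<le> C * (\<Sum>b'\<in>Basis - {b}. \<bar>(x - y) \<bullet> b'\<bar>)"
proof -
  have pU: "p \<in> U" using p frontier_sub by auto
  obtain b where b: "b \<in> Basis" "grad p \<bullet> b \<noteq> 0"
    using grad_nonzero[OF p] by (auto simp: euclidean_eq_iff[of "grad p" 0])
  define a where "a = \<bar>grad p \<bullet> b\<bar>"
  \<comment> \<open>Half of \<open>a\<close>, so that the error in the \<open>b\<close>-component is
    absorbed on the left with the positive factor a - \<epsilon>.\<close>
  define \<epsilon> where "\<epsilon> = a / 2"
  have \<epsilon>: "0 < \<epsilon>" "0 < a" using b by (auto simp: \<epsilon>_def a_def)
  have "isCont grad p" using continuous_on_grad open_nbhd pU by (simp add: continuous_on_eq_continuous_at)
  then obtain r1 where r1: "0 < r1" "\<And>z. dist z p < r1 \<Longrightarrow> dist (grad z) (grad p) < \<epsilon>"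
    using \<epsilon>(1) unfolding continuous_at_eps_delta by (metis (full_types))
  obtain r2 where r2: "0 < r2" "ball p r2 \<subseteq> U" using open_nbhd pU openE by blast
  define r where "r = min r1 r2"
  have r: "0 < r" "ball p r \<subseteq> U" "\<And>z. z \<in> ball p r \<Longrightarrow> norm (grad z - grad p) \<le> \<epsilon>"
    using r1 r2 by (auto simp: r_def dist_norm norm_minus_commute subset_iff intro!: less_imp_le)
  define C where "C = (\<epsilon> + norm (grad p)) / (a - \<epsilon>) + 1"
  have C: "0 \<le> C" using \<epsilon> by (simp add: C_def \<epsilon>_def)
  show ?thesis
  proof (rule that[OF r(1) C b(1)])
    fix x y assume xy: "x \<in> frontier \<Omega> \<inter> ball p r" "y \<in> frontier \<Omega> \<inter> ball p r"
    let ?w = "x - y" let ?s = "\<Sum>b'\<in>Basis - {b}. \<bar>(x - y) \<bullet> b'\<bar>"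
    let ?g = "\<lambda>z. \<rho> z - grad p \<bullet> z"
    have "norm (?g x - ?g y) \<le> \<epsilon> * norm (x - y)"
    proof (rule differentiable_bound[OF convex_ball[of p r]])
      show "(?g has_derivative (\<lambda>v. grad z \<bullet> v - grad p \<bullet> v)) (at z within ball p r)" if "z \<in> ball p r" for z
        using has_derivative_at_withinI[OF has_derivative_grad] r(2) that
        by (intro has_derivative_diff derivative_intros) auto
      show "onorm (\<lambda>v. grad z \<bullet> v - grad p \<bullet> v) \<le> \<epsilon>" if "z \<in> ball p r" for z
      proof (rule onorm_le)
        fix v
        have "norm (grad z \<bullet> v - grad p \<bullet> v) = \<bar>(grad z - grad p) \<bullet> v\<bar>" by (simp add: inner_diff_left)
        also have "\<dots> \<le> norm (grad z - grad p) * norm v" by (rule Cauchy_Schwarz_ineq2)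
        also have "\<dots> \<le> \<epsilon> * norm v" using r(3)[OF that] by (intro mult_right_mono) auto
        finally show "norm (grad z \<bullet> v - grad p \<bullet> v) \<le> \<epsilon> * norm v" .
      qed
    qed (use xy in auto)
    then have "\<bar>grad p \<bullet> ?w\<bar> \<le> \<epsilon> * norm ?w"
      using xy defining_function_zero[of x] defining_function_zero[of y] by (simp add: inner_diff_right abs_minus_commute)
    moreover have nw: "norm ?w \<le> \<bar>?w \<bullet> b\<bar> + ?s"
      using norm_le_l1[of ?w] b(1) by (simp add: sum.remove)
    ultimately have 1: "\<bar>grad p \<bullet> ?w\<bar> \<le> \<epsilon> * \<bar>?w \<bullet> b\<bar> + \<epsilon> * ?s"
      using \<epsilon> by (smt (verit) distrib_left mult_left_mono)
    have "grad p \<bullet> ?w = (\<Sum>b'\<in>Basis. (grad p \<bullet> b') * (?w \<bullet> b'))" by (rule euclidean_inner)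
    also have "\<dots> = (grad p \<bullet> b) * (?w \<bullet> b) + (\<Sum>b'\<in>Basis - {b}. (grad p \<bullet> b') * (?w \<bullet> b'))"
      using b(1) by (simp add: sum.remove)
    finally have "a * \<bar>?w \<bullet> b\<bar> \<le> \<bar>grad p \<bullet> ?w\<bar> + \<bar>\<Sum>b'\<in>Basis - {b}. (grad p \<bullet> b') * (?w \<bullet> b')\<bar>"
      unfolding a_def by (simp add: abs_mult[symmetric])
    also have "\<bar>\<Sum>b'\<in>Basis - {b}. (grad p \<bullet> b') * (?w \<bullet> b')\<bar> \<le> (\<Sum>b'\<in>Basis - {b}. norm (grad p) * \<bar>?w \<bullet> b'\<bar>)"
      by (rule order_trans[OF sum_abs]) (auto simp: abs_mult intro!: sum_mono mult_right_mono Basis_le_norm)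
    also have "\<dots> = norm (grad p) * ?s" by (simp add: sum_distrib_left)
    finally have "(a - \<epsilon>) * \<bar>?w \<bullet> b\<bar> \<le> (\<epsilon> + norm (grad p)) * ?s" using 1 by (simp add: algebra_simps)
    then have "\<bar>?w \<bullet> b\<bar> \<le> (\<epsilon> + norm (grad p)) / (a - \<epsilon>) * ?s"
      using \<epsilon> by (simp add: \<epsilon>_def field_simps)
    then show "dist x y \<le> C * ?s" using nw by (simp add: C_def dist_norm algebra_simps)
  qed
qed

text \<open>Compactness reduces this to finitely many Lipschitz graphs. Finiteness matters for the
  normalization: dividing by an infinite total mass would give the zero measure.\<close>

lemma hausdorff_frontier_finite:
  assumes m: "DIM('a) = Suc m" "0 < m"
  shows "hausdorff_outer_measure (real m) (frontier \<Omega>) < \<infinity>"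
proof -
  have "\<exists>r>0. hausdorff_outer_measure (real m) (frontier \<Omega> \<inter> ball p r) < \<infinity>" if "p \<in> frontier \<Omega>" for p
  proof -
    from local_projection[OF that] obtain r C b where "0 < r" "0 \<le> C" "b \<in> Basis"
    "\<And>x y. x \<in> frontier \<Omega> \<inter> ball p r \<Longrightarrow> y \<in> frontier \<Omega> \<inter> ball p r \<Longrightarrow>
       dist x y \<le> C * (\<Sum>b'\<in>Basis - {b}. \<bar>(x - y) \<bullet> b'\<bar>)" by blast
    then show ?thesis
      using m by (intro exI[of _ r] conjI hausdorff_outer_measure_finite_projection[of b _ m C]) auto
  qed
  then obtain r where r: "\<And>p. p \<in> frontier \<Omega> \<Longrightarrow> 0 < r p"
    "\<And>p. p \<in> frontier \<Omega> \<Longrightarrow> hausdorff_outer_measure (real m) (frontier \<Omega> \<inter> ball p (r p)) < \<infinity>"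
    by metis
  obtain D where D: "D \<subseteq> frontier \<Omega>" "finite D" "frontier \<Omega> \<subseteq> (\<Union>p\<in>D. ball p (r p))"
    using compactE_image[OF compact_frontier, of "frontier \<Omega>" "\<lambda>p. ball p (r p)"] r(1)
    by (metis (no_types, lifting) UN_I centre_in_ball open_ball subsetI)
  have "hausdorff_outer_measure (real m) (frontier \<Omega>) \<le> hausdorff_outer_measure (real m) (\<Union>p\<in>D. frontier \<Omega> \<inter> ball p (r p))"
    using D(3) by (intro hausdorff_outer_measure_mono) auto
  also have "\<dots> < \<infinity>" using D(1,2) r(2) by (intro hausdorff_outer_measure_finite_UN) auto
  finally show ?thesis .
qed

section \<open>Farthest points and enclosing balls\<close>

definition farthest_from :: "'a \<Rightarrow> 'a \<Rightarrow> bool" where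
  "farthest_from a q \<longleftrightarrow> q \<in> frontier \<Omega> \<and> (\<forall>z\<in>closure \<Omega>. dist z a \<le> dist q a)"

text \<open>The set \<open>V\<close> of the overview. The unit ball of centres is a fixed set of
  positive volume; its position relative to \<Omega> is arbitrary.\<close>

definition far_set :: "'a set" where
  "far_set = {q. \<exists>a\<in>cball 0 1. farthest_from a q}"

lemma farthest_exists: "\<exists>q. farthest_from a q"
proof -
  have "compact (closure \<Omega>)" using bounded_dom by simp
  moreover have "closure \<Omega> \<noteq> {}" using nonempty_dom by simp
  moreover have "continuous_on (closure \<Omega>) (\<lambda>z. dist z a)" by (intro continuous_intros)
  ultimately obtain q where q: "q \<in> closure \<Omega>" "\<And>z. z \<in> closure \<Omega> \<Longrightarrow> dist z a \<le> dist q a"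
    using continuous_attains_sup[of "closure \<Omega>" "\<lambda>z. dist z a"] by blast
  have "q \<notin> \<Omega>"
  proof
    assume "q \<in> \<Omega>"
    then obtain e where e: "0 < e" "cball q e \<subseteq> \<Omega>" using open_dom open_contains_cball by blast
    obtain u :: 'a where u: "norm u = 1" using norm_Basis nonempty_Basis by blast
    \<comment> \<open>If \<open>q\<close> were interior, a step away from \<open>a\<close> would
      increase the distance; for q = a every direction leads away.\<close>
    define w where "w = (if q = a then u else (1 / norm (q - a)) *\<^sub>R (q - a))"
    have w: "norm w = 1" using u by (simp add: w_def)
    have qa: "q - a = norm (q - a) *\<^sub>R w" by (simp add: w_def)
    have "q + e *\<^sub>R w \<in> cball q e" using w e by (simp add: dist_norm)
    then have "q + e *\<^sub>R w \<in> closure \<Omega>" using e closure_subset by blast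
    then have "norm (q + e *\<^sub>R w - a) \<le> norm (q - a)" using q(2) by (simp add: dist_norm)
    moreover have "q + e *\<^sub>R w - a = (norm (q - a) + e) *\<^sub>R w"
      using qa by (simp add: algebra_simps)
    ultimately show False using w e by simp
  qed
  then have "farthest_from a q" using q open_dom by (simp add: farthest_from_def frontier_def interior_open)
  then show ?thesis ..
qed

text \<open>Every direction \<open>w\<close> along which \<open>\<rho>\<close> decreases points into \<open>\<Omega>\<close>, hence into the ball around \<open>a\<close>
  through \<open>q\<close>.\<close>

lemma farthest_grad:
  assumes q: "farthest_from a q"
  obtains t where "0 \<le> t" "q - a = t *\<^sub>R grad q" "t = norm (q - a) / norm (grad q)"
proof -
  have qf: "q \<in> frontier \<Omega>" and far: "\<And>z. z \<in> closure \<Omega> \<Longrightarrow> dist z a \<le> dist q a"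
    using q by (auto simp: farthest_from_def)
  have qU: "q \<in> U" using qf frontier_sub by auto
  let ?n = "grad q" let ?y = "q - a"
  have n0: "?n \<noteq> 0" using grad_nonzero[OF qf] .
  have descent: "w \<bullet> ?y \<le> 0" if w: "?n \<bullet> w < 0" for w
  proof (rule ccontr)
    assume wy: "\<not> w \<bullet> ?y \<le> 0"
    have "((\<lambda>s. \<rho> (q + s *\<^sub>R w)) has_derivative (\<lambda>s. ?n \<bullet> (s *\<^sub>R w))) (at 0)"
      by (rule has_derivative_compose[of "\<lambda>s. q + s *\<^sub>R w", where g=\<rho>, simplified])
         (auto intro!: derivative_eq_intros has_derivative_grad[OF qU])
    then have "((\<lambda>s. \<rho> (q + s *\<^sub>R w)) has_real_derivative ?n \<bullet> w) (at 0)"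
      unfolding has_field_derivative_def
      by (rule has_derivative_eq_rhs) (auto simp: fun_eq_iff mult.commute)
    from DERIV_neg_dec_right[OF this w]
    have "\<exists>d>0. \<forall>h>0. h < d \<longrightarrow> \<rho> (q + h *\<^sub>R w) < \<rho> q" by simp
    then obtain d where d: "0 < d" "\<And>h. 0 < h \<Longrightarrow> h < d \<Longrightarrow> \<rho> (q + h *\<^sub>R w) < \<rho> q"
      by blast
    have lim: "((\<lambda>h. q + h *\<^sub>R w) \<longlongrightarrow> q + 0 *\<^sub>R w) (at_right 0)" by (intro tendsto_intros)
    have "eventually (\<lambda>h. q + h *\<^sub>R w \<in> U) (at_right 0)"
      by (rule topological_tendstoD[OF lim open_nbhd]) (simp add: qU)
    moreover have "eventually (\<lambda>h. h \<in> {0<..<d}) (at_right 0)"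
      using d(1) by (rule eventually_at_right_real)
    ultimately have "eventually (\<lambda>h. q + h *\<^sub>R w \<in> U \<and> h \<in> {0<..<d}) (at_right 0)"
      by eventually_elim simp
    then obtain h where h: "q + h *\<^sub>R w \<in> U" "0 < h" "h < d" by (auto dest: eventually_happens)
    have "\<rho> (q + h *\<^sub>R w) < 0" using d(2) h defining_function_zero[OF qf] by simp
    then have "q + h *\<^sub>R w \<in> closure \<Omega>" using h dom_eq closure_subset[of \<Omega>] by auto
    then have "norm (?y + h *\<^sub>R w) \<le> norm ?y" using far by (simp add: dist_norm algebra_simps)
    then have "(norm (?y + h *\<^sub>R w))\<^sup>2 \<le> (norm ?y)\<^sup>2" by (intro power_mono) auto
    then have "2 * h * (w \<bullet> ?y) + (norm (h *\<^sub>R w))\<^sup>2 \<le> 0"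
      unfolding norm_add_square by simp
    moreover have "0 < 2 * h * (w \<bullet> ?y)" using wy h by simp
    moreover have "0 \<le> (norm (h *\<^sub>R w))\<^sup>2" by simp
    ultimately show False by linarith
  qed
  define t where "t = (?y \<bullet> ?n) / (?n \<bullet> ?n)"
  \<comment> \<open>The component of \<open>q - a\<close> orthogonal to the gradient n. For every e
    > 0 the direction v - e n decreases \<rho>, so \<open>descent\<close> gives |v|^2 <= e t |n|^2,
    and v = 0. The direction -n then gives t >= 0.\<close>
  define v where "v = ?y - t *\<^sub>R ?n"
  have nn: "0 < ?n \<bullet> ?n" using n0 by simp
  have vn: "v \<bullet> ?n = 0" using nn by (simp add: v_def t_def inner_diff_left)
  have vy: "v \<bullet> ?y = v \<bullet> v" using vn by (simp add: v_def inner_diff_right inner_diff_left inner_commute)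
  have "v \<bullet> v \<le> e * (t * (?n \<bullet> ?n))" if "0 < e" for e
  proof -
    have "?n \<bullet> (v - e *\<^sub>R ?n) < 0" using vn nn that by (simp add: inner_diff_right inner_commute)
    from descent[OF this] have "v \<bullet> v - e * (?n \<bullet> ?y) \<le> 0" by (simp add: inner_diff_left vy)
    then show ?thesis using nn by (simp add: t_def inner_commute)
  qed
  note ve = this
  have "v \<bullet> v \<le> 0"
  proof (rule ccontr)
    assume "\<not> v \<bullet> v \<le> 0"
    then have pos: "0 < v \<bullet> v" by (simp only: not_le)
    define c where "c = \<bar>t * (?n \<bullet> ?n)\<bar> + 1"
    have c: "0 < c" "t * (?n \<bullet> ?n) \<le> c" by (auto simp: c_def)
    have "v \<bullet> v \<le> (v \<bullet> v / (2 * c)) * (t * (?n \<bullet> ?n))" using pos c by (intro ve divide_pos_pos) auto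
    also have "\<dots> \<le> (v \<bullet> v / (2 * c)) * c" using pos c by (intro mult_left_mono) auto
    also have "\<dots> = (v \<bullet> v) / 2" using c(1) by simp
    finally show False using pos by linarith
  qed
  then have "v \<bullet> v = 0" using inner_ge_zero[of v] by (rule antisym)
  then have "v = 0" by simp
  then have eq: "?y = t *\<^sub>R ?n" by (simp add: v_def)
  have "- ?n \<bullet> ?y \<le> 0" using nn by (intro descent) simp
  then have t0: "0 \<le> t" using nn by (simp add: t_def inner_commute)
  have "norm ?y = t * norm ?n" using eq t0 by simp
  then have "t = norm ?y / norm ?n" using n0 by simp
  then show ?thesis by (rule that[OF t0 eq])
qed

text \<open>Bounds the parameter \<open>t\<close> of \<open>farthest_grad\<close> uniformly, because
  |q - a| <= |q| + 1 for \<open>a\<close> in the unit ball. The gradient has no zero on the compact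
  boundary.\<close>

lemma farthest_parameter_bounded: "\<exists>T. \<forall>q\<in>frontier \<Omega>. (norm q + 1) / norm (grad q) \<le> T"
proof -
  have "compact ((\<lambda>q. (norm q + 1) / norm (grad q)) ` frontier \<Omega>)"
    using grad_nonzero
    by (intro compact_continuous_image compact_frontier continuous_intros continuous_on_subset[OF continuous_on_grad frontier_sub]) auto
  then show ?thesis by (auto simp: bounded_iff dest!: compact_imp_bounded)
qed

lemma far_set_sub: "far_set \<subseteq> frontier \<Omega>"
  by (auto simp: far_set_def farthest_from_def)

text \<open>\<open>V\<close> is the projection of a compact set of pairs (q, a). Compactness
  provides the measurability and the boundedness that the peak construction requires.\<close>

lemma compact_far_set: "compact far_set"
proof -
  let ?S = "(frontier \<Omega> \<times> cball 0 1) \<inter> (\<Inter>z\<in>closure \<Omega>. {p. dist z (snd p) \<le> dist (fst p) (snd p)})"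
  have "closed (\<Inter>z\<in>closure \<Omega>. {p :: 'a \<times> 'a. dist z (snd p) \<le> dist (fst p) (snd p)})"
    by (intro closed_INT ballI closed_Collect_le continuous_intros)
  then have "compact ?S"
    by (rule compact_Int_closed[OF compact_Times[OF compact_frontier compact_cball]])
  then have "compact (fst ` ?S)" by (intro compact_continuous_image continuous_on_fst continuous_on_id)
  moreover have "fst ` ?S = far_set"
  proof
    show "fst ` ?S \<subseteq> far_set" by (auto simp: far_set_def farthest_from_def)
    show "far_set \<subseteq> fst ` ?S"
    proof
      fix q assume "q \<in> far_set"
      then obtain a where "a \<in> cball 0 1" "farthest_from a q" by (auto simp: far_set_def)
      then have "(q, a) \<in> ?S" by (auto simp: farthest_from_def)
      then show "q \<in> fst ` ?S" by (rule image_eqI[rotated]) (rule fst_conv[symmetric])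
    qed
  qed
  ultimately show ?thesis by (simp only:)
qed

lemma hausdorff_far_set_pos:
  assumes m: "DIM('a) = Suc m" "0 < m"
  shows "hausdorff_outer_measure (real m) far_set \<noteq> 0"
proof
  assume null: "hausdorff_outer_measure (real m) far_set = 0"
  obtain L where L: "0 \<le> L" "\<And>x y. x \<in> frontier \<Omega> \<Longrightarrow> y \<in> frontier \<Omega> \<Longrightarrow> norm (grad x - grad y) \<le> L * norm (x - y)"
    using grad_lipschitz by blast
  obtain N where N: "\<And>x. x \<in> frontier \<Omega> \<Longrightarrow> norm (grad x) \<le> N"
    using compact_imp_bounded[OF compact_continuous_image[OF continuous_on_subset[OF continuous_on_grad frontier_sub] compact_frontier]]
    by (auto simp: bounded_iff)
  obtain T where T: "\<And>q. q \<in> frontier \<Omega> \<Longrightarrow> (norm q + 1) / norm (grad q) \<le> T"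
    using farthest_parameter_bounded by blast
  let ?f = "\<lambda>q t. q - t *\<^sub>R grad q"
  let ?T = "\<bar>T\<bar>"
  define K where "K = 1 + ?T * L + \<bar>N\<bar>"
  have K: "1 + ?T * L \<le> K" "\<bar>N\<bar> \<le> K" "0 < K"
    using mult_nonneg_nonneg[OF abs_ge_zero L(1), of T] by (auto simp: K_def)
  have lip: "dist (?f x s) (?f y t) \<le> K * (dist x y + \<bar>s - t\<bar>)"
    if "x \<in> far_set" "y \<in> far_set" "s \<in> {0..?T}" "t \<in> {0..?T}" for x y s t
  proof -
    have xy: "x \<in> frontier \<Omega>" "y \<in> frontier \<Omega>" using that far_set_sub by auto
    have "?f x s - ?f y t = (x - y) - s *\<^sub>R (grad x - grad y) - (s - t) *\<^sub>R grad y"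
      by (simp add: algebra_simps)
    also have "norm \<dots> \<le> norm (x - y) + norm (s *\<^sub>R (grad x - grad y)) + norm ((s - t) *\<^sub>R grad y)"
      by (smt (verit) norm_triangle_ineq4)
    also have "\<dots> \<le> norm (x - y) + ?T * (L * norm (x - y)) + \<bar>s - t\<bar> * \<bar>N\<bar>"
      using that L(1) L(2)[OF xy] N[OF xy(2)] by (intro add_mono) (auto intro!: mult_mono)
    also have "\<dots> = (1 + ?T * L) * norm (x - y) + \<bar>N\<bar> * \<bar>s - t\<bar>" by (simp add: algebra_simps)
    also have "\<dots> \<le> K * norm (x - y) + K * \<bar>s - t\<bar>"
      by (intro add_mono[of "_ * _" "_ * _"] mult_right_mono K(1,2)) auto
    finally show ?thesis by (simp add: dist_norm distrib_left)
  qed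
  \<comment> \<open>By \<open>farthest_grad\<close> every centre lies on the inner normal at its
    farthest point, at a parameter of at most \<open>?T\<close>.\<close>
  have cov: "\<exists>q\<in>far_set. \<exists>t\<in>{0..?T}. a = ?f q t" if a: "a \<in> cball 0 1" for a
  proof -
    obtain q where q: "farthest_from a q" using farthest_exists by blast
    then obtain t where t: "0 \<le> t" "q - a = t *\<^sub>R grad q" "t = norm (q - a) / norm (grad q)"
      by (rule farthest_grad)
    have qf: "q \<in> frontier \<Omega>" using q by (simp add: farthest_from_def)
    have "norm (q - a) \<le> norm q + 1" using a norm_triangle_ineq4[of q a] by simp
    then have "t \<le> (norm q + 1) / norm (grad q)" unfolding t(3) by (intro divide_right_mono) auto
    also have "\<dots> \<le> ?T" using T[OF qf] by linarith
    finally have "t \<le> ?T" .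
    moreover have "a = ?f q t" using t(2) by (simp add: algebra_simps)
    moreover have "q \<in> far_set" using q a by (auto simp: far_set_def)
    ultimately show ?thesis using t(1) by (intro bexI[of _ q] bexI[of _ t]) auto
  qed
  have pos: "0 < emeasure lborel (cball (0::'a) 1)" by (simp add: emeasure_cball)
  have le: "emeasure lborel (cball (0::'a) 1) \<le> 0 + ennreal e" if e: "0 < e" for e
  proof -
    have "\<exists>S\<in>sets borel. (\<forall>x\<in>far_set. \<forall>t\<in>{0..?T}. ?f x t \<in> S) \<and> emeasure lborel S \<le> ennreal e"
      using e K(3) by (intro hausdorff_null_imp_lipschitz_image_null[OF m null, of K] lip) auto
    then obtain S where S: "S \<in> sets borel" "\<And>x t. x \<in> far_set \<Longrightarrow> t \<in> {0..?T} \<Longrightarrow> ?f x t \<in> S"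
      "emeasure lborel S \<le> ennreal e" by blast
    have "cball 0 1 \<subseteq> S" using cov S(2) by blast
    then have "emeasure lborel (cball (0::'a) 1) \<le> emeasure lborel S" using S(1) by (intro emeasure_mono) auto
    then show ?thesis using S(3) by simp
  qed
  have "emeasure lborel (cball (0::'a) 1) \<le> 0" by (rule ennreal_le_epsilon) (use le in auto)
  with pos show False by simp
qed

text \<open>The lower bound expresses that \<open>\<Omega>\<close> lies in the ball around \<open>a\<close> touching at \<open>q\<close>. For the upper
  bound, \<open>q\<close> lies in the ball touching at \<open>z\<close>, so \<open>(q - z) \<bullet> \<nabla>\<rho>(z) \<le> 0\<close>, and the gradients at \<open>q\<close> and \<open>z\<close>
  differ by \<open>O(|z - q|)\<close>.\<close>

lemma far_set_support:
  obtains R C where "0 < R" "0 \<le> C"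
    "\<And>q. q \<in> far_set \<Longrightarrow> \<exists>\<nu>. norm \<nu> \<le> R \<and> (\<forall>z\<in>frontier \<Omega>. (norm (z - q))\<^sup>2 / 2 \<le> (q - z) \<bullet> \<nu>) \<and>
      (\<forall>z\<in>far_set. (q - z) \<bullet> \<nu> \<le> C * (norm (z - q))\<^sup>2)"
proof -
  obtain L where L: "0 \<le> L" "\<And>x y. x \<in> frontier \<Omega> \<Longrightarrow> y \<in> frontier \<Omega> \<Longrightarrow> norm (grad x - grad y) \<le> L * norm (x - y)"
    using grad_lipschitz by blast
  obtain T where T: "\<And>q. q \<in> frontier \<Omega> \<Longrightarrow> (norm q + 1) / norm (grad q) \<le> T"
    using farthest_parameter_bounded by blast
  obtain R0 where R0: "\<And>q. q \<in> frontier \<Omega> \<Longrightarrow> norm q \<le> R0"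
    using compact_imp_bounded[OF compact_frontier] by (auto simp: bounded_iff)
  \<comment> \<open>Squaring |z - a| <= |q - a| and expanding around \<open>q\<close> leaves |z -
    q|^2 as the gain.\<close>
  have supp: "(norm (z - q))\<^sup>2 / 2 \<le> (q - z) \<bullet> (q - a)" if "farthest_from a q" "z \<in> frontier \<Omega>" for z q a
  proof -
    have "z \<in> closure \<Omega>" using that(2) by (simp add: frontier_def)
    then have "norm ((q - a) + (z - q)) \<le> norm (q - a)" using that(1) by (simp add: farthest_from_def dist_norm)
    then have "(norm ((q - a) + (z - q)))\<^sup>2 \<le> (norm (q - a))\<^sup>2" by (intro power_mono) auto
    then have "2 * ((z - q) \<bullet> (q - a)) + (norm (z - q))\<^sup>2 \<le> 0"
      unfolding norm_add_square by simp
    then show ?thesis by (simp add: inner_diff_left)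
  qed
  show ?thesis
  proof (rule that[of "\<bar>R0\<bar> + 1" "\<bar>T\<bar> * L"])
    fix q assume "q \<in> far_set"
    then obtain a where a: "a \<in> cball 0 1" "farthest_from a q" by (auto simp: far_set_def)
    obtain t where t: "0 \<le> t" "q - a = t *\<^sub>R grad q" "t = norm (q - a) / norm (grad q)"
      using a(2) by (rule farthest_grad)
    have qf: "q \<in> frontier \<Omega>" using a(2) by (simp add: farthest_from_def)
    have qa: "norm (q - a) \<le> norm q + 1" using a(1) norm_triangle_ineq4[of q a] by simp
    then have "t \<le> (norm q + 1) / norm (grad q)" unfolding t(3) by (intro divide_right_mono) auto
    also have "\<dots> \<le> \<bar>T\<bar>" using T[OF qf] by linarith
    finally have tT: "t \<le> \<bar>T\<bar>" .
    show "\<exists>\<nu>. norm \<nu> \<le> \<bar>R0\<bar> + 1 \<and> (\<forall>z\<in>frontier \<Omega>. (norm (z - q))\<^sup>2 / 2 \<le> (q - z) \<bullet> \<nu>) \<and>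
      (\<forall>z\<in>far_set. (q - z) \<bullet> \<nu> \<le> \<bar>T\<bar> * L * (norm (z - q))\<^sup>2)"
    proof (intro exI[of _ "q - a"] conjI ballI)
      show "norm (q - a) \<le> \<bar>R0\<bar> + 1" using qa R0[OF qf] by linarith
      show "(norm (z - q))\<^sup>2 / 2 \<le> (q - z) \<bullet> (q - a)" if "z \<in> frontier \<Omega>" for z
        by (rule supp[OF a(2) that])
      fix z assume "z \<in> far_set"
      then obtain a' where a': "farthest_from a' z" by (auto simp: far_set_def)
      obtain t' where t': "0 \<le> t'" "z - a' = t' *\<^sub>R grad z" using a' by (rule farthest_grad)
      have zf: "z \<in> frontier \<Omega>" using a' by (simp add: farthest_from_def)
      have "(q - z) \<bullet> grad z \<le> 0"
      \<comment> \<open>For t' = 0 the enclosing ball at \<open>z\<close> is a single point, which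
        forces q = z.\<close>
      proof (cases "t' = 0")
        case True
        have "(norm (q - z))\<^sup>2 / 2 \<le> 0" using supp[OF a' qf] t'(2) True by simp
        then show ?thesis by simp
      next
        case False
        have "0 \<le> (norm (q - z))\<^sup>2 / 2" by simp
        also have "\<dots> \<le> (z - q) \<bullet> (z - a')" by (rule supp[OF a' qf])
        also have "\<dots> = t' * ((z - q) \<bullet> grad z)" by (simp add: t'(2))
        finally have "0 \<le> (z - q) \<bullet> grad z" using False t'(1) by (simp add: zero_le_mult_iff)
        then show ?thesis by (simp add: inner_diff_left)
      qed
      then have "(q - z) \<bullet> grad q \<le> (q - z) \<bullet> (grad q - grad z)" by (simp add: inner_diff_right)
      also have "\<dots> \<le> norm (q - z) * norm (grad q - grad z)" by (rule norm_cauchy_schwarz)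
      also have "\<dots> \<le> norm (q - z) * (L * norm (q - z))" by (intro mult_left_mono L(2) qf zf) auto
      also have "\<dots> = L * (norm (z - q))\<^sup>2" by (simp add: power2_eq_square norm_minus_commute)
      finally have "t * ((q - z) \<bullet> grad q) \<le> t * (L * (norm (z - q))\<^sup>2)" using t(1) by (intro mult_left_mono)
      also have "\<dots> \<le> \<bar>T\<bar> * (L * (norm (z - q))\<^sup>2)" using tT L(1) by (intro mult_right_mono) auto
      finally show "(q - z) \<bullet> (q - a) \<le> \<bar>T\<bar> * L * (norm (z - q))\<^sup>2" by (simp add: t(2) mult.assoc)
    qed
  qed (use L in auto)
qed

end

section \<open>Orthonormal systems by Haar splitting\<close>

text \<open>Indexed by the functions themselves, so that finite systems grow by set union; two
  different members cannot agree almost everywhere.\<close>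

definition L2_orthonormal_set :: "'a measure \<Rightarrow> ('a \<Rightarrow> complex) set \<Rightarrow> bool" where
  "L2_orthonormal_set M S \<longleftrightarrow> (\<forall>f\<in>S. \<forall>g\<in>S. L2_inner M f g = (if f = g then 1 else 0))"

text \<open>Equality almost everywhere, since a Gram-Schmidt residual of norm 0 vanishes only up to
  a null set.\<close>

definition in_AE_span :: "'a measure \<Rightarrow> ('a \<Rightarrow> complex) set \<Rightarrow> ('a \<Rightarrow> complex) \<Rightarrow> bool" where
  "in_AE_span M S u \<longleftrightarrow> (\<exists>c. AE x in M. u x = (\<Sum>f\<in>S. c f * f x))"

lemma in_AE_span_mono:
  assumes "in_AE_span M S u" "S \<subseteq> T" "finite T"
  shows "in_AE_span M T u"
proof -
  obtain c where c: "AE x in M. u x = (\<Sum>f\<in>S. c f * f x)"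
    using assms(1) by (auto simp: in_AE_span_def)
  have "(\<Sum>f\<in>T. (if f \<in> S then c f else 0) * f x) = (\<Sum>f\<in>S. c f * f x)" for x
    using assms(2,3) by (intro sum.mono_neutral_cong_right) auto
  with c show ?thesis unfolding in_AE_span_def by (intro exI[of _ "\<lambda>f. if f \<in> S then c f else 0"]) simp
qed

lemma in_AE_span_lincomb:
  assumes "in_AE_span M S u" "in_AE_span M S v"
  shows "in_AE_span M S (\<lambda>x. a * u x + b * v x)"
proof -
  obtain c d where cd: "AE x in M. u x = (\<Sum>f\<in>S. c f * f x)" "AE x in M. v x = (\<Sum>f\<in>S. d f * f x)"
    using assms by (auto simp: in_AE_span_def)
  have "AE x in M. a * u x + b * v x = (\<Sum>f\<in>S. (a * c f + b * d f) * f x)"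
    using cd by eventually_elim
      (simp add: sum_distrib_left sum.distrib[symmetric] algebra_simps)
  then show ?thesis unfolding in_AE_span_def by (rule exI[where x="\<lambda>f. a * c f + b * d f"])
qed

lemma in_AE_span_sum:
  assumes "finite I" "\<And>i. i \<in> I \<Longrightarrow> in_AE_span M S (u i)"
  shows "in_AE_span M S (\<lambda>x. \<Sum>i\<in>I. a i * u i x)"
  using assms
proof (induction I)
  case empty
  then show ?case unfolding in_AE_span_def by (intro exI[of _ "\<lambda>_. 0"]) simp
next
  case (insert i I)
  then show ?case
    using in_AE_span_lincomb[of M S "u i" "\<lambda>x. \<Sum>i\<in>I. a i * u i x" "a i" 1] by simp
qed

lemma in_AE_span_member: "f \<in> S \<Longrightarrow> finite S \<Longrightarrow> in_AE_span M S f"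
  unfolding in_AE_span_def by (intro exI[of _ "\<lambda>g. if g = f then 1 else 0"]) (simp add: if_distrib[of "\<lambda>c. c * _"] sum.delta cong: if_cong)

lemma L2_inner_cnj: "cnj (L2_inner M f g) = L2_inner M g f"
  using Bochner_Integration.integral_cnj[of M "\<lambda>x. f x * cnj (g x)"] by (simp add: L2_inner_def mult.commute)

lemma L2_inner_self: "L2_inner M f f = of_real (LINT x|M. (norm (f x))\<^sup>2)"
  unfolding L2_inner_def
  by (simp add: complex_norm_square[symmetric] del: of_real_power flip: integral_complex_of_real)

text \<open>Boundedness makes all inner products exist on a finite measure, and it gives every unit
  vector some sup bound from which the splitting can start.\<close>

locale bounded_function_space = finite_measure M for M :: "'a measure" +
  fixes E :: "('a \<Rightarrow> complex) set"
  assumes zero_mem: "(\<lambda>_. 0) \<in> E"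
    and lincomb_mem: "f \<in> E \<Longrightarrow> g \<in> E \<Longrightarrow> (\<lambda>x. a * f x + b * g x) \<in> E"
    and measurable_mem [measurable_dest]: "f \<in> E \<Longrightarrow> f \<in> borel_measurable M"
    and bounded_mem: "f \<in> E \<Longrightarrow> \<exists>B. \<forall>x\<in>space M. norm (f x) \<le> B"
begin

lemma sum_mem:
  assumes "finite I" "\<And>i. i \<in> I \<Longrightarrow> u i \<in> E"
  shows "(\<lambda>x. \<Sum>i\<in>I. a i * u i x) \<in> E"
  using assms
proof (induction I)
  case (insert i I)
  then show ?case using lincomb_mem[of "u i" "\<lambda>x. \<Sum>i\<in>I. a i * u i x" "a i" 1] by simp
qed (simp add: zero_mem)

lemma scale_mem: "f \<in> E \<Longrightarrow> (\<lambda>x. a * f x) \<in> E"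
  using lincomb_mem[of f f a 0] by simp

lemma integrable_mult_cnj:
  assumes "f \<in> E" "g \<in> E"
  shows "integrable M (\<lambda>x. f x * cnj (g x))"
proof -
  obtain A B where "\<forall>x\<in>space M. norm (f x) \<le> A" "\<forall>x\<in>space M. norm (g x) \<le> B"
    using assms bounded_mem by metis
  then have "norm (f x * cnj (g x)) \<le> A * B" if "x \<in> space M" for x
    using that norm_ge_zero[of "f x"] unfolding norm_mult complex_mod_cnj
    by (intro mult_mono norm_ge_zero) (auto intro: order_trans[OF norm_ge_zero])
  moreover have "(\<lambda>x. cnj (g x)) \<in> borel_measurable M"
    by (rule measurable_compose[OF measurable_mem[OF assms(2)] borel_measurable_continuous_onI])
      (intro continuous_intros)
  ultimately show ?thesis
    using measurable_mem[OF assms(1)]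
    by (intro integrable_const_bound[where B="A * B"] AE_I2) auto
qed

lemma integrable_norm_square: "f \<in> E \<Longrightarrow> integrable M (\<lambda>x. (norm (f x))\<^sup>2)"
  using integrable_norm[OF integrable_mult_cnj[of f f]] by (simp add: norm_mult power2_eq_square)

lemma mem_L2_space: "f \<in> E \<Longrightarrow> f \<in> L2_space M"
  using integrable_norm_square measurable_mem by (auto simp: L2_space_def)

lemma L2_inner_lincomb_left:
  assumes "f \<in> E" "g \<in> E" "h \<in> E"
  shows "L2_inner M (\<lambda>x. a * f x + b * g x) h = a * L2_inner M f h + b * L2_inner M g h"
  using assms integrable_mult_cnj[of f h] integrable_mult_cnj[of g h]
  unfolding L2_inner_def by (simp add: ring_distribs mult.assoc)

lemma L2_inner_lincomb_right:
  assumes "f \<in> E" "g \<in> E" "h \<in> E"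
  shows "L2_inner M h (\<lambda>x. a * f x + b * g x) = cnj a * L2_inner M h f + cnj b * L2_inner M h g"
  using L2_inner_lincomb_left[OF assms, of a b] L2_inner_cnj[of M "\<lambda>x. a * f x + b * g x" h]
  by (simp add: L2_inner_cnj)

lemma L2_inner_sum_left:
  assumes "finite I" "\<And>i. i \<in> I \<Longrightarrow> u i \<in> E" "h \<in> E"
  shows "L2_inner M (\<lambda>x. \<Sum>i\<in>I. a i * u i x) h = (\<Sum>i\<in>I. a i * L2_inner M (u i) h)"
  using assms
proof (induction I)
  case (insert i I)
  then show ?case
    using L2_inner_lincomb_left[OF _ sum_mem[of I u a], of "u i" h "a i" 1] by simp
qed (simp add: L2_inner_def)

text \<open>A Gram-Schmidt step, with Pythagoras for its length. It serves twice: to reach a new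
  generator, and to make a bounded sum of peaks exactly orthogonal to \<open>S\<close>.\<close>

lemma residual:
  assumes S: "finite S" "S \<subseteq> E" "L2_orthonormal_set M S" and g: "g \<in> E"
  defines "r \<equiv> \<lambda>x. g x - (\<Sum>f\<in>S. L2_inner M g f * f x)"
  shows "r \<in> E" "f \<in> S \<Longrightarrow> L2_inner M r f = 0"
    "L2_inner M r r = L2_inner M g g - of_real (\<Sum>f\<in>S. (norm (L2_inner M g f))\<^sup>2)"
proof -
  let ?p = "\<lambda>x. \<Sum>f\<in>S. L2_inner M g f * f x"
  have p: "?p \<in> E" using S sum_mem[of S "\<lambda>f. f" "L2_inner M g"] by auto
  have r: "r = (\<lambda>x. 1 * g x + (-1) * ?p x)" by (simp add: r_def)
  show rE: "r \<in> E" unfolding r by (rule lincomb_mem[OF g p])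
  have pf: "L2_inner M ?p h = (\<Sum>f\<in>S. L2_inner M g f * L2_inner M f h)" if "h \<in> E" for h
    using S that by (intro L2_inner_sum_left) auto
  show ort: "L2_inner M r f = 0" if f: "f \<in> S" for f
  proof -
    have "(\<Sum>k\<in>S. L2_inner M g k * L2_inner M k f) = (\<Sum>k\<in>S. if k = f then L2_inner M g f else 0)"
      using S f by (intro sum.cong) (auto simp: L2_orthonormal_set_def)
    also have "\<dots> = L2_inner M g f" using S f by simp
    finally show ?thesis
      using L2_inner_lincomb_left[OF g p, of f 1 "-1"] pf[of f] f S(2) unfolding r by auto
  qed
  have "L2_inner M r ?p = cnj (L2_inner M ?p r)" by (simp add: L2_inner_cnj)
  also have "L2_inner M ?p r = (\<Sum>f\<in>S. L2_inner M g f * L2_inner M f r)" by (rule pf[OF rE])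
  also have "\<dots> = 0" using ort L2_inner_cnj[of M r] by (intro sum.neutral) (metis complex_cnj_zero mult_zero_right)
  finally have rp: "L2_inner M r ?p = 0" by simp
  have "L2_inner M r r = L2_inner M r g"
    using L2_inner_lincomb_right[OF g p rE, of 1 "-1"] rp unfolding r[symmetric] by simp
  also have "\<dots> = L2_inner M g g - L2_inner M ?p g"
    using L2_inner_lincomb_left[OF g p g, of 1 "-1"] unfolding r[symmetric] by simp
  also have "L2_inner M ?p g = (\<Sum>f\<in>S. L2_inner M g f * cnj (L2_inner M g f))"
    using pf[OF g] by (simp add: L2_inner_cnj)
  finally show "L2_inner M r r = L2_inner M g g - of_real (\<Sum>f\<in>S. (norm (L2_inner M g f))\<^sup>2)"
    by (simp only: of_real_sum complex_norm_square)
qed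

lemma normalize:
  assumes g: "g \<in> E" and pos: "0 < Re (L2_inner M g g)"
  shows "L2_inner M (\<lambda>x. of_real (1 / sqrt (Re (L2_inner M g g))) * g x)
      (\<lambda>x. of_real (1 / sqrt (Re (L2_inner M g g))) * g x) = 1"
proof -
  define a where "a = complex_of_real (1 / sqrt (Re (L2_inner M g g)))"
  have "L2_inner M (\<lambda>x. a * g x) (\<lambda>x. a * g x) = a * cnj a * L2_inner M g g"
    unfolding L2_inner_def by (simp add: mult_ac)
  also have "L2_inner M g g = of_real (Re (L2_inner M g g))" by (simp add: L2_inner_self)
  also have "a * cnj a * of_real (Re (L2_inner M g g)) = 1"
    using pos by (simp add: a_def flip: of_real_mult)
  finally show ?thesis unfolding a_def .
qed

lemma Re_L2_inner_self_nonneg: "0 \<le> Re (L2_inner M f f)"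
  by (simp add: L2_inner_self)

lemma AE_zero_of_L2_inner_self:
  assumes "f \<in> E" "L2_inner M f f = 0"
  shows "AE x in M. f x = 0"
proof -
  have "(LINT x|M. (norm (f x))\<^sup>2) = 0" using assms(2) by (simp add: L2_inner_self)
  then have "AE x in M. (norm (f x))\<^sup>2 = 0"
    using integral_nonneg_eq_0_iff_AE[OF integrable_norm_square[OF assms(1)]] by simp
  then show ?thesis by simp
qed

end

text \<open>The interface between analysis and algebra. \<open>C\<close> does not depend on
  \<open>S\<close>, and the members of \<open>S\<close> carry no common sup bound: the splitting
  applies \<open>extension\<close> to systems that contain a large unit vector.\<close>

locale bounded_extension_space = bounded_function_space +
  fixes C :: real
  assumes C_nonneg: "0 \<le> C"
    and extension: "finite S \<Longrightarrow> S \<subseteq> E \<Longrightarrow> L2_orthonormal_set M S \<Longrightarrow>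
      \<exists>h\<in>E. L2_inner M h h = 1 \<and> (\<forall>f\<in>S. L2_inner M h f = 0) \<and> (\<forall>x\<in>space M. norm (h x) \<le> C)"
begin

lemma L2_orthonormal_set_insert:
  assumes "L2_orthonormal_set M S" "L2_inner M u u = 1" "\<And>f. f \<in> S \<Longrightarrow> L2_inner M u f = 0"
  shows "L2_orthonormal_set M (insert u S)"
  using assms L2_inner_cnj[of M u] unfolding L2_orthonormal_set_def
  by (metis complex_cnj_zero insert_iff zero_neq_one)

text \<open>Haar-type splitting: a unit vector \<open>u\<close> is replaced by \<open>(u + h) / \<surd>2\<close> and \<open>(u - h) / \<surd>2\<close> with
  a fresh bounded \<open>h\<close>. The bound \<open>b\<close> of \<open>u\<close> becomes \<open>(b + C) / \<surd>2\<close>, whose fixed point is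
  \<open>(1 + \<surd>2) * C\<close>.\<close>

lemma split_into_bounded:
  assumes "finite S" "S \<subseteq> E" "L2_orthonormal_set M S"
    and "u \<in> E" "L2_inner M u u = 1" "\<And>f. f \<in> S \<Longrightarrow> L2_inner M u f = 0"
    and "\<And>x. x \<in> space M \<Longrightarrow> norm (u x) \<le> (1 + sqrt 2) * C + sqrt 2 ^ m"
  shows "\<exists>T. finite T \<and> T \<subseteq> E \<and> L2_orthonormal_set M (S \<union> T) \<and> S \<inter> T = {} \<and>
    (\<forall>f\<in>T. \<forall>x\<in>space M. norm (f x) \<le> (1 + sqrt 2) * C + 1) \<and> in_AE_span M T u"
  using assms
proof (induction m arbitrary: S u)
  case 0
  then show ?case
    using L2_orthonormal_set_insert[of S u]
    by (intro exI[of _ "{u}"]) (auto intro!: in_AE_span_member)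
next
  case (Suc m)
  have "L2_orthonormal_set M (insert u S)" using Suc.prems by (intro L2_orthonormal_set_insert)
  then have "\<exists>h\<in>E. L2_inner M h h = 1 \<and> (\<forall>f\<in>insert u S. L2_inner M h f = 0) \<and>
      (\<forall>x\<in>space M. norm (h x) \<le> C)"
    using Suc.prems by (intro extension) auto
  then obtain h where h: "h \<in> E" "L2_inner M h h = 1" "\<And>f. f \<in> insert u S \<Longrightarrow> L2_inner M h f = 0"
    "\<And>x. x \<in> space M \<Longrightarrow> norm (h x) \<le> C"
    by blast
  have hu: "L2_inner M h u = 0" "L2_inner M u h = 0"
    using h(3)[of u] L2_inner_cnj[of M h u] by auto
  define s where "s = complex_of_real (1 / sqrt 2)"
  have s: "s * s = 1 / 2" "cnj s = s"
    by (simp_all add: s_def flip: of_real_mult)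
  have norm_s: "norm s = 1 / sqrt 2" unfolding s_def norm_of_real by simp
  define v where "v = (\<lambda>x. s * u x + s * h x)"
  define w where "w = (\<lambda>x. s * u x + (- s) * h x)"
  have uE: "u \<in> E" by fact
  have vw: "v \<in> E" "w \<in> E" unfolding v_def w_def by (rule lincomb_mem[OF uE h(1)])+
  have ip: "L2_inner M v f = s * L2_inner M u f + s * L2_inner M h f"
    "L2_inner M w f = s * L2_inner M u f - s * L2_inner M h f" if "f \<in> E" for f
    using L2_inner_lincomb_left[OF uE h(1) that, of s s] L2_inner_lincomb_left[OF uE h(1) that, of s "-s"]
    unfolding v_def[symmetric] w_def[symmetric] by auto
  have ipr: "L2_inner M f v = s * L2_inner M f u + s * L2_inner M f h"
    "L2_inner M f w = s * L2_inner M f u - s * L2_inner M f h" if "f \<in> E" for f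
    using L2_inner_lincomb_right[OF uE h(1) that, of s s] L2_inner_lincomb_right[OF uE h(1) that, of s "-s"] s(2)
    unfolding v_def[symmetric] w_def[symmetric] by auto
  have s': "s * (s * z) = z / 2" for z by (simp add: s(1) flip: mult.assoc)
  have vv: "L2_inner M v v = 1" "L2_inner M w w = 1" "L2_inner M v w = 0"
    by (simp_all only: ip[OF vw(1)] ip[OF vw(2)] ipr[OF uE] ipr[OF h(1)] h(2) hu Suc.prems(5))
       (simp_all add: s' right_diff_distrib distrib_left s)
  have bnd: "norm (v x) \<le> (1 + sqrt 2) * C + sqrt 2 ^ m" "norm (w x) \<le> (1 + sqrt 2) * C + sqrt 2 ^ m"
    if "x \<in> space M" for x
  proof -
    \<comment> \<open>The term ((1 + sqrt 2) C + C) / sqrt 2 reproduces the fixed point (1 + sqrt 2)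
      C, and the excess over it loses one factor sqrt 2.\<close>
    have "(norm (u x) + norm (h x)) / sqrt 2 \<le> ((1 + sqrt 2) * C + sqrt 2 ^ Suc m + C) / sqrt 2"
      using Suc.prems(7)[OF that] h(4)[OF that] by (intro divide_right_mono) auto
    also have "\<dots> = (1 + sqrt 2) * C + sqrt 2 ^ m"
      by (simp add: field_simps)
    finally have *: "norm (s * u x) + norm (s * h x) \<le> (1 + sqrt 2) * C + sqrt 2 ^ m"
      by (simp add: norm_mult norm_s add_divide_distrib)
    show "norm (v x) \<le> (1 + sqrt 2) * C + sqrt 2 ^ m"
      unfolding v_def by (rule order_trans[OF norm_triangle_ineq *])
    show "norm (w x) \<le> (1 + sqrt 2) * C + sqrt 2 ^ m"
      using order_trans[OF norm_triangle_ineq4 *] unfolding w_def by simp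
  qed
  have orthS: "L2_inner M v f = 0" "L2_inner M w f = 0" if "f \<in> S" for f
    using ip[of f] that Suc.prems(2,6) h(3)[of f] by auto
  \<comment> \<open>While \<open>v\<close> is split, \<open>w\<close> stays in the orthonormal set,
    so that the new vectors remain orthogonal to it; the resulting \<open>T1\<close> then joins
    \<open>S\<close> for the splitting of \<open>w\<close>.\<close>
  have "\<exists>T. finite T \<and> T \<subseteq> E \<and> L2_orthonormal_set M (insert w S \<union> T) \<and> insert w S \<inter> T = {} \<and>
    (\<forall>f\<in>T. \<forall>x\<in>space M. norm (f x) \<le> (1 + sqrt 2) * C + 1) \<and> in_AE_span M T v"
    by (rule Suc.IH) (use Suc.prems vw vv orthS bnd in \<open>auto intro!: L2_orthonormal_set_insert\<close>)
  then obtain T1 where T1: "finite T1" "T1 \<subseteq> E" "L2_orthonormal_set M (insert w S \<union> T1)"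
    "insert w S \<inter> T1 = {}" "\<forall>f\<in>T1. \<forall>x\<in>space M. norm (f x) \<le> (1 + sqrt 2) * C + 1" "in_AE_span M T1 v"
    by blast
  have "\<exists>T. finite T \<and> T \<subseteq> E \<and> L2_orthonormal_set M ((S \<union> T1) \<union> T) \<and> (S \<union> T1) \<inter> T = {} \<and>
    (\<forall>f\<in>T. \<forall>x\<in>space M. norm (f x) \<le> (1 + sqrt 2) * C + 1) \<and> in_AE_span M T w"
  proof (rule Suc.IH)
    show "L2_orthonormal_set M (S \<union> T1)" using T1(3) by (auto simp: L2_orthonormal_set_def)
    show "L2_inner M w f = 0" if "f \<in> S \<union> T1" for f
    proof (cases "f \<in> S")
      case False
      then have "f \<in> T1" "f \<noteq> w" using that T1(4) by auto
      then show ?thesis using T1(3) by (auto simp: L2_orthonormal_set_def)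
    qed (rule orthS)
  qed (use Suc.prems T1 vw vv bnd in auto)
  then obtain T2 where T2: "finite T2" "T2 \<subseteq> E" "L2_orthonormal_set M ((S \<union> T1) \<union> T2)"
    "(S \<union> T1) \<inter> T2 = {}" "\<forall>f\<in>T2. \<forall>x\<in>space M. norm (f x) \<le> (1 + sqrt 2) * C + 1" "in_AE_span M T2 w"
    by blast
  have "u = (\<lambda>x. s * v x + s * w x)"
    by (simp add: v_def w_def algebra_simps s')
  then have "in_AE_span M (T1 \<union> T2) u"
    using T1 T2 in_AE_span_lincomb[of M "T1 \<union> T2" v w s s] in_AE_span_mono[of M T1 v "T1 \<union> T2"]
      in_AE_span_mono[of M T2 w "T1 \<union> T2"] by auto
  then show ?case
    using T1 T2 by (intro exI[of _ "T1 \<union> T2"]) (auto simp: Un_assoc)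
qed

text \<open>A fresh \<open>h\<close> is inserted before \<open>g\<close> is considered, so the
  system grows strictly even if \<open>g\<close> already lies in its span. This makes the final
  sequence infinite.\<close>

lemma extend_to_span:
  assumes S: "finite S" "S \<subseteq> E" "L2_orthonormal_set M S"
    and bS: "\<And>f x. f \<in> S \<Longrightarrow> x \<in> space M \<Longrightarrow> norm (f x) \<le> (1 + sqrt 2) * C + 1"
    and g: "g \<in> E"
  shows "\<exists>T. finite T \<and> S \<subset> T \<and> T \<subseteq> E \<and> L2_orthonormal_set M T \<and>
    (\<forall>f\<in>T. \<forall>x\<in>space M. norm (f x) \<le> (1 + sqrt 2) * C + 1) \<and> in_AE_span M T g"
proof -
  obtain h where h: "h \<in> E" "L2_inner M h h = 1" "\<And>f. f \<in> S \<Longrightarrow> L2_inner M h f = 0"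
    "\<And>x. x \<in> space M \<Longrightarrow> norm (h x) \<le> C"
    using extension[OF S] by auto
  define R where "R = insert h S"
  have "C \<le> (1 + sqrt 2) * C + 1" using C_nonneg by (simp add: algebra_simps)
  then have bR: "norm (f x) \<le> (1 + sqrt 2) * C + 1" if "f \<in> R" "x \<in> space M" for f x
    using that bS[of f x] h(4)[of x] by (auto simp: R_def)
  have "h \<notin> S" using h(2) h(3)[of h] by auto
  then have R: "finite R" "S \<subset> R" "R \<subseteq> E" using S h(1) by (auto simp: R_def)
  have oR: "L2_orthonormal_set M R"
    unfolding R_def by (rule L2_orthonormal_set_insert[OF S(3) h(2,3)])
  note R = R oR bR
  define r where "r = (\<lambda>x. g x - (\<Sum>f\<in>R. L2_inner M g f * f x))"
  have r: "r \<in> E" "\<And>f. f \<in> R \<Longrightarrow> L2_inner M r f = 0"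
    using residual(1,2)[OF R(1,3,4) g] by (auto simp: r_def)
  have span_g: "in_AE_span M T g" if "in_AE_span M T r" "R \<subseteq> T" "finite T" for T
  proof -
    have "in_AE_span M T (\<lambda>x. \<Sum>f\<in>R. L2_inner M g f * f x)"
      by (rule in_AE_span_sum) (use R that in \<open>auto intro!: in_AE_span_member\<close>)
    from in_AE_span_lincomb[OF that(1) this, of 1 1] show ?thesis by (simp add: r_def)
  qed
  show ?thesis
  proof (cases "Re (L2_inner M r r) = 0")
    case True
    then have "L2_inner M r r = 0" by (simp add: L2_inner_self)
    then have "in_AE_span M R r"
      using AE_zero_of_L2_inner_self[OF r(1)] unfolding in_AE_span_def by (intro exI[of _ "\<lambda>_. 0"]) simp
    then show ?thesis using R span_g[of R] by (intro exI[of _ R]) auto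
  next
    case False
    then have pos: "0 < Re (L2_inner M r r)" using Re_L2_inner_self_nonneg[of r] by linarith
    define a where "a = 1 / sqrt (Re (L2_inner M r r))"
    define u where "u = (\<lambda>x. of_real a * r x)"
    have a: "0 < a" using pos by (simp add: a_def)
    have u: "u \<in> E" "L2_inner M u u = 1"
      using normalize[OF r(1) pos] scale_mem[OF r(1)] unfolding u_def a_def by blast+
    have uR: "L2_inner M u f = 0" if "f \<in> R" for f
      using r(2)[OF that] unfolding u_def L2_inner_def by (simp add: mult.assoc)
    obtain B where B: "\<And>x. x \<in> space M \<Longrightarrow> norm (u x) \<le> B" using bounded_mem[OF u(1)] by auto
    \<comment> \<open>The number of splittings depends on the sup bound of \<open>u\<close>; the
      bound that they reach does not.\<close>
    obtain m where m: "B < sqrt 2 ^ m" using real_arch_pow[of "sqrt 2" B] by auto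
    have "\<exists>T. finite T \<and> T \<subseteq> E \<and> L2_orthonormal_set M (R \<union> T) \<and> R \<inter> T = {} \<and>
      (\<forall>f\<in>T. \<forall>x\<in>space M. norm (f x) \<le> (1 + sqrt 2) * C + 1) \<and> in_AE_span M T u"
    proof (rule split_into_bounded)
      fix x assume "x \<in> space M"
      then have "norm (u x) \<le> sqrt 2 ^ m" using B[of x] m by linarith
      then show "norm (u x) \<le> (1 + sqrt 2) * C + sqrt 2 ^ m" using C_nonneg by (simp add: add_increasing)
    qed (use R u uR in auto)
    then obtain T where T: "finite T" "T \<subseteq> E" "L2_orthonormal_set M (R \<union> T)" "R \<inter> T = {}"
      "\<forall>f\<in>T. \<forall>x\<in>space M. norm (f x) \<le> (1 + sqrt 2) * C + 1" "in_AE_span M T u" by blast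
    have "in_AE_span M (R \<union> T) u" using T R by (intro in_AE_span_mono[OF T(6)]) auto
    from in_AE_span_lincomb[OF this this, of "of_real (1 / a)" 0]
    have "in_AE_span M (R \<union> T) r" using a by (simp add: u_def)
    then show ?thesis using R T span_g[of "R \<union> T"] by (intro exI[of _ "R \<union> T"]) auto
  qed
qed

text \<open>The last clause takes one finite \<open>F\<close> for the first \<open>K\<close>
  generators together, because a polynomial combines finitely many monomials. Strict growth makes
  the union of the finite systems countably infinite, so the naturals enumerate it
  injectively.\<close>

theorem bounded_orthonormal_basis:
  fixes G :: "nat \<Rightarrow> 'a \<Rightarrow> complex"
  assumes G: "\<And>k. G k \<in> E"
  obtains f where "\<And>n. f n \<in> E" "L2_orthonormal M f"
    "\<And>n x. x \<in> space M \<Longrightarrow> norm (f n x) \<le> (1 + sqrt 2) * C + 1"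
    "\<And>K. \<exists>F. finite F \<and> F \<subseteq> range f \<and> (\<forall>k<K. in_AE_span M F (G k))"
proof -
  let ?P = "\<lambda>S. finite S \<and> S \<subseteq> E \<and> L2_orthonormal_set M S \<and>
    (\<forall>f\<in>S. \<forall>x\<in>space M. norm (f x) \<le> (1 + sqrt 2) * C + 1)"
  have "\<exists>S. \<forall>n. ?P (S n) \<and> (S n \<subset> S (Suc n) \<and> in_AE_span M (S (Suc n)) (G n))"
  proof (rule dependent_nat_choice)
    show "\<exists>S. ?P S" by (intro exI[of _ "{}"]) (simp add: L2_orthonormal_set_def)
  next
    fix S n assume "?P S"
    then show "\<exists>T. ?P T \<and> (S \<subset> T \<and> in_AE_span M T (G n))"
      using extend_to_span[of S "G n"] G[of n] by auto
  qed
  then obtain S where "\<forall>n. ?P (S n) \<and> (S n \<subset> S (Suc n) \<and> in_AE_span M (S (Suc n)) (G n))"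
    by (elim exE)
  then have S: "?P (S n)" "S n \<subset> S (Suc n)" "in_AE_span M (S (Suc n)) (G n)" for n
    by iprover+
  have mono: "S m \<subseteq> S n" if "m \<le> n" for m n
    by (rule lift_Suc_mono_le[of S, OF psubset_imp_subset[OF S(2)] that])
  define U where "U = (\<Union>n. S n)"
  have "n \<le> card (S n)" for n
  proof (induction n)
    case (Suc n)
    have "card (S n) < card (S (Suc n))" using S(1,2) by (intro psubset_card_mono) auto
    with Suc show ?case by simp
  qed simp
  note card_S = this
  have "infinite U"
  proof
    assume "finite U"
    then have "card (S (Suc (card U))) \<le> card U" by (rule card_mono) (auto simp: U_def)
    with card_S[of "Suc (card U)"] show False by simp
  qed
  moreover have "countable U" unfolding U_def using S(1) by (auto intro: countable_finite)
  ultimately have bij: "bij_betw (from_nat_into U) UNIV U" by (intro bij_betw_from_nat_into)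
  define f where "f = from_nat_into U"
  have f: "range f = U" "inj f" using bij by (auto simp: f_def bij_betw_def)
  have fU: "f n \<in> U" for n using f by auto
  have U: "L2_orthonormal_set M U"
    unfolding L2_orthonormal_set_def
  proof (intro ballI)
    fix p q assume "p \<in> U" "q \<in> U"
    then obtain m n where "p \<in> S m" "q \<in> S n" by (auto simp: U_def)
    then have "p \<in> S (max m n)" "q \<in> S (max m n)"
      using subsetD[OF mono[OF max.cobounded1[of m n]]] subsetD[OF mono[OF max.cobounded2[of n m]]] by blast+
    then show "L2_inner M p q = (if p = q then 1 else 0)"
      using S(1)[of "max m n"] unfolding L2_orthonormal_set_def by blast
  qed
  show ?thesis
  proof (rule that[of f])
    show fE: "f n \<in> E" for n
    proof -
      obtain k where "f n \<in> S k" using fU[of n] by (auto simp: U_def)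
      then show ?thesis using S(1)[of k] by blast
    qed
    show "L2_orthonormal M f"
      unfolding L2_orthonormal_def
    proof (intro conjI allI)
      show "f n \<in> L2_space M" for n by (rule mem_L2_space[OF fE])
      show "L2_inner M (f m) (f n) = (if m = n then 1 else 0)" for m n
        using U[unfolded L2_orthonormal_set_def, rule_format, OF fU fU, of m n] f(2) by (simp add: inj_eq)
    qed
    show "norm (f n x) \<le> (1 + sqrt 2) * C + 1" if "x \<in> space M" for n x
    proof -
      obtain k where "f n \<in> S k" using fU[of n] by (auto simp: U_def)
      then show ?thesis using S(1)[of k] that by blast
    qed
    show "\<exists>F. finite F \<and> F \<subseteq> range f \<and> (\<forall>k<K. in_AE_span M F (G k))" for K
    proof (intro exI[of _ "S K"] conjI allI impI)
      show "S K \<subseteq> range f" by (auto simp: f U_def)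
      show "in_AE_span M (S K) (G k)" if "k < K" for k
        using in_AE_span_mono[OF S(3)[of k] mono[of "Suc k" K]] that S(1)[of K] by auto
      show "finite (S K)" using S(1)[of K] by blast
    qed
  qed
qed

end

section \<open>Polynomials and choice of signs\<close>

definition monomial :: "('d \<Rightarrow> nat) \<Rightarrow> complex ^ 'd \<Rightarrow> complex" where
  "monomial \<alpha> z = (\<Prod>j\<in>UNIV. (z $ j) ^ \<alpha> j)"

lemma holomorphic_polynomial_iff:
  "holomorphic_polynomial p \<longleftrightarrow> (\<exists>A c. finite A \<and> p = (\<lambda>z. \<Sum>\<alpha>\<in>A. c \<alpha> * monomial \<alpha> z))"
  by (simp add: holomorphic_polynomial_def monomial_def)

text \<open>Repeated multi-indices are collected here once and for all, so that sums and products of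
  polynomials can be indexed by disjoint unions and products of index sets.\<close>

lemma holomorphic_polynomial_sum_monomials:
  assumes "finite I"
  shows "holomorphic_polynomial (\<lambda>z. \<Sum>i\<in>I. c i * monomial (m i) z)"
  unfolding holomorphic_polynomial_iff
proof (intro exI conjI)
  show "finite (m ` I)" using assms by simp
  show "(\<lambda>z. \<Sum>i\<in>I. c i * monomial (m i) z) =
      (\<lambda>z. \<Sum>\<alpha>\<in>m ` I. (\<Sum>i | i \<in> I \<and> m i = \<alpha>. c i) * monomial \<alpha> z)"
  proof
    fix z
    have "(\<Sum>i\<in>I. c i * monomial (m i) z) = (\<Sum>\<alpha>\<in>m ` I. \<Sum>i | i \<in> I \<and> m i = \<alpha>. c i * monomial (m i) z)"
      using assms by (rule sum.image_gen)
    also have "\<dots> = (\<Sum>\<alpha>\<in>m ` I. (\<Sum>i | i \<in> I \<and> m i = \<alpha>. c i) * monomial \<alpha> z)"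
      by (intro sum.cong refl) (simp add: sum_distrib_right)
    finally show "(\<Sum>i\<in>I. c i * monomial (m i) z) =
      (\<Sum>\<alpha>\<in>m ` I. (\<Sum>i | i \<in> I \<and> m i = \<alpha>. c i) * monomial \<alpha> z)" .
  qed
qed

lemma holomorphic_polynomial_monomial: "holomorphic_polynomial (monomial \<alpha>)"
  using holomorphic_polynomial_sum_monomials[of "{()}" "\<lambda>_. 1" "\<lambda>_. \<alpha>"] by simp

lemma holomorphic_polynomial_const: "holomorphic_polynomial (\<lambda>_. a)"
  using holomorphic_polynomial_sum_monomials[of "{()}" "\<lambda>_. a" "\<lambda>_ _. 0"] by (simp add: monomial_def)

lemma holomorphic_polynomial_component:
  fixes j :: "'d::finite"
  shows "holomorphic_polynomial (\<lambda>z :: complex ^ 'd. z $ j)"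
proof -
  have "monomial (\<lambda>i. if i = j then 1 else 0) z = z $ j" for z :: "complex ^ 'd"
    by (simp add: monomial_def if_distrib[of "\<lambda>n. _ ^ n"] cong: if_cong)
  then have "monomial (\<lambda>i. if i = j then 1 else 0) = (\<lambda>z :: complex ^ 'd. z $ j)" by (rule ext)
  then show ?thesis using holomorphic_polynomial_monomial by metis
qed

lemma holomorphic_polynomial_add:
  assumes "holomorphic_polynomial p" "holomorphic_polynomial q"
  shows "holomorphic_polynomial (\<lambda>z. p z + q z)"
proof -
  obtain A c B d where A: "finite A" "p = (\<lambda>z. \<Sum>\<alpha>\<in>A. c \<alpha> * monomial \<alpha> z)"
    and B: "finite B" "q = (\<lambda>z. \<Sum>\<alpha>\<in>B. d \<alpha> * monomial \<alpha> z)"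
    using assms unfolding holomorphic_polynomial_iff by auto
  have "(\<lambda>z. p z + q z) = (\<lambda>z. \<Sum>i\<in>A <+> B. case_sum c d i * monomial (case_sum id id i) z)"
    by (simp add: A B sum.Plus)
  then show ?thesis using holomorphic_polynomial_sum_monomials[of "A <+> B"] A B by simp
qed

lemma holomorphic_polynomial_mult:
  assumes "holomorphic_polynomial p" "holomorphic_polynomial q"
  shows "holomorphic_polynomial (\<lambda>z. p z * q z)"
proof -
  obtain A c B d where A: "finite A" "p = (\<lambda>z. \<Sum>\<alpha>\<in>A. c \<alpha> * monomial \<alpha> z)"
    and B: "finite B" "q = (\<lambda>z. \<Sum>\<alpha>\<in>B. d \<alpha> * monomial \<alpha> z)"
    using assms unfolding holomorphic_polynomial_iff by auto
  have "p z * q z = (\<Sum>i\<in>A \<times> B. (c (fst i) * d (snd i)) * monomial (\<lambda>j. fst i j + snd i j) z)" for z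
    unfolding A B sum_product sum.cartesian_product
    by (intro sum.cong refl) (auto simp: monomial_def power_add prod.distrib)
  then have "(\<lambda>z. p z * q z) = (\<lambda>z. \<Sum>i\<in>A \<times> B. (c (fst i) * d (snd i)) * monomial (\<lambda>j. fst i j + snd i j) z)"
    by (rule ext)
  then show ?thesis using holomorphic_polynomial_sum_monomials[of "A \<times> B"] A B by simp
qed

lemma holomorphic_polynomial_power:
  "holomorphic_polynomial p \<Longrightarrow> holomorphic_polynomial (\<lambda>z. p z ^ n)"
  by (induction n) (auto intro: holomorphic_polynomial_mult holomorphic_polynomial_const)

lemma holomorphic_polynomial_sum:
  "(\<And>i. i \<in> I \<Longrightarrow> holomorphic_polynomial (p i)) \<Longrightarrow> holomorphic_polynomial (\<lambda>z. \<Sum>i\<in>I. p i z)"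
  by (induction I rule: infinite_finite_induct)
     (auto intro: holomorphic_polynomial_add holomorphic_polynomial_const)

lemma holomorphic_polynomial_lincomb:
  "holomorphic_polynomial p \<Longrightarrow> holomorphic_polynomial q \<Longrightarrow> holomorphic_polynomial (\<lambda>z. a * p z + b * q z)"
  by (intro holomorphic_polynomial_add holomorphic_polynomial_mult holomorphic_polynomial_const)

lemma continuous_on_holomorphic_polynomial:
  "holomorphic_polynomial p \<Longrightarrow> continuous_on S p"
  unfolding holomorphic_polynomial_def by (auto intro!: continuous_intros)

text \<open>By the parallelogram law the larger of Q(h + e) and Q(h - e) is at least Q(h) + Q(e), a
  deterministic form of averaging over signs. In the application \<open>Q\<close> may be
  indefinite.\<close>

lemma exists_signs:
  fixes Q :: "('a \<Rightarrow> complex) \<Rightarrow> real"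
  assumes par: "\<And>u v. u \<in> E \<Longrightarrow> v \<in> E \<Longrightarrow> Q (\<lambda>x. u x + v x) + Q (\<lambda>x. u x - v x) = 2 * Q u + 2 * Q v"
    and E: "(\<lambda>_. 0) \<in> E" "\<And>u v. u \<in> E \<Longrightarrow> v \<in> E \<Longrightarrow> (\<lambda>x. u x + v x) \<in> E"
      "\<And>u v. u \<in> E \<Longrightarrow> v \<in> E \<Longrightarrow> (\<lambda>x. u x - v x) \<in> E"
    and Q0: "0 \<le> Q (\<lambda>_. 0)" and J: "finite J" "\<And>j. j \<in> J \<Longrightarrow> e j \<in> E"
  shows "\<exists>\<epsilon>. (\<forall>j. \<epsilon> j = 1 \<or> \<epsilon> j = -1) \<and> (\<lambda>x. \<Sum>j\<in>J. \<epsilon> j * e j x) \<in> E \<and>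
    (\<Sum>j\<in>J. Q (e j)) \<le> Q (\<lambda>x. \<Sum>j\<in>J. \<epsilon> j * e j x)"
  using J
proof (induction J)
  case empty
  show ?case using Q0 E(1) by (intro exI[of _ "\<lambda>_. 1"]) simp
next
  case (insert i J)
  then obtain \<epsilon> where \<epsilon>: "\<forall>j. \<epsilon> j = 1 \<or> \<epsilon> j = -1" "(\<lambda>x. \<Sum>j\<in>J. \<epsilon> j * e j x) \<in> E"
    "(\<Sum>j\<in>J. Q (e j)) \<le> Q (\<lambda>x. \<Sum>j\<in>J. \<epsilon> j * e j x)" by auto
  let ?h = "\<lambda>x. \<Sum>j\<in>J. \<epsilon> j * e j x"
  have ei: "e i \<in> E" using insert by simp
  have upd: "(\<lambda>x. \<Sum>j\<in>insert i J. (\<epsilon>(i := a)) j * e j x) = (\<lambda>x. a * e i x + ?h x)" for a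
    using insert.hyps by (auto simp: fun_eq_iff intro!: sum.cong)
  have "Q (e i) + Q ?h \<le> Q (\<lambda>x. ?h x + e i x) \<or> Q (e i) + Q ?h \<le> Q (\<lambda>x. ?h x - e i x)"
    using par[OF \<epsilon>(2) ei] by linarith
  then obtain a :: complex where a: "a = 1 \<or> a = -1" "Q (e i) + Q ?h \<le> Q (\<lambda>x. a * e i x + ?h x)"
    "(\<lambda>x. a * e i x + ?h x) \<in> E"
  proof
    assume "Q (e i) + Q ?h \<le> Q (\<lambda>x. ?h x + e i x)"
    then show ?thesis using that[of 1] E(2)[OF ei \<epsilon>(2)] by (simp add: add.commute)
  next
    assume "Q (e i) + Q ?h \<le> Q (\<lambda>x. ?h x - e i x)"
    then show ?thesis using that[of "-1"] E(3)[OF \<epsilon>(2) ei] by simp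
  qed
  show ?case
  proof (intro exI[of _ "\<epsilon>(i := a)"] conjI)
    show "\<forall>j. (\<epsilon>(i := a)) j = 1 \<or> (\<epsilon>(i := a)) j = -1" using \<epsilon>(1) a(1) by simp
    show "(\<lambda>x. \<Sum>j\<in>insert i J. (\<epsilon>(i := a)) j * e j x) \<in> E" unfolding upd by (rule a(3))
    show "(\<Sum>j\<in>insert i J. Q (e j)) \<le> Q (\<lambda>x. \<Sum>j\<in>insert i J. (\<epsilon>(i := a)) j * e j x)"
      unfolding upd using insert.hyps \<epsilon>(3) a(2) by simp
  qed
qed

section \<open>From many small pieces to one bounded extension\<close>

context bounded_function_space
begin

text \<open>The L1 norm of \<open>f\<close> is used because single peaks are small in L1.\<close>

lemma norm_L2_inner_le:
  assumes "f \<in> E" "g \<in> E" and B: "\<And>x. x \<in> space M \<Longrightarrow> norm (g x) \<le> B"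
  shows "norm (L2_inner M f g) \<le> B * (LINT x|M. norm (f x))"
proof -
  have one: "integrable M f"
  proof -
    obtain A where "\<forall>x\<in>space M. norm (f x) \<le> A" using bounded_mem[OF assms(1)] by auto
    then show ?thesis using measurable_mem[OF assms(1)] by (intro integrable_const_bound[of f A] AE_I2) auto
  qed
  have "norm (L2_inner M f g) \<le> (LINT x|M. norm (f x * cnj (g x)))"
    unfolding L2_inner_def by (rule integral_norm_bound)
  also have "\<dots> \<le> (LINT x|M. B * norm (f x))"
  proof (rule integral_mono)
    show "integrable M (\<lambda>x. norm (f x * cnj (g x)))" using integrable_mult_cnj[OF assms(1,2)] by (rule integrable_norm)
    show "integrable M (\<lambda>x. B * norm (f x))" using one by (intro integrable_mult_right integrable_norm)
    show "norm (f x * cnj (g x)) \<le> B * norm (f x)" if "x \<in> space M" for x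
      using B[OF that] by (simp add: norm_mult mult.commute[of B] mult_left_mono)
  qed
  finally show ?thesis by simp
qed

text \<open>The signs make the quadratic form \<open>\<parallel>h\<parallel>\<^sup>2 - K * \<parallel>P\<^sub>S h\<parallel>\<^sup>2\<close> of \<open>h = \<Sum>\<plusminus>e\<^sub>j\<close> at least the sum of
  its values at the \<open>e\<^sub>j\<close>; for large \<open>K\<close> this makes the projection \<open>P\<^sub>S h\<close> onto the span of \<open>S\<close> small.\<close>

lemma bounded_extension_of_small_pieces:
  assumes C1: "0 \<le> C1" and c: "0 < c"
    and pieces: "\<And>\<eta>. 0 < \<eta> \<Longrightarrow> \<exists>(J :: 'b set) e. finite J \<and> (\<forall>j\<in>J. e j \<in> E) \<and>
      (\<forall>x\<in>space M. (\<Sum>j\<in>J. norm (e j x)) \<le> C1) \<and> c \<le> (\<Sum>j\<in>J. LINT x|M. (norm (e j x))\<^sup>2) \<and>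
      (\<forall>j\<in>J. (LINT x|M. norm (e j x)) \<le> \<eta>)"
  shows "bounded_extension_space M E ((C1 + 1) / sqrt (c / 4))"
proof (unfold_locales)
  show "0 \<le> (C1 + 1) / sqrt (c / 4)" using C1 c by simp
next
  fix S assume S: "finite S" "S \<subseteq> E" "L2_orthonormal_set M S"
  define m where "m = measure M (space M)"
  have m: "0 \<le> m" by (simp add: m_def)
  have "\<exists>B. \<forall>x\<in>space M. norm (f x) \<le> B" if "f \<in> S" for f using bounded_mem S(2) that by auto
  then obtain B0 where B0: "\<And>f x. f \<in> S \<Longrightarrow> x \<in> space M \<Longrightarrow> norm (f x) \<le> B0 f" by metis
  define B where "B = (\<Sum>f\<in>S. \<bar>B0 f\<bar>)"
  have B: "norm (f x) \<le> B" if "f \<in> S" "x \<in> space M" for f x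
  proof -
    have "norm (f x) \<le> \<bar>B0 f\<bar>" using B0[OF that] by linarith
    also have "\<dots> \<le> B" unfolding B_def using S(1) that(1) by (intro member_le_sum) auto
    finally show ?thesis .
  qed
  have Bpos: "0 \<le> B" by (auto simp: B_def intro: sum_nonneg)
  define n where "n = real (card S)"
  \<comment> \<open>The first summand makes the projection of \<open>h\<close> at most 1 in sup-norm
    (via \<open>coef\<close>), the second makes its squared L2 norm at most c / 4
    (\<open>P1\<close>), and the 1 keeps \<open>K\<close> positive.\<close>
  define K where "K = (n * B * C1)\<^sup>2 * m + 4 * C1\<^sup>2 * m / c + 1"
  have K: "1 \<le> K" "(n * B * C1)\<^sup>2 * m \<le> K" "4 * C1\<^sup>2 * m / c \<le> K"
    using m c by (auto simp: K_def)
  define X where "X = K * n * B\<^sup>2 * C1 * m + 1"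
  \<comment> \<open>Chosen so that the penalty, \<open>K\<close> times the sum of all
    \<open>P (e j)\<close>, costs at most half of \<open>c\<close>.\<close>
  define \<eta> where "\<eta> = c / (2 * X)"
  have den: "0 < X"
    unfolding X_def using K(1) C1 m by (intro add_nonneg_pos mult_nonneg_nonneg) (auto simp: n_def)
  have \<eta>: "0 < \<eta>" using den c by (simp add: \<eta>_def)
  have \<eta>K: "K * n * B\<^sup>2 * C1 * m * \<eta> \<le> c / 2"
  proof -
    have "K * n * B\<^sup>2 * C1 * m * \<eta> \<le> X * \<eta>" using \<eta> by (simp add: X_def)
    also have "\<dots> = c / 2" using den by (simp add: \<eta>_def)
    finally show ?thesis .
  qed
  obtain J :: "'b set" and e where J: "finite J" "\<And>j. j \<in> J \<Longrightarrow> e j \<in> E"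
    "\<And>x. x \<in> space M \<Longrightarrow> (\<Sum>j\<in>J. norm (e j x)) \<le> C1" "c \<le> (\<Sum>j\<in>J. LINT x|M. (norm (e j x))\<^sup>2)"
    "\<And>j. j \<in> J \<Longrightarrow> (LINT x|M. norm (e j x)) \<le> \<eta>"
    using pieces[OF \<eta>] by blast
  define P where "P = (\<lambda>v. \<Sum>f\<in>S. (norm (L2_inner M v f))\<^sup>2)"
  define Q where "Q = (\<lambda>v. Re (L2_inner M v v) - K * P v)"
  have par1: "L2_inner M (\<lambda>x. u x + v x) f = L2_inner M u f + L2_inner M v f"
    "L2_inner M (\<lambda>x. u x - v x) f = L2_inner M u f - L2_inner M v f"
    if "u \<in> E" "v \<in> E" "f \<in> E" for u v f
    using L2_inner_lincomb_left[OF that, of 1 1] L2_inner_lincomb_left[OF that, of 1 "-1"] by auto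
  have par2: "L2_inner M f (\<lambda>x. u x + v x) = L2_inner M f u + L2_inner M f v"
    "L2_inner M f (\<lambda>x. u x - v x) = L2_inner M f u - L2_inner M f v"
    if "u \<in> E" "v \<in> E" "f \<in> E" for u v f
    using L2_inner_lincomb_right[OF that, of 1 1] L2_inner_lincomb_right[OF that, of 1 "-1"] by auto
  have addE: "(\<lambda>x. u x + v x) \<in> E" "(\<lambda>x. u x - v x) \<in> E" if "u \<in> E" "v \<in> E" for u v
    using lincomb_mem[OF that, of 1 1] lincomb_mem[OF that, of 1 "-1"] by auto
  have parQ: "Q (\<lambda>x. u x + v x) + Q (\<lambda>x. u x - v x) = 2 * Q u + 2 * Q v" if uv: "u \<in> E" "v \<in> E" for u v
  proof -
    have "Re (L2_inner M (\<lambda>x. u x + v x) (\<lambda>x. u x + v x)) + Re (L2_inner M (\<lambda>x. u x - v x) (\<lambda>x. u x - v x))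
        = 2 * Re (L2_inner M u u) + 2 * Re (L2_inner M v v)"
      by (simp add: par1[OF uv] par2[OF uv] addE uv)
    moreover have "P (\<lambda>x. u x + v x) + P (\<lambda>x. u x - v x) = 2 * P u + 2 * P v"
    proof -
      have "(norm (a + b))\<^sup>2 + (norm (a - b))\<^sup>2 = 2 * (norm a)\<^sup>2 + 2 * (norm b)\<^sup>2" for a b :: complex
        by (simp add: power2_norm_eq_inner inner_add_left inner_add_right inner_diff_left inner_diff_right)
      then have "(norm (L2_inner M (\<lambda>x. u x + v x) f))\<^sup>2 + (norm (L2_inner M (\<lambda>x. u x - v x) f))\<^sup>2 =
          2 * (norm (L2_inner M u f))\<^sup>2 + 2 * (norm (L2_inner M v f))\<^sup>2" if "f \<in> S" for f
        using that S(2) by (subst par1[OF uv], blast, subst par1[OF uv], blast) simp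
      then show ?thesis
        unfolding P_def sum_distrib_left sum.distrib[symmetric] by (rule sum.cong[OF refl])
    qed
    then have "K * P (\<lambda>x. u x + v x) + K * P (\<lambda>x. u x - v x) = 2 * (K * P u) + 2 * (K * P v)"
      by (simp only: distrib_left[symmetric] mult.left_commute[of 2])
    moreover have "a - p + (b - q) = 2 * (a' - p') + 2 * (b' - q')"
      if "a + b = 2 * a' + 2 * b'" "p + q = 2 * p' + 2 * q'" for a b a' b' p q p' q' :: real
      using that by argo
    ultimately show ?thesis unfolding Q_def by blast
  qed
  have "\<exists>\<epsilon>. (\<forall>j. \<epsilon> j = 1 \<or> \<epsilon> j = -1) \<and> (\<lambda>x. \<Sum>j\<in>J. \<epsilon> j * e j x) \<in> E \<and>
      (\<Sum>j\<in>J. Q (e j)) \<le> Q (\<lambda>x. \<Sum>j\<in>J. \<epsilon> j * e j x)"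
  proof (rule exists_signs)
    show "0 \<le> Q (\<lambda>_. 0)" by (simp add: Q_def P_def L2_inner_def)
  qed (fact parQ zero_mem addE J(1) | rule parQ addE J(2), assumption+)+
  then obtain \<epsilon> where \<epsilon>: "\<And>j. \<epsilon> j = 1 \<or> \<epsilon> j = -1" "(\<lambda>x. \<Sum>j\<in>J. \<epsilon> j * e j x) \<in> E"
    "(\<Sum>j\<in>J. Q (e j)) \<le> Q (\<lambda>x. \<Sum>j\<in>J. \<epsilon> j * e j x)" by blast
  define h where "h = (\<lambda>x. \<Sum>j\<in>J. \<epsilon> j * e j x)"
  have hE: "h \<in> E" using \<epsilon>(2) by (simp add: h_def)
  have hC: "norm (h x) \<le> C1" if "x \<in> space M" for x
  proof -
    have "norm (\<epsilon> j) = 1" for j using \<epsilon>(1)[of j] by auto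
    then have "norm (h x) \<le> (\<Sum>j\<in>J. norm (e j x))"
      unfolding h_def by (intro sum_norm_le) (simp add: norm_mult)
    then show ?thesis using J(3)[OF that] by linarith
  qed
  have int_e: "integrable M (\<lambda>x. norm (e j x))" if j: "j \<in> J" for j
  proof -
    obtain A where "\<forall>x\<in>space M. norm (e j x) \<le> A" using bounded_mem[OF J(2)[OF j]] by auto
    then show ?thesis using measurable_mem[OF J(2)[OF j]] by (intro integrable_norm integrable_const_bound[of _ A] AE_I2) auto
  qed
  \<comment> \<open>Of the two L1 norms of \<open>e j\<close> in the squared inner product, one is
    estimated by \<eta> and the other is kept: summed over \<open>j\<close> these are at most C1 m.
    So the number of pieces does not enter.\<close>
  have Pe: "(\<Sum>j\<in>J. P (e j)) \<le> n * B\<^sup>2 * C1 * m * \<eta>"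
  proof -
    have "P (e j) \<le> n * (B\<^sup>2 * \<eta> * (LINT x|M. norm (e j x)))" if j: "j \<in> J" for j
    proof -
      have I0: "0 \<le> (LINT x|M. norm (e j x))" by (rule Bochner_Integration.integral_nonneg) simp
      have "(norm (L2_inner M (e j) f))\<^sup>2 \<le> B\<^sup>2 * \<eta> * (LINT x|M. norm (e j x))" if f: "f \<in> S" for f
      proof -
        have "norm (L2_inner M (e j) f) \<le> B * (LINT x|M. norm (e j x))"
          using f S(2) B by (intro norm_L2_inner_le J(2)[OF j]) auto
        then have "(norm (L2_inner M (e j) f))\<^sup>2 \<le> (B * (LINT x|M. norm (e j x)))\<^sup>2" by (intro power_mono) auto
        also have "\<dots> = B\<^sup>2 * (LINT x|M. norm (e j x)) * (LINT x|M. norm (e j x))" by (simp add: power2_eq_square)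
        also have "\<dots> \<le> B\<^sup>2 * \<eta> * (LINT x|M. norm (e j x))"
          using J(5)[OF j] I0 by (intro mult_right_mono mult_left_mono) auto
        finally show ?thesis .
      qed
      then show ?thesis unfolding P_def n_def by (rule sum_bounded_above)
    qed
    then have "(\<Sum>j\<in>J. P (e j)) \<le> (\<Sum>j\<in>J. n * (B\<^sup>2 * \<eta> * (LINT x|M. norm (e j x))))" by (rule sum_mono)
    also have "\<dots> = n * B\<^sup>2 * \<eta> * (LINT x|M. (\<Sum>j\<in>J. norm (e j x)))"
      using int_e by (simp add: sum_distrib_left mult.assoc)
    also have "\<dots> \<le> n * B\<^sup>2 * \<eta> * (LINT x|M. C1)"
      using \<eta> J(3) int_e by (intro mult_left_mono integral_mono integrable_sum) (auto simp: n_def)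
    also have "\<dots> = n * B\<^sup>2 * C1 * m * \<eta>" by (simp add: m_def)
    finally show ?thesis .
  qed
  have "c / 2 \<le> Q h"
  proof -
    have "c - K * (n * B\<^sup>2 * C1 * m * \<eta>) \<le> (\<Sum>j\<in>J. LINT x|M. (norm (e j x))\<^sup>2) - K * (\<Sum>j\<in>J. P (e j))"
      using Pe J(4) K(1) by (intro diff_mono mult_left_mono) auto
    also have "\<dots> = (\<Sum>j\<in>J. Q (e j))"
      by (simp add: Q_def L2_inner_self sum_subtractf sum_distrib_left)
    also have "\<dots> \<le> Q h" using \<epsilon>(3) by (simp add: h_def)
    finally show ?thesis using \<eta>K by (simp add: mult.assoc)
  qed
  moreover have P0: "0 \<le> P h" unfolding P_def by (intro sum_nonneg) auto
  moreover have "0 \<le> K * P h" using P0 K(1) by simp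
  ultimately have hn: "c / 2 \<le> Re (L2_inner M h h)" "K * P h \<le> Re (L2_inner M h h)"
    using c unfolding Q_def by linarith+
  have "Re (L2_inner M h h) \<le> C1\<^sup>2 * m"
  proof -
    have "Re (L2_inner M h h) = (LINT x|M. (norm (h x))\<^sup>2)" by (simp add: L2_inner_self)
    also have "\<dots> \<le> (LINT x|M. C1\<^sup>2)"
      using hC by (intro integral_mono integrable_norm_square[OF hE] power_mono) auto
    finally show ?thesis by (simp add: m_def mult.commute)
  qed
  then have KP: "K * P h \<le> C1\<^sup>2 * m" using hn(2) by linarith
  have P1: "P h \<le> c / 4"
  proof -
    have "(4 * C1\<^sup>2 * m / c) * P h \<le> K * P h" using K(3) P0 by (rule mult_right_mono)
    then have "(4 * C1\<^sup>2 * m / c) * P h \<le> C1\<^sup>2 * m" using KP by linarith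
    then have 4: "(C1\<^sup>2 * m) * (4 * P h) \<le> (C1\<^sup>2 * m) * c" using c by (simp add: field_simps)
    show ?thesis
    proof (cases "C1\<^sup>2 * m = 0")
      case True
      have "K * P h \<le> 0" using KP unfolding True .
      then have "P h \<le> 0" using K(1) by (simp add: mult_le_0_iff)
      then show ?thesis using c by linarith
    next
      case False
      then have "0 < C1\<^sup>2 * m" using m by (simp add: less_le)
      then have "4 * P h \<le> c" using 4 by (subst (asm) mult_le_cancel_left_pos) auto
      then show ?thesis by simp
    qed
  qed
  have coef: "n * (norm (L2_inner M h f) * B) \<le> 1" if f: "f \<in> S" for f
  proof -
    have "(norm (L2_inner M h f))\<^sup>2 \<le> P h" unfolding P_def using S(1) f by (intro member_le_sum) auto
    then have "(n * B)\<^sup>2 * (norm (L2_inner M h f))\<^sup>2 \<le> (n * B)\<^sup>2 * P h" by (intro mult_left_mono) auto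
    also have "\<dots> \<le> 1"
    proof -
      have "(n * B)\<^sup>2 * (K * P h) \<le> (n * B)\<^sup>2 * (C1\<^sup>2 * m)" using KP by (intro mult_left_mono) auto
      also have "\<dots> \<le> K" using K(2) by (simp add: power_mult_distrib mult.assoc)
      finally have "K * ((n * B)\<^sup>2 * P h) \<le> K * 1" by (simp add: mult.left_commute)
      then show ?thesis using K(1) by (subst (asm) mult_le_cancel_left_pos) auto
    qed
    finally have "(n * (norm (L2_inner M h f) * B))\<^sup>2 \<le> 1\<^sup>2" by (simp add: power_mult_distrib mult_ac)
    then show ?thesis by (rule power2_le_imp_le) simp
  qed
  define r where "r = (\<lambda>x. h x - (\<Sum>f\<in>S. L2_inner M h f * f x))"
  have r: "r \<in> E" "\<And>f. f \<in> S \<Longrightarrow> L2_inner M r f = 0" "Re (L2_inner M r r) = Re (L2_inner M h h) - P h"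
    using residual[OF S hE] by (auto simp: r_def P_def)
  have rC: "norm (r x) \<le> C1 + 1" if x: "x \<in> space M" for x
  proof -
    have "n * norm (\<Sum>f\<in>S. L2_inner M h f * f x) \<le> n * (\<Sum>f\<in>S. norm (L2_inner M h f) * B)"
      using B x by (intro mult_left_mono sum_norm_le) (auto simp: norm_mult n_def intro!: mult_left_mono)
    also have "\<dots> \<le> n * 1"
    proof -
      have "(\<Sum>f\<in>S. n * (norm (L2_inner M h f) * B)) \<le> real (card S) * 1"
        using coef by (intro sum_bounded_above) auto
      then show ?thesis by (simp add: n_def sum_distrib_left)
    qed
    finally have *: "n * norm (\<Sum>f\<in>S. L2_inner M h f * f x) \<le> n * 1" .
    have "norm (\<Sum>f\<in>S. L2_inner M h f * f x) \<le> 1"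
    proof (cases "S = {}")
      case False
      then have "0 < n" using S(1) by (simp add: n_def card_gt_0_iff)
      then show ?thesis using * by (subst (asm) mult_le_cancel_left_pos) auto
    qed simp
    then show ?thesis using hC[OF x] norm_triangle_ineq4[of "h x" "\<Sum>f\<in>S. L2_inner M h f * f x"]
      unfolding r_def by linarith
  qed
  \<comment> \<open>The squared norm of \<open>r\<close> is at least c / 2 - c / 4, while |r| <= C1
    + 1 pointwise. This is the origin of the constant (C1 + 1) / sqrt (c / 4).\<close>
  have rr: "c / 4 \<le> Re (L2_inner M r r)" using r(3) hn(1) P1 by linarith
  then have rpos: "0 < Re (L2_inner M r r)" using c by linarith
  let ?a = "1 / sqrt (Re (L2_inner M r r))"
  show "\<exists>h\<in>E. L2_inner M h h = 1 \<and> (\<forall>f\<in>S. L2_inner M h f = 0) \<and> (\<forall>x\<in>space M. norm (h x) \<le> (C1 + 1) / sqrt (c / 4))"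
  proof (intro bexI[of _ "\<lambda>x. of_real ?a * r x"] conjI ballI)
    show "L2_inner M (\<lambda>x. of_real ?a * r x) (\<lambda>x. of_real ?a * r x) = 1" by (rule normalize[OF r(1) rpos])
    show "(\<lambda>x. of_real ?a * r x) \<in> E" by (rule scale_mem[OF r(1)])
    show "L2_inner M (\<lambda>x. of_real ?a * r x) f = 0" if f: "f \<in> S" for f
      using L2_inner_lincomb_left[OF r(1) r(1), of f "of_real ?a" 0] r(2)[OF f] S(2) f by auto
    fix x assume x: "x \<in> space M"
    have "norm (of_real ?a * r x) = norm (r x) / sqrt (Re (L2_inner M r r))"
      using rpos by (simp add: norm_mult norm_divide)
    also have "\<dots> \<le> (C1 + 1) / sqrt (c / 4)"
      using rC[OF x] rr c C1 by (intro frac_le) auto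
    finally show "norm (of_real ?a * r x) \<le> (C1 + 1) / sqrt (c / 4)" .
  qed
qed

end

section \<open>Peak polynomials\<close>

text \<open>The natural subtraction truncates the exponent at 0, so n = -1, 0, 1 contribute 1 each;
  the rest is dominated by two geometric series.\<close>

lemma sum_geometric_int_le:
  fixes x :: real
  assumes x: "0 \<le> x" "x < 1" and I: "finite (I :: int set)"
  shows "(\<Sum>n\<in>I. x ^ (nat \<bar>n\<bar> - 1)) \<le> 2 * (1 + 1 / (1 - x))"
proof -
  let ?g = "\<lambda>n::int. x ^ (nat \<bar>n\<bar> - 1)"
  define M0 where "M0 = Max (insert 0 (abs ` I))"
  have M0: "\<bar>n\<bar> \<le> M0" if "n \<in> I" for n
    unfolding M0_def using I that by (intro Max_ge) auto
  define M where "M = nat \<bar>M0\<bar>"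
  have sub: "I \<subseteq> {- int M..int M}" using M0 by (force simp: M_def)
  have "(\<Sum>n\<in>I. ?g n) \<le> (\<Sum>n\<in>{- int M..int M}. ?g n)"
    using x sub by (intro sum_mono2) auto
  also have "\<dots> \<le> 2 * (\<Sum>m\<le>M. x ^ (m - 1))"
  proof (induction M)
    case (Suc M)
    have "{- int (Suc M)..int (Suc M)} = insert (- int (Suc M)) (insert (int (Suc M)) {- int M..int M})" by auto
    moreover have "sum ?g (insert a (insert b S)) = ?g a + (?g b + sum ?g S)"
      if "finite S" "a \<notin> insert b S" "b \<notin> S" for a b :: int and S
      using that by simp
    ultimately have "(\<Sum>n\<in>{- int (Suc M)..int (Suc M)}. ?g n) =
        ?g (- int (Suc M)) + (?g (int (Suc M)) + (\<Sum>n\<in>{- int M..int M}. ?g n))"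
      by simp
    also have "\<dots> = 2 * x ^ (Suc M - 1) + (\<Sum>n\<in>{- int M..int M}. ?g n)"
      by (simp only: abs_minus_cancel abs_of_nat nat_int)
    also have "\<dots> \<le> 2 * x ^ (Suc M - 1) + 2 * (\<Sum>m\<le>M. x ^ (m - 1))" using Suc by (rule add_left_mono)
    finally show ?case by (simp add: algebra_simps)
  qed simp
  also have "(\<Sum>m\<le>M. x ^ (m - 1)) \<le> 1 + 1 / (1 - x)"
  proof -
    have "(\<Sum>m\<le>M. x ^ (m - 1)) = 1 + (\<Sum>m<M. x ^ m)"
      by (simp add: sum.atMost_shift)
    also have "(\<Sum>m<M. x ^ m) = (1 - x ^ M) / (1 - x)" using x by (simp add: sum_gp_strict)
    also have "\<dots> \<le> 1 / (1 - x)" using x by (intro divide_right_mono) auto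
    finally show ?thesis by simp
  qed
  finally show ?thesis by simp
qed

text \<open>Enlarging \<open>J\<close> to the full product of its coordinate projections turns the
  sum of products into a product of one-dimensional sums; the bound is independent of
  \<open>J\<close>.\<close>

lemma sum_grid_le:
  fixes x :: real and m :: "'b \<Rightarrow> int"
  assumes x: "0 \<le> x" "x < 1" and B: "finite B" and J: "finite J" "J \<subseteq> extensional B"
  shows "(\<Sum>g\<in>J. \<Prod>b\<in>B. x ^ (nat \<bar>m b - g b\<bar> - 1)) \<le> (2 * (1 + 1 / (1 - x))) ^ card B"
proof -
  let ?I = "\<lambda>b. (\<lambda>g. g b) ` J"
  have "(\<Sum>g\<in>J. \<Prod>b\<in>B. x ^ (nat \<bar>m b - g b\<bar> - 1)) \<le>
      (\<Sum>g\<in>PiE B ?I. \<Prod>b\<in>B. x ^ (nat \<bar>m b - g b\<bar> - 1))"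
    using x B J by (intro sum_mono2 finite_PiE) (auto intro!: prod_nonneg simp: PiE_def Pi_def)
  also have "\<dots> = (\<Prod>b\<in>B. \<Sum>n\<in>?I b. x ^ (nat \<bar>m b - n\<bar> - 1))"
    using B J by (intro prod_sum_PiE[symmetric]) auto
  also have "\<dots> \<le> (\<Prod>b\<in>B. 2 * (1 + 1 / (1 - x)))"
  proof (rule prod_mono)
    fix b assume "b \<in> B"
    have "(\<Sum>n\<in>?I b. x ^ (nat \<bar>m b - n\<bar> - 1)) = (\<Sum>l\<in>(\<lambda>n. m b - n) ` ?I b. x ^ (nat \<bar>l\<bar> - 1))"
      by (subst sum.reindex) (auto simp: inj_on_def)
    also have "\<dots> \<le> 2 * (1 + 1 / (1 - x))" using J by (intro sum_geometric_int_le x) auto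
    finally show "0 \<le> (\<Sum>n\<in>?I b. x ^ (nat \<bar>m b - n\<bar> - 1)) \<and>
        (\<Sum>n\<in>?I b. x ^ (nat \<bar>m b - n\<bar> - 1)) \<le> 2 * (1 + 1 / (1 - x))"
      using x by (auto intro: sum_nonneg)
  qed
  also have "\<dots> = (2 * (1 + 1 / (1 - x))) ^ card B" by simp
  finally show ?thesis .
qed

text \<open>Turns Gaussian decay into geometric decay in the distance of cells: |u - v| is at least
  the distance of the floors minus 1, and a nonnegative integer is at most its square.\<close>

lemma floor_diff_le_square:
  fixes u v :: real
  shows "real (nat \<bar>\<lfloor>u\<rfloor> - \<lfloor>v\<rfloor>\<bar> - 1) \<le> (u - v)\<^sup>2"
proof (cases "\<bar>\<lfloor>u\<rfloor> - \<lfloor>v\<rfloor>\<bar> \<le> 1")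
  case True
  then have "nat \<bar>\<lfloor>u\<rfloor> - \<lfloor>v\<rfloor>\<bar> - 1 = 0" by linarith
  then show ?thesis by simp
next
  case False
  define t where "t = \<bar>\<lfloor>u\<rfloor> - \<lfloor>v\<rfloor>\<bar> - 1"
  have t: "1 \<le> t" using False by (simp add: t_def)
  have "real_of_int t \<le> \<bar>u - v\<bar>" unfolding t_def by linarith
  moreover have t1: "1 \<le> real_of_int t" using t by simp
  ultimately have "real_of_int t * real_of_int t \<le> \<bar>u - v\<bar> * \<bar>u - v\<bar>" by (intro mult_mono) auto
  moreover have "real_of_int t * 1 \<le> real_of_int t * real_of_int t" using t1 by (intro mult_left_mono) auto
  moreover have "real (nat \<bar>\<lfloor>u\<rfloor> - \<lfloor>v\<rfloor>\<bar> - 1) = real_of_int t" using t by (simp add: t_def of_nat_diff nat_diff_distrib)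
  ultimately show ?thesis by (simp add: power2_eq_square abs_mult_self_eq)
qed

text \<open>The \<open>L\<^sub>q\<close> of the overview, with \<nu> for \<open>q - a\<close>. The
  conjugation falls on \<nu>, so the function is holomorphic in \<open>z\<close> while its real part
  is the real inner product.\<close>

definition tangent_form :: "complex ^ 'd \<Rightarrow> complex ^ 'd \<Rightarrow> complex ^ 'd \<Rightarrow> complex" where
  "tangent_form q \<nu> z = (\<Sum>i\<in>UNIV. (q $ i - z $ i) * cnj (\<nu> $ i))"

lemma Re_tangent_form: "Re (tangent_form q \<nu> z) = (q - z) \<bullet> \<nu>"
  by (simp add: tangent_form_def inner_vec_def inner_complex_def)

lemma norm_tangent_form_le:
  fixes q :: "complex ^ 'd"
  shows "norm (tangent_form q \<nu> z) \<le> real CARD('d) * (norm (z - q) * norm \<nu>)"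
proof -
  have "norm (tangent_form q \<nu> z) \<le> (\<Sum>i\<in>(UNIV :: 'd set). norm (z - q) * norm \<nu>)"
    unfolding tangent_form_def
  proof (rule sum_norm_le)
    fix i
    have "norm ((q $ i - z $ i) * cnj (\<nu> $ i)) = norm ((z - q) $ i) * norm (\<nu> $ i)"
      by (simp add: norm_mult norm_minus_commute)
    also have "\<dots> \<le> norm (z - q) * norm \<nu>" by (intro mult_mono Finite_Cartesian_Product.norm_nth_le) auto
    finally show "norm ((q $ i - z $ i) * cnj (\<nu> $ i)) \<le> norm (z - q) * norm \<nu>" .
  qed
  then show ?thesis by simp
qed

lemma holomorphic_polynomial_tangent_form: "holomorphic_polynomial (tangent_form q \<nu>)"
proof -
  have "holomorphic_polynomial (\<lambda>z. \<Sum>i\<in>UNIV. cnj (\<nu> $ i) * q $ i * 1 + (- cnj (\<nu> $ i)) * z $ i)"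
    by (intro holomorphic_polynomial_sum holomorphic_polynomial_lincomb holomorphic_polynomial_const
        holomorphic_polynomial_component)
  also have "(\<lambda>z. \<Sum>i\<in>UNIV. cnj (\<nu> $ i) * q $ i * 1 + (- cnj (\<nu> $ i)) * z $ i) = tangent_form q \<nu>"
    by (simp add: fun_eq_iff tangent_form_def algebra_simps)
  finally show ?thesis .
qed

definition peak :: "real \<Rightarrow> nat \<Rightarrow> complex ^ 'd \<Rightarrow> complex ^ 'd \<Rightarrow> complex ^ 'd \<Rightarrow> complex" where
  "peak K N q \<nu> z = (1 - tangent_form q \<nu> z / of_real K) ^ N"

lemma holomorphic_polynomial_peak: "holomorphic_polynomial (peak K N q \<nu>)"
proof -
  have "holomorphic_polynomial (\<lambda>z. (1 * 1 + (- 1 / of_real K) * tangent_form q \<nu> z) ^ N)"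
    by (intro holomorphic_polynomial_power holomorphic_polynomial_lincomb holomorphic_polynomial_const
        holomorphic_polynomial_tangent_form)
  then show ?thesis unfolding peak_def[abs_def] by simp
qed

text \<open>With w = |z - q|^2, the linear term of |1 - L / K|^2 is at most - w / K by
  \<open>lower\<close>; by |L|^2 <= K w / 2 the quadratic term takes back at most half of it. Then 1
  - s <= exp (- s) applies.\<close>

lemma norm_peak_le:
  fixes q :: "complex ^ 'd"
  assumes \<nu>: "norm \<nu> \<le> R" and lower: "(norm (z - q))\<^sup>2 / 2 \<le> (q - z) \<bullet> \<nu>"
    and K: "2 * (real CARD('d) * R)\<^sup>2 \<le> K" "0 < K"
  shows "norm (peak K N q \<nu> z) \<le> exp (- (real N * (norm (z - q))\<^sup>2 / (4 * K)))"
proof -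
  let ?L = "tangent_form q \<nu> z" let ?w = "(norm (z - q))\<^sup>2"
  have "norm ?L \<le> real CARD('d) * (norm (z - q) * R)"
    by (rule order_trans[OF norm_tangent_form_le]) (use \<nu> in \<open>auto intro!: mult_left_mono\<close>)
  then have "(norm ?L)\<^sup>2 \<le> (real CARD('d) * (norm (z - q) * R))\<^sup>2" by (intro power_mono) auto
  also have "\<dots> = (real CARD('d) * R)\<^sup>2 * ?w" by (simp add: power_mult_distrib)
  also have "\<dots> \<le> (K / 2) * ?w" using K by (intro mult_right_mono) auto
  finally have L: "(norm ?L)\<^sup>2 \<le> K / 2 * ?w" .
  have "(norm (1 - ?L / of_real K))\<^sup>2 = 1 - 2 * Re ?L / K + (norm ?L)\<^sup>2 / K\<^sup>2"
    unfolding cmod_power2 using K(2) by (simp add: Re_divide_of_real Im_divide_of_real power2_diff power_divide add_divide_distrib)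
  also have "\<dots> \<le> 1 - ?w / K + (K / 2 * ?w) / K\<^sup>2"
    using L lower K(2) by (intro add_mono diff_mono divide_right_mono) (auto simp: Re_tangent_form)
  also have "\<dots> = 1 + (- (?w / (2 * K)))" using K(2) by (simp add: power2_eq_square field_simps)
  also have "\<dots> \<le> exp (- (?w / (2 * K)))" by (rule exp_ge_add_one_self)
  also have "\<dots> = (exp (- (?w / (4 * K))))\<^sup>2" by (simp flip: exp_double)
  finally have "norm (1 - ?L / of_real K) \<le> exp (- (?w / (4 * K)))" by (rule power2_le_imp_le) simp
  then have "norm (peak K N q \<nu> z) \<le> exp (- (?w / (4 * K))) ^ N"
    unfolding peak_def norm_power by (intro power_mono) auto
  then show ?thesis by (simp flip: exp_of_nat_mult)
qed

text \<open>The real part of 1 - L / K is at least 1 - 1 / (2N), and Bernoulli's inequality keeps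
  the N-th power of this at least 1 / 2.\<close>

lemma norm_peak_ge:
  assumes upper: "(q - z) \<bullet> \<nu> \<le> K / (2 * real N)" and K: "0 < K" and N: "0 < N"
  shows "1 / 2 \<le> norm (peak K N q \<nu> z)"
proof -
  let ?L = "tangent_form q \<nu> z"
  have N1: "1 / (2 * real N) \<le> 1 / 2" using N by simp
  have "Re ?L / K \<le> 1 / (2 * real N)"
    using divide_right_mono[OF upper, of K] K by (simp add: Re_tangent_form field_simps)
  then have le: "1 - 1 / (2 * real N) \<le> norm (1 - ?L / of_real K)"
    using complex_Re_le_cmod[of "1 - ?L / of_real K"] K by (simp add: Re_divide_of_real)
  have "1 + real N * (- (1 / (2 * real N))) \<le> (1 + - (1 / (2 * real N))) ^ N"
    by (rule Bernoulli_inequality) (use N1 in linarith)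
  also have "\<dots> \<le> norm (1 - ?L / of_real K) ^ N" using le N1 by (intro power_mono) auto
  finally show ?thesis using N by (simp add: peak_def norm_power)
qed

text \<open>One peak is placed in each cell of side \<open>1 / k\<close> meeting \<open>V\<close>, with exponent \<open>N = k\<^sup>2\<close>, so that
  every peak is of size at least \<open>1/2\<close> on its cell and decays like a Gaussian at the scale of the
  cells.\<close>

lemma peak_pieces:
  fixes V :: "(complex ^ 'd) set"
  assumes fin: "finite_measure M" and sets_M: "sets M = sets (restrict_space borel (space M))"
    and V: "bounded V" "V \<in> sets M"
    and R: "0 < R" and C: "0 \<le> C"
    and supp: "\<And>q. q \<in> V \<Longrightarrow> \<exists>\<nu>. norm \<nu> \<le> R \<and> (\<forall>z\<in>space M. (norm (z - q))\<^sup>2 / 2 \<le> (q - z) \<bullet> \<nu>) \<and>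
      (\<forall>z\<in>V. (q - z) \<bullet> \<nu> \<le> C * (norm (z - q))\<^sup>2)"
    and small: "\<And>\<eta>. 0 < \<eta> \<Longrightarrow> \<exists>r>0. \<forall>q\<in>V. measure M (space M \<inter> cball q r) \<le> \<eta>"
  obtains C1 where "0 \<le> C1" "\<And>\<eta>. 0 < \<eta> \<Longrightarrow> \<exists>(J :: (complex ^ 'd \<Rightarrow> int) set) e. finite J \<and>
      (\<forall>j\<in>J. holomorphic_polynomial (e j)) \<and>
      (\<forall>x\<in>space M. (\<Sum>j\<in>J. norm (e j x)) \<le> C1) \<and> measure M V / 4 \<le> (\<Sum>j\<in>J. LINT x|M. (norm (e j x))\<^sup>2) \<and>
      (\<forall>j\<in>J. (LINT x|M. norm (e j x)) \<le> \<eta>)"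
proof -
  interpret finite_measure M by (rule fin)
  define n where "n = real DIM(complex ^ 'd)"
  \<comment> \<open>The first summand serves \<open>norm_peak_le\<close>. The second serves
    \<open>norm_peak_ge\<close>: within a cell |z - q|^2 <= n / N, and C n / N <= K / (2N).\<close>
  define K where "K = 2 * (real CARD('d) * R)\<^sup>2 + 2 * C * n + 1"
  have n: "0 < n" by (simp add: n_def)
  have K: "0 < K" "2 * (real CARD('d) * R)\<^sup>2 \<le> K" "2 * C * n \<le> K"
    using C n by (auto simp: K_def intro!: add_nonneg_pos)
  define x where "x = exp (- (1 / (4 * K)))"
  have x: "0 \<le> x" "x < 1" using K by (auto simp: x_def)
  define C1 where "C1 = (2 * (1 + 1 / (1 - x))) ^ DIM(complex ^ 'd)"
  from supp obtain \<nu> where \<nu>: "\<And>q. q \<in> V \<Longrightarrow> norm (\<nu> q) \<le> R"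
    "\<And>q z. q \<in> V \<Longrightarrow> z \<in> space M \<Longrightarrow> (norm (z - q))\<^sup>2 / 2 \<le> (q - z) \<bullet> \<nu> q"
    "\<And>q z. q \<in> V \<Longrightarrow> z \<in> V \<Longrightarrow> (q - z) \<bullet> \<nu> q \<le> C * (norm (z - q))\<^sup>2"
    by metis
  show ?thesis
  proof (rule that[of C1])
    show "0 \<le> C1" using x by (simp add: C1_def)
    fix \<eta> :: real assume \<eta>: "0 < \<eta>"
    \<comment> \<open>The L1 norm of a peak is split: at most \<eta> / 2 from the ball of radius
      \<open>r\<close>, where the peak is at most 1, and \<eta> / 2 from outside, where it is at
      most exp (- k^2 r^2 / (4 K)). Hence \<open>k\<close> is chosen after \<open>r\<close>.\<close>
    obtain r where r: "0 < r" "\<And>q. q \<in> V \<Longrightarrow> measure M (space M \<inter> cball q r) \<le> \<eta> / 2"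
      using small[of "\<eta> / 2"] \<eta> by auto
    define m where "m = measure M (space M)"
    have m: "0 \<le> m" by (simp add: m_def)
    obtain k :: nat where k: "0 < k" "exp (- (real (k\<^sup>2) * r\<^sup>2 / (4 * K))) * m \<le> \<eta> / 2"
    proof -
      have "((\<lambda>k. exp (- (real (k\<^sup>2) * r\<^sup>2 / (4 * K))) * m) \<longlongrightarrow> 0 * m) sequentially"
      proof (intro tendsto_mult tendsto_const)
        have "filterlim (\<lambda>k. real (k\<^sup>2) * (r\<^sup>2 / (4 * K))) at_top sequentially"
          using r(1) K(1)
          by (intro filterlim_at_top_mult_tendsto_pos[OF tendsto_const] filterlim_compose[OF filterlim_real_sequentially] filterlim_at_top_mono[OF filterlim_ident])
             (auto simp: power2_nat_le_imp_le intro!: always_eventually self_le_power)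
        then show "(\<lambda>k. exp (- (real (k\<^sup>2) * r\<^sup>2 / (4 * K)))) \<longlonglongrightarrow> 0"
          by (intro filterlim_compose[OF exp_at_bot]) (simp add: filterlim_uminus_at_bot)
      qed
      then have "eventually (\<lambda>k. exp (- (real (k\<^sup>2) * r\<^sup>2 / (4 * K))) * m < \<eta> / 2) sequentially"
        using \<eta> by (intro order_tendstoD) auto
      then have "eventually (\<lambda>k. 0 < k \<and> exp (- (real (k\<^sup>2) * r\<^sup>2 / (4 * K))) * m \<le> \<eta> / 2) sequentially"
        using eventually_gt_at_top[of 0] by eventually_elim auto
      then show ?thesis using that by (auto dest: eventually_happens)
    qed
    define N where "N = k\<^sup>2"
    have N: "0 < N" using k by (simp add: N_def)
    define cell where "cell = (\<lambda>y :: complex ^ 'd. restrict (\<lambda>b. \<lfloor>real k * (y \<bullet> b)\<rfloor>) Basis)"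
    define J where "J = cell ` V"
    have "finite J"
    proof -
      obtain B where B: "\<And>y. y \<in> V \<Longrightarrow> norm y \<le> B" using V(1) by (auto simp: bounded_iff)
      have "J \<subseteq> PiE Basis (\<lambda>_. {\<lfloor>- (real k * B)\<rfloor>..\<lfloor>real k * B\<rfloor>})"
      proof
        fix g assume "g \<in> J"
        then obtain y where y: "y \<in> V" "g = cell y" by (auto simp: J_def)
        have "\<lfloor>real k * (y \<bullet> b)\<rfloor> \<in> {\<lfloor>- (real k * B)\<rfloor>..\<lfloor>real k * B\<rfloor>}" if b: "b \<in> Basis" for b
        proof -
          have "\<bar>y \<bullet> b\<bar> \<le> B" using Basis_le_norm[OF b, of y] B[OF y(1)] by linarith
          then have "real k * (y \<bullet> b) \<le> real k * B" "real k * (- B) \<le> real k * (y \<bullet> b)"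
            by (intro mult_left_mono; auto)+
          then show ?thesis by (auto intro!: floor_mono)
        qed
        then show "g \<in> PiE Basis (\<lambda>_. {\<lfloor>- (real k * B)\<rfloor>..\<lfloor>real k * B\<rfloor>})"
          unfolding y cell_def by auto
      qed
      then show ?thesis by (rule finite_subset) (auto intro: finite_PiE)
    qed
    have Jext: "J \<subseteq> extensional Basis" by (auto simp: J_def cell_def)
    \<comment> \<open>One representative in \<open>V\<close> of each cell that meets
      \<open>V\<close>, since support vectors are provided only at points of
      \<open>V\<close>.\<close>
    define q where "q = (\<lambda>g. SOME y. y \<in> V \<and> cell y = g)"
    have q: "q g \<in> V" "cell (q g) = g" if "g \<in> J" for g
      using someI_ex[of "\<lambda>y. y \<in> V \<and> cell y = g"] that by (auto simp: J_def q_def)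
    define e where "e = (\<lambda>g. peak K N (q g) (\<nu> (q g)))"
    have hp: "holomorphic_polynomial (e g)" for g unfolding e_def by (rule holomorphic_polynomial_peak)
    have upper: "norm (e g z) \<le> exp (- (real N * (norm (z - q g))\<^sup>2 / (4 * K)))" if "g \<in> J" "z \<in> space M" for g z
      unfolding e_def using \<nu>(1,2)[OF q(1)[OF that(1)]] that(2) K by (intro norm_peak_le[of _ R]) auto
    have meas: "(\<lambda>z. e g z) \<in> borel_measurable M" for g
    proof -
      have "e g \<in> borel_measurable (restrict_space borel (space M))"
        by (intro measurable_restrict_space1 borel_measurable_continuous_onI continuous_on_holomorphic_polynomial hp)
      then show ?thesis using sets_M by (simp cong: measurable_cong_sets)
    qed
    have e1: "norm (e g z) \<le> 1" if "g \<in> J" "z \<in> space M" for g z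
      using K(1) by (intro order_trans[OF upper[OF that]]) auto
    have int1: "integrable M (\<lambda>z. norm (e g z))" if "g \<in> J" for g
      using e1[OF that] meas[of g] by (intro integrable_norm integrable_const_bound[of _ 1] AE_I2) auto
    have int2: "integrable M (\<lambda>z. (norm (e g z))\<^sup>2)" if "g \<in> J" for g
      using e1[OF that] meas[of g] by (intro integrable_const_bound[of _ 1] AE_I2) (auto simp: power_le_one)
    have sum_le: "(\<Sum>g\<in>J. norm (e g z)) \<le> C1" if z: "z \<in> space M" for z
    proof -
      have "norm (e g z) \<le> (\<Prod>b\<in>Basis. x ^ (nat \<bar>\<lfloor>real k * (z \<bullet> b)\<rfloor> - g b\<bar> - 1))" if g: "g \<in> J" for g
      proof -
        have gb: "g b = \<lfloor>real k * (q g \<bullet> b)\<rfloor>" if "b \<in> Basis" for b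
          using fun_cong[OF q(2)[OF g], of b] that by (simp add: cell_def)
        have "(\<Sum>b\<in>Basis. real (nat \<bar>\<lfloor>real k * (z \<bullet> b)\<rfloor> - g b\<bar> - 1)) \<le> (\<Sum>b\<in>Basis. (real k * (z \<bullet> b) - real k * (q g \<bullet> b))\<^sup>2)"
          using gb floor_diff_le_square by (intro sum_mono) simp
        also have "\<dots> = (real k)\<^sup>2 * (\<Sum>b\<in>Basis. ((z - q g) \<bullet> b)\<^sup>2)"
          by (simp add: sum_distrib_left inner_diff_left power_mult_distrib flip: right_diff_distrib)
        also have "(\<Sum>b\<in>Basis. ((z - q g) \<bullet> b)\<^sup>2) = (norm (z - q g))\<^sup>2"
          unfolding power2_norm_eq_inner euclidean_inner[of "z - q g" "z - q g"] by (simp add: power2_eq_square)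
        finally have t: "(\<Sum>b\<in>Basis. real (nat \<bar>\<lfloor>real k * (z \<bullet> b)\<rfloor> - g b\<bar> - 1)) \<le> real N * (norm (z - q g))\<^sup>2"
          by (simp add: N_def)
        have "norm (e g z) \<le> exp (- (real N * (norm (z - q g))\<^sup>2 / (4 * K)))" by (rule upper[OF g z])
        also have "\<dots> \<le> exp (- ((\<Sum>b\<in>Basis. real (nat \<bar>\<lfloor>real k * (z \<bullet> b)\<rfloor> - g b\<bar> - 1)) / (4 * K)))"
          using divide_right_mono[OF t, of "4 * K"] K(1) by simp
        also have "\<dots> = (\<Prod>b\<in>Basis. x ^ (nat \<bar>\<lfloor>real k * (z \<bullet> b)\<rfloor> - g b\<bar> - 1))"
          unfolding x_def by (simp add: exp_sum sum_divide_distrib flip: exp_of_nat_mult sum_negf)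
        finally show ?thesis .
      qed
      then have "(\<Sum>g\<in>J. norm (e g z)) \<le> (\<Sum>g\<in>J. \<Prod>b\<in>Basis. x ^ (nat \<bar>\<lfloor>real k * (z \<bullet> b)\<rfloor> - g b\<bar> - 1))"
        by (rule sum_mono)
      also have "\<dots> \<le> C1"
        unfolding C1_def using \<open>finite J\<close> Jext x by (intro sum_grid_le) auto
      finally show ?thesis .
    qed
    have lower: "1 / 4 \<le> (\<Sum>g\<in>J. (norm (e g z))\<^sup>2)" if z: "z \<in> V" for z
    proof -
      \<comment> \<open>The peak of the cell containing \<open>z\<close> already suffices; its lower
        bound 1 / 2 is squared to 1 / 4.\<close>
      let ?g = "cell z"
      have g: "?g \<in> J" using z by (simp add: J_def)
      have "\<bar>(z - q ?g) \<bullet> b\<bar> \<le> 1 / real k" if b: "b \<in> Basis" for b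
      proof -
        have "\<lfloor>real k * (z \<bullet> b)\<rfloor> = \<lfloor>real k * (q ?g \<bullet> b)\<rfloor>"
          using fun_cong[OF q(2)[OF g], of b] b by (simp add: cell_def)
        then have "\<bar>real k * (z \<bullet> b) - real k * (q ?g \<bullet> b)\<bar> \<le> 1" by linarith
        then have "real k * \<bar>(z - q ?g) \<bullet> b\<bar> \<le> 1"
          by (simp add: inner_diff_left abs_mult flip: right_diff_distrib)
        then show ?thesis using k by (simp add: field_simps)
      qed
      then have "\<bar>(z - q ?g) \<bullet> b\<bar>\<^sup>2 \<le> (1 / real k)\<^sup>2" if "b \<in> Basis" for b
        using that by (intro power_mono) auto
      then have "(\<Sum>b\<in>Basis. \<bar>(z - q ?g) \<bullet> b\<bar>\<^sup>2) \<le> n * (1 / real k)\<^sup>2"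
        unfolding n_def by (rule sum_bounded_above)
      then have dz: "(norm (z - q ?g))\<^sup>2 \<le> n / real N"
        unfolding power2_norm_eq_inner euclidean_inner[of "z - q ?g" "z - q ?g"]
        by (simp add: power2_eq_square N_def)
      have "(q ?g - z) \<bullet> \<nu> (q ?g) \<le> C * (norm (z - q ?g))\<^sup>2" using \<nu>(3) q(1)[OF g] z by blast
      also have "\<dots> \<le> C * (n / real N)" using dz C by (rule mult_left_mono)
      also have "\<dots> \<le> K / (2 * real N)" using K(3) N by (simp add: field_simps)
      finally have "1 / 2 \<le> norm (e ?g z)" unfolding e_def using K(1) N by (intro norm_peak_ge)
      then have "(1 / 2)\<^sup>2 \<le> (norm (e ?g z))\<^sup>2" by (intro power_mono) auto
      also have "\<dots> \<le> (\<Sum>g\<in>J. (norm (e g z))\<^sup>2)" using \<open>finite J\<close> g by (intro member_le_sum) auto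
      finally show ?thesis by (simp add: power2_eq_square)
    qed
    have "measure M V / 4 = (LINT z|M. indicator V z * (1 / 4))"
      using V(2) by simp
    also have "\<dots> \<le> (LINT z|M. (\<Sum>g\<in>J. (norm (e g z))\<^sup>2))"
    proof (rule integral_mono)
      show "integrable M (\<lambda>z. indicator V z * (1 / 4) :: real)" using V(2) by (intro integrable_mult_left integrable_real_indicator) (auto simp: less_top[symmetric])
      show "integrable M (\<lambda>z. \<Sum>g\<in>J. (norm (e g z))\<^sup>2)" using int2 by (rule Bochner_Integration.integrable_sum)
      show "indicator V z * (1 / 4) \<le> (\<Sum>g\<in>J. (norm (e g z))\<^sup>2)" for z
        using lower[of z] by (auto simp: indicator_def intro!: sum_nonneg)
    qed
    also have "\<dots> = (\<Sum>g\<in>J. LINT z|M. (norm (e g z))\<^sup>2)" using int2 by (rule Bochner_Integration.integral_sum)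
    finally have L2: "measure M V / 4 \<le> (\<Sum>g\<in>J. LINT z|M. (norm (e g z))\<^sup>2)" .
    have L1: "(LINT z|M. norm (e g z)) \<le> \<eta>" if g: "g \<in> J" for g
    proof -
      let ?A = "space M \<inter> cball (q g) r" let ?c = "exp (- (real (k\<^sup>2) * r\<^sup>2 / (4 * K)))"
      have A: "?A \<in> sets M" unfolding sets_M by (auto simp: sets_restrict_space)
      have "(LINT z|M. norm (e g z)) \<le> (LINT z|M. indicator ?A z + ?c)"
      proof (rule integral_mono)
        show "integrable M (\<lambda>z. norm (e g z))" by (rule int1[OF g])
        show "integrable M (\<lambda>z. indicator ?A z + ?c)"
          using A by (intro Bochner_Integration.integrable_add integrable_real_indicator integrable_const) (auto simp: less_top[symmetric])
        fix z assume z: "z \<in> space M"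
        show "norm (e g z) \<le> indicator ?A z + ?c"
        proof (cases "z \<in> cball (q g) r")
          case True
          have "norm (e g z) \<le> 1 + ?c" using e1[OF g z] exp_ge_zero[of "- (real (k\<^sup>2) * r\<^sup>2 / (4 * K))"] by linarith
          then show ?thesis using True z by simp
        next
          case False
          then have "r\<^sup>2 \<le> (norm (z - q g))\<^sup>2" using r(1) by (intro power_mono) (auto simp: dist_norm norm_minus_commute)
          then have "real N * r\<^sup>2 / (4 * K) \<le> real N * (norm (z - q g))\<^sup>2 / (4 * K)"
            using K(1) by (intro divide_right_mono mult_left_mono) auto
          then have "exp (- (real N * (norm (z - q g))\<^sup>2 / (4 * K))) \<le> ?c" unfolding N_def by simp
          with upper[OF g z] have "norm (e g z) \<le> ?c" by (rule order_trans)
          then show ?thesis using False by simp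
        qed
      qed
      also have "\<dots> = measure M ?A + ?c * m"
        using A by (subst Bochner_Integration.integral_add) (auto simp: m_def mult.commute less_top[symmetric] intro!: integrable_real_indicator)
      also have "\<dots> \<le> \<eta> / 2 + \<eta> / 2" using r(2)[OF q(1)[OF g]] k(2) by (intro add_mono)
      finally show ?thesis by simp
    qed
    show "\<exists>(J :: (complex ^ 'd \<Rightarrow> int) set) e. finite J \<and>
      (\<forall>j\<in>J. holomorphic_polynomial (e j)) \<and>
      (\<forall>x\<in>space M. (\<Sum>j\<in>J. norm (e j x)) \<le> C1) \<and> measure M V / 4 \<le> (\<Sum>j\<in>J. LINT x|M. (norm (e j x))\<^sup>2) \<and>
      (\<forall>j\<in>J. (LINT x|M. norm (e j x)) \<le> \<eta>)"
      using \<open>finite J\<close> hp sum_le L2 L1 by (intro exI[of _ J] exI[of _ e] conjI ballI) 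
  qed
qed

section \<open>Surface measure and the basis\<close>

text \<open>Without atoms, continuity from above gives a small ball at each point, and a Lebesgue
  number of the resulting cover makes the radius uniform. This is what makes peaks small in
  L1.\<close>

lemma uniformly_small_balls:
  fixes M :: "'a::metric_space measure"
  assumes fin: "finite_measure M" and sets_M: "sets M = sets (restrict_space borel (space M))"
    and cpt: "compact (space M)" and null: "\<And>x. x \<in> space M \<Longrightarrow> emeasure M {x} = 0" and \<eta>: "0 < \<eta>"
  shows "\<exists>r>0. \<forall>q\<in>space M. measure M (space M \<inter> cball q r) \<le> \<eta>"
proof -
  interpret finite_measure M by (rule fin)
  have msr: "space M \<inter> cball x r \<in> sets M" for x r unfolding sets_M by (auto simp: sets_restrict_space)
  have "\<exists>r>0. measure M (space M \<inter> cball x r) \<le> \<eta>" if x: "x \<in> space M" for x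
  proof -
    define A where "A = (\<lambda>n. space M \<inter> cball x (1 / real (Suc n)))"
    have "range A \<subseteq> sets M" using msr by (auto simp: A_def)
    moreover have "decseq A"
    proof (rule decseq_SucI)
      fix n
      have "1 / real (Suc (Suc n)) \<le> 1 / real (Suc n)" by (intro divide_left_mono) auto
      then show "A (Suc n) \<subseteq> A n" unfolding A_def by auto
    qed
    ultimately have "(\<lambda>n. measure M (A n)) \<longlonglongrightarrow> measure M (\<Inter>n. A n)" by (rule finite_Lim_measure_decseq)
    moreover have "(\<Inter>n. A n) = {x}"
    proof
      show "(\<Inter>n. A n) \<subseteq> {x}"
      proof
        fix y assume y: "y \<in> (\<Inter>n. A n)"
        have "dist x y \<le> 0"
        proof (rule ccontr)
          assume "\<not> dist x y \<le> 0"
          then obtain n where "inverse (real (Suc n)) < dist x y" using reals_Archimedean[of "dist x y"] by auto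
          moreover have "dist x y \<le> 1 / real (Suc n)" using y by (auto simp: A_def)
          ultimately show False by (simp add: inverse_eq_divide)
        qed
        then show "y \<in> {x}" by simp
      qed
      show "{x} \<subseteq> (\<Inter>n. A n)" using x by (auto simp: A_def)
    qed
    ultimately have "(\<lambda>n. measure M (A n)) \<longlonglongrightarrow> 0" using null[OF x] by (simp add: measure_def)
    then have "eventually (\<lambda>n. measure M (A n) < \<eta>) sequentially" using \<eta> by (rule order_tendstoD)
    then obtain n where "measure M (A n) < \<eta>" by (auto dest: eventually_happens)
    then show ?thesis unfolding A_def by (intro exI[of _ "1 / real (Suc n)"] conjI less_imp_le) auto
  qed
  then obtain r where r: "\<And>x. x \<in> space M \<Longrightarrow> 0 < r x" "\<And>x. x \<in> space M \<Longrightarrow> measure M (space M \<inter> cball x (r x)) \<le> \<eta>"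
    by metis
  have cover: "space M \<subseteq> \<Union>((\<lambda>x. ball x (r x)) ` space M)" using r(1) by auto
  have "\<exists>e>0. \<forall>x\<in>space M. \<exists>G\<in>(\<lambda>x. ball x (r x)) ` space M. ball x e \<subseteq> G"
  proof (rule Heine_Borel_lemma[OF cpt cover])
    fix G assume "G \<in> (\<lambda>x. ball x (r x)) ` space M"
    then show "open G" by auto
  next
    fix e :: real
    assume "0 < e" "\<And>x. x \<in> space M \<Longrightarrow> \<exists>G\<in>(\<lambda>x. ball x (r x)) ` space M. ball x e \<subseteq> G"
    then show "\<exists>e>0. \<forall>x\<in>space M. \<exists>G\<in>(\<lambda>x. ball x (r x)) ` space M. ball x e \<subseteq> G" by blast
  qed
  then obtain e where e: "0 < e" "\<And>x. x \<in> space M \<Longrightarrow> \<exists>G\<in>(\<lambda>x. ball x (r x)) ` space M. ball x e \<subseteq> G"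
    by blast
  show ?thesis
  proof (intro exI[of _ "e / 2"] conjI ballI)
    fix q assume "q \<in> space M"
    then obtain x where x: "x \<in> space M" "ball q e \<subseteq> ball x (r x)" using e(2) by blast
    have "cball q (e / 2) \<subseteq> ball q e" using e(1) by auto
    then have "space M \<inter> cball q (e / 2) \<subseteq> space M \<inter> cball x (r x)" using x(2) ball_subset_cball by blast
    then have "measure M (space M \<inter> cball q (e / 2)) \<le> measure M (space M \<inter> cball x (r x))"
      by (intro finite_measure_mono msr)
    then show "measure M (space M \<inter> cball q (e / 2)) \<le> \<eta>" using r(2)[OF x(1)] by linarith
  qed (use e in auto)
qed

section \<open>The normalized surface measure and the assembly of the proof\<close>

lemma space_normalized_surface_measure [simp]: "space (normalized_surface_measure \<Omega>) = frontier \<Omega>"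
  by (simp add: normalized_surface_measure_def surface_measure_def space_restrict_space)

lemma sets_normalized_surface_measure:
  "sets (normalized_surface_measure \<Omega>) = sets (restrict_space borel (frontier \<Omega>))"
  by (simp add: normalized_surface_measure_def surface_measure_def sets_restrict_space)

lemma emeasure_normalized_surface_measure:
  fixes \<Omega> :: "(complex ^ 'd) set"
  assumes "A \<in> sets borel" "A \<subseteq> frontier \<Omega>"
  shows "emeasure (normalized_surface_measure \<Omega>) A =
    hausdorff_outer_measure (2 * real CARD('d) - 1) A / hausdorff_outer_measure (2 * real CARD('d) - 1) (frontier \<Omega>)"
proof -
  have sp: "space (surface_measure \<Omega>) = frontier \<Omega>"
    by (simp add: surface_measure_def space_restrict_space)
  have eq: "emeasure (surface_measure \<Omega>) B = hausdorff_outer_measure (2 * real CARD('d) - 1) B"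
    if "B \<in> sets borel" "B \<subseteq> frontier \<Omega>" for B
    using that unfolding surface_measure_def
    by (subst emeasure_restrict_space) (auto simp: emeasure_hausdorff_measure)
  have "A \<in> sets (surface_measure \<Omega>)"
    using assms by (auto simp: surface_measure_def sets_restrict_space)
  then have "emeasure (normalized_surface_measure \<Omega>) A =
      emeasure (surface_measure \<Omega>) (space (surface_measure \<Omega>) \<inter> A) / emeasure (surface_measure \<Omega>) (space (surface_measure \<Omega>))"
    unfolding normalized_surface_measure_def by (intro emeasure_uniform_measure) auto
  moreover have "frontier \<Omega> \<inter> A = A" using assms(2) by auto
  ultimately show ?thesis using assms by (simp add: sp eq)
qed

theorem proposition2:
  fixes \<Omega> :: "(complex ^ 'd) set"
  assumes "smooth_strictly_pseudoconvex_domain \<Omega>"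
  shows "\<exists>(C :: real) (f :: nat \<Rightarrow> complex ^ 'd \<Rightarrow> complex).
           (\<forall>n. f n \<in> boundary_polynomials \<Omega>) \<and>
           L2_orthonormal (normalized_surface_measure \<Omega>) f \<and>
           boundary_polynomials \<Omega> \<subseteq> L2_closed_span (normalized_surface_measure \<Omega>) (range f) \<and>
           (\<forall>n. \<forall>\<zeta>\<in>frontier \<Omega>. norm (f n \<zeta>) \<le> C)"
proof -
  from assms obtain \<rho> U where "smooth_bounded_domain \<Omega> \<rho> U"
    unfolding smooth_strictly_pseudoconvex_domain_def boundary_defining_function_def smooth_bounded_domain_def
    by blast
  then interpret dom: smooth_bounded_domain \<Omega> \<rho> U .
  define m where "m = 2 * CARD('d) - 1"
  have m: "DIM(complex ^ 'd) = Suc m" "0 < m" "2 * real CARD('d) - 1 = real m"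
  proof -
    have pos: "0 < CARD('d)" by simp
    then have eq: "2 * CARD('d) = Suc m" by (simp add: m_def)
    then show "DIM(complex ^ 'd) = Suc m" by simp
    show "0 < m" using pos eq by linarith
    have "2 * real CARD('d) = real (2 * CARD('d))" by simp
    then show "2 * real CARD('d) - 1 = real m" unfolding eq by simp
  qed
  let ?M = "normalized_surface_measure \<Omega>" and ?H = "hausdorff_outer_measure (real m)"
  let ?V = "dom.far_set"
  have Vborel: "?V \<in> sets borel" using dom.compact_far_set by (simp add: borel_closed compact_imp_closed)
  have V0: "?H ?V \<noteq> 0" by (rule dom.hausdorff_far_set_pos[OF m(1,2)])
  have "?H ?V \<le> ?H (frontier \<Omega>)" by (rule hausdorff_outer_measure_mono[OF dom.far_set_sub])
  then have F0: "?H (frontier \<Omega>) \<noteq> 0" using V0 by auto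
  have Ffin: "?H (frontier \<Omega>) < \<infinity>" by (rule dom.hausdorff_frontier_finite[OF m(1,2)])
  have em: "emeasure ?M A = ?H A / ?H (frontier \<Omega>)" if "A \<in> sets borel" "A \<subseteq> frontier \<Omega>" for A
    using emeasure_normalized_surface_measure[OF that] by (simp add: m(3))
  have fin: "finite_measure ?M"
  proof (rule finite_measureI)
    have "emeasure ?M (space ?M) = ?H (frontier \<Omega>) / ?H (frontier \<Omega>)" by (simp add: em)
    also have "\<dots> = 1" using F0 Ffin by (intro ennreal_divide_self) auto
    finally show "emeasure ?M (space ?M) \<noteq> \<infinity>" by simp
  qed
  then interpret finite_measure ?M .
  have sets_M: "sets ?M = sets (restrict_space borel (space ?M))"
    by (simp add: sets_normalized_surface_measure)
  have null: "emeasure ?M {x} = 0" if "x \<in> space ?M" for x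
    using that m(2) by (simp add: em hausdorff_outer_measure_singleton)
  have VM: "?V \<in> sets ?M" using Vborel dom.far_set_sub by (auto simp: sets_M sets_restrict_space)
  have "0 < emeasure ?M ?V"
    using V0 Ffin by (simp add: em[OF Vborel dom.far_set_sub] ennreal_zero_less_divide zero_less_iff_neq_zero)
  then have Vpos: "0 < measure ?M ?V" by (simp add: emeasure_eq_measure)
  \<comment> \<open>Polynomials on the whole space, not their restrictions: members of
    \<open>boundary_polynomials\<close> have arbitrary values off the boundary and are compared with
    polynomials only at the end.\<close>
  define E where "E = {p :: complex ^ 'd \<Rightarrow> complex. holomorphic_polynomial p}"
  interpret bounded_function_space ?M E
  proof unfold_locales
    show "(\<lambda>_. 0) \<in> E" by (simp add: E_def holomorphic_polynomial_const)
    show "(\<lambda>x. a * f x + b * g x) \<in> E" if "f \<in> E" "g \<in> E" for f g a b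
      using that by (simp add: E_def holomorphic_polynomial_lincomb)
    show "f \<in> borel_measurable ?M" if "f \<in> E" for f
    proof -
      have "f \<in> borel_measurable (restrict_space borel (space ?M))"
        using that by (intro measurable_restrict_space1 borel_measurable_continuous_onI continuous_on_holomorphic_polynomial) (simp add: E_def)
      then show ?thesis using sets_M by (simp cong: measurable_cong_sets)
    qed
    show "\<exists>B. \<forall>x\<in>space ?M. norm (f x) \<le> B" if "f \<in> E" for f
      using compact_imp_bounded[OF compact_continuous_image[OF _ dom.compact_frontier], of f] that
      by (auto simp: E_def continuous_on_holomorphic_polynomial bounded_iff)
  qed
  obtain R C where R: "0 < R" "0 \<le> C"
    "\<And>q. q \<in> ?V \<Longrightarrow> \<exists>\<nu>. norm \<nu> \<le> R \<and> (\<forall>z\<in>frontier \<Omega>. (norm (z - q))\<^sup>2 / 2 \<le> (q - z) \<bullet> \<nu>) \<and>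
      (\<forall>z\<in>?V. (q - z) \<bullet> \<nu> \<le> C * (norm (z - q))\<^sup>2)"
    using dom.far_set_support by blast
  have small: "\<exists>r>0. \<forall>q\<in>?V. measure ?M (space ?M \<inter> cball q r) \<le> \<eta>" if \<eta>: "0 < \<eta>" for \<eta>
  proof -
    have "compact (space ?M)" using dom.compact_frontier by simp
    from uniformly_small_balls[OF fin sets_M this null \<eta>] show ?thesis using dom.far_set_sub by fastforce
  qed
  obtain C1 where C1: "0 \<le> C1" "\<And>\<eta>. 0 < \<eta> \<Longrightarrow> \<exists>(J :: (complex ^ 'd \<Rightarrow> int) set) e. finite J \<and>
      (\<forall>j\<in>J. holomorphic_polynomial (e j)) \<and>
      (\<forall>x\<in>space ?M. (\<Sum>j\<in>J. norm (e j x)) \<le> C1) \<and> measure ?M ?V / 4 \<le> (\<Sum>j\<in>J. LINT x|?M. (norm (e j x))\<^sup>2) \<and>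
      (\<forall>j\<in>J. (LINT x|?M. norm (e j x)) \<le> \<eta>)"
    by (rule peak_pieces[OF fin sets_M compact_imp_bounded[OF dom.compact_far_set] VM R(1,2)])
      (use R(3) small in auto)
  \<comment> \<open>Here c = \<open>measure ?M ?V / 4\<close> bounds the sum of the squared norms of
    the pieces from below, whence the second division by 4.\<close>
  interpret bounded_extension_space ?M E "(C1 + 1) / sqrt (measure ?M ?V / 4 / 4)"
    using C1 Vpos by (intro bounded_extension_of_small_pieces) (simp_all add: E_def)
  \<comment> \<open>Multi-indices form a countable type, so \<open>from_nat\<close> reaches every
    monomial.\<close>
  define G where "G = (\<lambda>k. monomial (from_nat k :: 'd \<Rightarrow> nat))"
  have "G k \<in> E" for k by (simp add: G_def E_def holomorphic_polynomial_monomial)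
  then obtain f where f: "\<And>n. f n \<in> E" "L2_orthonormal ?M f"
    "\<And>n x. x \<in> space ?M \<Longrightarrow> norm (f n x) \<le> (1 + sqrt 2) * ((C1 + 1) / sqrt (measure ?M ?V / 4 / 4)) + 1"
    "\<And>K. \<exists>F. finite F \<and> F \<subseteq> range f \<and> (\<forall>k<K. in_AE_span ?M F (G k))"
    using bounded_orthonormal_basis by blast
  have span: "g \<in> L2_closed_span ?M (range f)" if g: "g \<in> boundary_polynomials \<Omega>" for g
  proof -
    obtain p where p: "holomorphic_polynomial p" "\<And>\<zeta>. \<zeta> \<in> space ?M \<Longrightarrow> g \<zeta> = p \<zeta>"
      using g by (auto simp: boundary_polynomials_def)
    obtain A c where A: "finite A" "p = (\<lambda>z. \<Sum>\<alpha>\<in>A. c \<alpha> * monomial \<alpha> z)"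
      using p(1) unfolding holomorphic_polynomial_iff by blast
    \<comment> \<open>One \<open>F\<close> for all monomials of \<open>p\<close>. For empty
      \<open>A\<close> the maximum is unspecified, but then there is nothing to cover.\<close>
    obtain F where F: "finite F" "F \<subseteq> range f" "\<And>k. k < Suc (Max (to_nat ` A)) \<Longrightarrow> in_AE_span ?M F (G k)"
      using f(4)[of "Suc (Max (to_nat ` A))"] by blast
    have "in_AE_span ?M F (monomial \<alpha>)" if "\<alpha> \<in> A" for \<alpha>
    proof -
      have "to_nat \<alpha> \<le> Max (to_nat ` A)" using A(1) that by (intro Max_ge) auto
      then have "in_AE_span ?M F (G (to_nat \<alpha>))" by (intro F(3)) simp
      then show ?thesis by (simp add: G_def)
    qed
    then have "in_AE_span ?M F p" unfolding A(2) by (intro in_AE_span_sum A(1))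
    then obtain d where d: "AE x in ?M. p x = (\<Sum>h\<in>F. d h * h x)" unfolding in_AE_span_def by blast
    have pL2: "p \<in> L2_space ?M" by (rule mem_L2_space) (simp add: E_def p(1))
    have "g \<in> borel_measurable ?M \<longleftrightarrow> p \<in> borel_measurable ?M"
      using p(2) by (intro measurable_cong)
    moreover have "integrable ?M (\<lambda>x. (norm (g x))\<^sup>2) \<longleftrightarrow> integrable ?M (\<lambda>x. (norm (p x))\<^sup>2)"
      using p(2) by (intro Bochner_Integration.integrable_cong) auto
    ultimately have "g \<in> L2_space ?M" using pL2 by (simp add: L2_space_def)
    \<comment> \<open>\<open>p\<close> is almost everywhere an exact finite combination of basis
      elements, so the same \<open>F\<close> and \<open>d\<close> serve every tolerance.\<close>
    moreover have "L2_norm_on ?M (\<lambda>x. g x - (\<Sum>h\<in>F. d h * h x)) = 0"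
    proof -
      have "AE x in ?M. (norm (g x - (\<Sum>h\<in>F. d h * h x)))\<^sup>2 = 0"
        using d AE_space by eventually_elim (simp add: p(2))
      then show ?thesis unfolding L2_norm_on_def by (subst integral_eq_zero_AE) auto
    qed
    ultimately show ?thesis
      unfolding L2_closed_span_def using F(1,2) by (auto intro!: exI[of _ F] exI[of _ d])
  qed
  show ?thesis
  proof (intro exI conjI allI ballI subsetI)
    show "f n \<in> boundary_polynomials \<Omega>" for n using f(1)[of n] by (auto simp: E_def boundary_polynomials_def)
    show "L2_orthonormal ?M f" by (rule f(2))
    show "g \<in> L2_closed_span ?M (range f)" if "g \<in> boundary_polynomials \<Omega>" for g by (rule span[OF that])
    show "norm (f n \<zeta>) \<le> (1 + sqrt 2) * ((C1 + 1) / sqrt (measure ?M ?V / 4 / 4)) + 1"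
      if "\<zeta> \<in> frontier \<Omega>" for n \<zeta> using f(3)[of \<zeta> n] that by simp
  qed
qed

end
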